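(* Let $\Omega\subset\mathbb R^3$ be a bounded convex domain with $C^3$ boundary. There is $C>0$ depending only on $\Omega$ such that for every small $\epsilon>0$, $S\in L^2\cap L^\infty(\Omega\times\mathbb S^2)$ and $g\in L^2\cap L^\infty(\Gamma^-)$, the unique solution $u$ of $$\epsilon\vec w\cdot\nabla_xu+u-\bar u=S\ \text{in }\Omega\times\mathbb S^2,\qquad u=g\ \text{on }\Gamma^-$$ satisfies $$\|u\|_{L^\infty(\Omega\times\mathbb S^2)}\le C\Big(\epsilon^{-\frac72}\|S\|_{L^2(\Omega\times\mathbb S^2)}+\|S\|_{L^\infty(\Omega\times\mathbb S^2)}+\epsilon^{-2}\|g\|_{L^2(\Gamma^-)}+\|g\|_{L^\infty(\Gamma^-)}\Big).$$
   Context: $\bar u(\vec x)=\frac1{4\pi}\int_{\mathbb S^2}u(\vec x,\vec w)\,\mathrm d\vec w$; $\vec\nu$ is the outward unit normal; $\Gamma^-=\{(\vec x,\vec w):\vec x\in\partial\Omega,\ \vec w\cdot\vec\nu<0\}$ and "$u=g$ on $\Gamma^-$" means $u(\vec x_0,\vec w)=g(\vec x_0,\vec w)$ there. $\|g\|_{L^2(\Gamma^-)}=\big(\int\int_{\Gamma^-}|g|^2|\vec w\cdot\vec\nu|\,\mathrm d\vec w\,\mathrm d\vec x\big)^{1/2}$ with surface measure on $\partial\Omega$. *)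

theory Defs
  imports "HOL-Analysis.Analysis" "HOL-Probability.Probability"
begin

definition H2_delta :: "real \<Rightarrow> (real^3) set \<Rightarrow> ennreal" where
  "H2_delta \<delta> A =
     (INF C \<in> {C :: nat \<Rightarrow> (real^3) set. A \<subseteq> (\<Union>i. C i) \<and>
                 (\<forall>i. bounded (C i) \<and> diameter (C i) \<le> \<delta>)}.
        (\<Sum>i. ennreal (pi / 4 * (diameter (C i))\<^sup>2)))"

definition H2 :: "(real^3) set \<Rightarrow> ennreal" where
  "H2 A = (SUP \<delta> \<in> {0<..}. H2_delta \<delta> A)"

definition surface_measure :: "(real^3) set \<Rightarrow> (real^3) measure" where
  "surface_measure T = measure_of T (sets (restrict_space borel T)) H2"

definition sphere_measure :: "(real^3) measure" where
  "sphere_measure = surface_measure (sphere 0 1)"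

definition grad :: "(real^3 \<Rightarrow> real) \<Rightarrow> real^3 \<Rightarrow> real^3" where
  "grad f x = (\<chi> i. frechet_derivative f (at x) (axis i 1))"

fun Ck :: "nat \<Rightarrow> (real^3) set \<Rightarrow> (real^3 \<Rightarrow> real) \<Rightarrow> bool" where
  "Ck 0 U f = continuous_on U f"
| "Ck (Suc k) U f = ((\<forall>x\<in>U. f differentiable (at x)) \<and> (\<forall>i. Ck k U (\<lambda>x. grad f x $ i)))"

definition local_defining_fn :: "(real^3) set \<Rightarrow> real^3 \<Rightarrow> real \<Rightarrow> (real^3 \<Rightarrow> real) \<Rightarrow> bool" where
  "local_defining_fn \<Omega> x0 r \<rho> \<longleftrightarrow> r > 0 \<and> Ck 3 (ball x0 r) \<rho> \<and>
      (\<forall>x\<in>ball x0 r. x \<in> \<Omega> \<longleftrightarrow> \<rho> x < 0) \<and>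
      (\<forall>x\<in>ball x0 r. grad \<rho> x \<noteq> 0)"

definition C3_boundary :: "(real^3) set \<Rightarrow> bool" where
  "C3_boundary \<Omega> \<longleftrightarrow> (\<forall>x0\<in>frontier \<Omega>. \<exists>r \<rho>. local_defining_fn \<Omega> x0 r \<rho>)"

definition outward_normal :: "(real^3) set \<Rightarrow> real^3 \<Rightarrow> real^3" where
  "outward_normal \<Omega> x0 = (SOME n. \<exists>r \<rho>. local_defining_fn \<Omega> x0 r \<rho> \<and>
                              n = (1 / norm (grad \<rho> x0)) *\<^sub>R grad \<rho> x0)"

definition phase_measure :: "(real^3) set \<Rightarrow> ((real^3) \<times> (real^3)) measure" where
  "phase_measure \<Omega> = lebesgue_on \<Omega> \<Otimes>\<^sub>M sphere_measure"

definition Gamma_minus :: "(real^3) set \<Rightarrow> ((real^3) \<times> (real^3)) set" where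
  "Gamma_minus \<Omega> = {(x, w). x \<in> frontier \<Omega> \<and> w \<in> sphere 0 1 \<and> w \<bullet> outward_normal \<Omega> x < 0}"

definition bdry_phase_measure :: "(real^3) set \<Rightarrow> ((real^3) \<times> (real^3)) measure" where
  "bdry_phase_measure \<Omega> = surface_measure (frontier \<Omega>) \<Otimes>\<^sub>M sphere_measure"

text \<open>Measure on Gamma^- (for L^infinity) and weighted measure |w.nu| d sigma d w (for L^2).\<close>
definition Gamma_minus_measure :: "(real^3) set \<Rightarrow> ((real^3) \<times> (real^3)) measure" where
  "Gamma_minus_measure \<Omega> = density (bdry_phase_measure \<Omega>) (indicator (Gamma_minus \<Omega>))"

definition Gamma_minus_weighted :: "(real^3) set \<Rightarrow> ((real^3) \<times> (real^3)) measure" where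
  "Gamma_minus_weighted \<Omega> = density (bdry_phase_measure \<Omega>)
      (\<lambda>(x, w). ennreal (\<bar>w \<bullet> outward_normal \<Omega> x\<bar>) * indicator (Gamma_minus \<Omega>) (x, w))"

definition L2sq :: "'a measure \<Rightarrow> ('a \<Rightarrow> real) \<Rightarrow> ennreal" where
  "L2sq M f = (\<integral>\<^sup>+ z. ennreal ((f z)\<^sup>2) \<partial>M)"

definition memL2 :: "'a measure \<Rightarrow> ('a \<Rightarrow> real) \<Rightarrow> bool" where
  "memL2 M f \<longleftrightarrow> f \<in> borel_measurable M \<and> L2sq M f < \<infinity>"

definition L2norm :: "'a measure \<Rightarrow> ('a \<Rightarrow> real) \<Rightarrow> real" where
  "L2norm M f = sqrt (enn2real (L2sq M f))"

definition Linf :: "'a measure \<Rightarrow> ('a \<Rightarrow> real) \<Rightarrow> ereal" where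
  "Linf M f = esssup M (\<lambda>z. ereal \<bar>f z\<bar>)"

definition memLinf :: "'a measure \<Rightarrow> ('a \<Rightarrow> real) \<Rightarrow> bool" where
  "memLinf M f \<longleftrightarrow> f \<in> borel_measurable M \<and> Linf M f < \<infinity>"

definition avg :: "(real^3 \<Rightarrow> real^3 \<Rightarrow> real) \<Rightarrow> real^3 \<Rightarrow> real" where
  "avg u x = 1 / (4 * pi) * (\<integral> w. u x w \<partial>sphere_measure)"

definition back_exit :: "(real^3) set \<Rightarrow> real^3 \<Rightarrow> real^3 \<Rightarrow> real" where
  "back_exit \<Omega> x w = Inf {s. 0 \<le> s \<and> x - s *\<^sub>R w \<notin> \<Omega>}"

text \<open>u solves  eps w.grad_x u + u - avg u = S in Omega x S^2, u = g on Gamma^-,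
  in the mild sense (integrated along the characteristic lines x - s w),
  within the class L^2(Omega x S^2).\<close>
definition is_solution ::
  "(real^3) set \<Rightarrow> real \<Rightarrow> (real^3 \<Rightarrow> real^3 \<Rightarrow> real) \<Rightarrow> (real^3 \<Rightarrow> real^3 \<Rightarrow> real)
     \<Rightarrow> (real^3 \<Rightarrow> real^3 \<Rightarrow> real) \<Rightarrow> bool" where
  "is_solution \<Omega> \<epsilon> S g u \<longleftrightarrow>
     memL2 (phase_measure \<Omega>) (\<lambda>(x, w). u x w) \<and>
     (AE z in phase_measure \<Omega>.
        (let x = fst z; w = snd z; \<tau> = back_exit \<Omega> x w;
             F = (\<lambda>s. exp (- s / \<epsilon>) * (avg u (x - s *\<^sub>R w) + S (x - s *\<^sub>R w) w))
         in F integrable_on {0..\<tau>} \<and>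
            u x w = exp (- \<tau> / \<epsilon>) * g (x - \<tau> *\<^sub>R w) w + (1 / \<epsilon>) * integral {0..\<tau>} F))"

end

theory Submission
  imports Defs
begin

text \<open>
  Write $K$ for the scattering operator with kernel
  $k(z) = e^{-|z|/\epsilon} / (4\pi\epsilon|z|^2)$ and $f$ for the average of $|S|$ over directions and
  over an exponentially distributed path length. The mild formulation shows that
  $W = (|\bar u| - \|g\|_\infty)^+$ satisfies $W \le K W + f$. A quartic barrier $\Phi$ with
  $K\Phi \le \Phi - \epsilon^2$ and Schur's test give
  $\|W\|_2 \le C \epsilon^{-2} \|S\|_2$. The part of $k$ outside the ball of radius $\epsilon/2$ has
  $L^2$ norm $O(\epsilon^{-3/2})$ and the part inside has mass at most $1/2$, so truncating $W$ at
  twice the remaining contribution yields $\|W\|_\infty \le C(\epsilon^{-7/2}\|S\|_2 + \|S\|_\infty)$,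
  which carries over to $u$ along characteristics.

  The kernel $k$ appears only after polar coordinates, so the Hausdorff measure on the sphere has
  to be dominated by the cone measure with its exact constant. This is possible by covering with
  caps, whose area $\pi r^2$ is exactly $\pi/4$ times the square of $2r$, and avoids the
  isodiametric inequality.
\<close>

section \<open>Two-dimensional Hausdorff measure\<close>

text \<open>The kernel k is a probability density, so K alone contracts nothing. All that can be
  gained is the \<epsilon>^2 that the barrier wins at each point, a contraction factor 1 -
  O(\<epsilon>^2). A fixed constant above 1 in the comparison of the two sphere measures would
  outweigh this gain for small \<epsilon>; hence the insistence on the exact constant.

  Passing to the excess over the supremum of g keeps the boundary data away from all negative powers
  of \<epsilon>: along a characteristic the weights exp(-t/\<epsilon>) of the exit value and 1 -
  exp(-t/\<epsilon>) of the path add up to 1, so a constant is reproduced without loss.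

  Two measure-theoretic obstacles shape the rest. The data are measurable only for the completed
  Lebesgue measure, while line averages compose them with x - s w, so Borel representatives off a
  null set are carried along. And g is controlled only almost everywhere on Gamma^-, so null sets of
  the boundary must be shown to cast null shadows along characteristics; this uses that the boundary
  has finite area.\<close>

lemma H2_delta_le:
  assumes "A \<subseteq> (\<Union>i. C i)" "\<And>i. bounded (C i)" "\<And>i. diameter (C i) \<le> \<delta>"
  shows "H2_delta \<delta> A \<le> (\<Sum>i. ennreal (pi / 4 * (diameter (C i))\<^sup>2))"
  unfolding H2_delta_def using assms by (intro INF_lower) auto

lemma H2_delta_greatest:
  assumes "\<And>C :: nat \<Rightarrow> (real^3) set. A \<subseteq> (\<Union>i. C i) \<Longrightarrow> (\<And>i. bounded (C i)) \<Longrightarrow>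
    (\<And>i. diameter (C i) \<le> \<delta>) \<Longrightarrow> X \<le> (\<Sum>i. ennreal (pi / 4 * (diameter (C i))\<^sup>2))"
  shows "X \<le> H2_delta \<delta> A"
  unfolding H2_delta_def using assms by (intro INF_greatest) auto

lemma H2_delta_mono: "A \<subseteq> B \<Longrightarrow> H2_delta \<delta> A \<le> H2_delta \<delta> B"
  by (rule H2_delta_greatest, rule H2_delta_le) auto

lemma H2_delta_antimono: "\<delta> \<le> \<eta> \<Longrightarrow> H2_delta \<eta> A \<le> H2_delta \<delta> A"
  by (rule H2_delta_greatest, rule H2_delta_le) (auto intro: order_trans)

lemma H2_delta_empty: "0 \<le> \<delta> \<Longrightarrow> H2_delta \<delta> {} = 0"
  using H2_delta_le[of "{}" "\<lambda>_. {}" \<delta>] by simp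

lemma H2_delta_near_cover:
  assumes "H2_delta \<delta> A < X"
  obtains C where "A \<subseteq> (\<Union>i. C i)" "\<And>i. bounded (C i)" "\<And>i. diameter (C i) \<le> \<delta>"
    "(\<Sum>i. ennreal (pi / 4 * (diameter (C i))\<^sup>2)) < X"
  using assms unfolding H2_delta_def INF_less_iff by auto

lemma H2_delta_UN: "H2_delta \<delta> (\<Union>i. A i) \<le> (\<Sum>i. H2_delta \<delta> (A i))"
proof (cases "(\<Sum>i. H2_delta \<delta> (A i)) = \<top>")
  case False
  show ?thesis
  proof (rule ennreal_le_epsilon)
    fix e :: real assume e: "0 < e"
    have fin: "H2_delta \<delta> (A i) < \<top>" for i
      by (rule ennreal_suminf_lessD) (use False in \<open>simp only: less_top\<close>)
    have "\<exists>C. A i \<subseteq> (\<Union>j. C j) \<and> (\<forall>j. bounded (C j)) \<and> (\<forall>j. diameter (C j) \<le> \<delta>) \<and>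
       (\<Sum>j. ennreal (pi / 4 * (diameter (C j))\<^sup>2)) < H2_delta \<delta> (A i) + ennreal (e * (1/2)^Suc i)" for i
    proof -
      have "0 < ennreal (e * (1/2)^Suc i)" using e by simp
      then have "H2_delta \<delta> (A i) < H2_delta \<delta> (A i) + ennreal (e * (1/2)^Suc i)"
        using fin[of i] by (cases "H2_delta \<delta> (A i)") (simp_all add: ennreal_less_iff flip: ennreal_plus)
      then obtain C where "A i \<subseteq> (\<Union>j. C j)" "\<And>j. bounded (C j)" "\<And>j. diameter (C j) \<le> \<delta>"
        "(\<Sum>j. ennreal (pi / 4 * (diameter (C j))\<^sup>2)) < H2_delta \<delta> (A i) + ennreal (e * (1/2)^Suc i)"
        by (rule H2_delta_near_cover) blast
      then show ?thesis by blast
    qed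
    from choice[OF allI, OF this] obtain C
      where C': "\<forall>i. A i \<subseteq> (\<Union>j. C i j) \<and> (\<forall>j. bounded (C i j)) \<and> (\<forall>j. diameter (C i j) \<le> \<delta>) \<and>
       (\<Sum>j. ennreal (pi / 4 * (diameter (C i j))\<^sup>2)) < H2_delta \<delta> (A i) + ennreal (e * (1/2)^Suc i)" ..
    then have C: "\<And>i. A i \<subseteq> (\<Union>j. C i j)" "\<And>i j. bounded (C i j)" "\<And>i j. diameter (C i j) \<le> \<delta>"
       "\<And>i. (\<Sum>j. ennreal (pi / 4 * (diameter (C i j))\<^sup>2)) < H2_delta \<delta> (A i) + ennreal (e * (1/2)^Suc i)"
      by blast+
    define D where "D n = (case prod_decode n of (i, j) \<Rightarrow> C i j)" for n
    have "H2_delta \<delta> (\<Union>i. A i) \<le> (\<Sum>n. ennreal (pi / 4 * (diameter (D n))\<^sup>2))"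
    proof (rule H2_delta_le)
      show "(\<Union>i. A i) \<subseteq> (\<Union>n. D n)"
      proof
        fix x assume "x \<in> (\<Union>i. A i)"
        then obtain i j where "x \<in> C i j" using C(1) by blast
        then have "x \<in> D (prod_encode (i, j))" by (simp add: D_def)
        then show "x \<in> (\<Union>n. D n)" by blast
      qed
      fix n
      obtain i j where "prod_decode n = (i, j)" by fastforce
      then have "D n = C i j" by (simp add: D_def)
      then show "bounded (D n)" "diameter (D n) \<le> \<delta>" using C(2,3) by auto
    qed
    also have "\<dots> = (\<Sum>i. \<Sum>j. ennreal (pi / 4 * (diameter (C i j))\<^sup>2))"
      unfolding D_def by (rule suminf_ennreal_2dimen) simp
    also have "\<dots> \<le> (\<Sum>i. H2_delta \<delta> (A i) + ennreal (e * (1/2)^Suc i))"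
      using C(4) by (intro suminf_le) (auto intro: less_imp_le)
    also have "\<dots> = (\<Sum>i. H2_delta \<delta> (A i)) + (\<Sum>i. ennreal (e * (1/2)^Suc i))"
      by (intro suminf_add[symmetric]) auto
    also have "(\<Sum>i. ennreal (e * (1/2)^Suc i)) = ennreal e"
    proof (rule suminf_ennreal_eq)
      show "(\<lambda>i. e * (1/2)^Suc i) sums e"
        using sums_mult[OF power_half_series, of e] by (simp only: mult_1_right)
    qed (use e in auto)
    finally show "H2_delta \<delta> (\<Union>i. A i) \<le> (\<Sum>i. H2_delta \<delta> (A i)) + ennreal e" .
  qed
qed simp

lemma H2_delta_le_H2: "0 < \<delta> \<Longrightarrow> H2_delta \<delta> A \<le> H2 A"
  unfolding H2_def by (intro SUP_upper) auto

lemma H2_leI: "(\<And>\<delta>. 0 < \<delta> \<Longrightarrow> H2_delta \<delta> A \<le> X) \<Longrightarrow> H2 A \<le> X"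
  unfolding H2_def by (intro SUP_least) auto

lemma H2_mono: "A \<subseteq> B \<Longrightarrow> H2 A \<le> H2 B"
  by (rule H2_leI, rule order_trans[OF H2_delta_mono H2_delta_le_H2])

lemma H2_empty [simp]: "H2 {} = 0"
proof -
  have "H2 {} \<le> 0" by (rule H2_leI) (simp add: H2_delta_empty)
  then show ?thesis by simp
qed

lemma H2_UN: "H2 (\<Union>i. A i) \<le> (\<Sum>i. H2 (A i))"
  by (rule H2_leI, rule order_trans[OF H2_delta_UN], intro suminf_le) (auto intro: H2_delta_le_H2)

lemma H2_Un: "H2 (A \<union> B) \<le> H2 A + H2 B"
proof -
  have "H2 (A \<union> B) = H2 (\<Union>i. binaryset A B i)" by (simp only: UN_binaryset_eq)
  also have "\<dots> \<le> (\<Sum>i. H2 (binaryset A B i))" by (rule H2_UN)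
  also have "\<dots> = H2 A + H2 B" by (rule suminf_binaryset_eq) simp
  finally show ?thesis .
qed

text \<open>The metric property of an outer measure: once \<delta> < d, a covering set of diameter
  at most \<delta> cannot meet both A and B, so every cover splits into two covers with no member
  counted twice.\<close>

lemma H2_add_separated:
  assumes sep: "0 < d" "\<And>x y. x \<in> A \<Longrightarrow> y \<in> B \<Longrightarrow> d \<le> dist x y"
  shows "H2 A + H2 B \<le> H2 (A \<union> B)"
proof -
  have key: "H2_delta \<delta> A + H2_delta \<delta> B \<le> H2_delta \<delta> (A \<union> B)" if \<delta>: "0 < \<delta>" "\<delta> < d" for \<delta>
  proof (rule H2_delta_greatest)
    fix C :: "nat \<Rightarrow> (real^3) set"
    assume C: "A \<union> B \<subseteq> (\<Union>i. C i)" "\<And>i. bounded (C i)" "\<And>i. diameter (C i) \<le> \<delta>"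
    define CA where "CA i = (if C i \<inter> A = {} then {} else C i)" for i
    define CB where "CB i = (if C i \<inter> B = {} then {} else C i)" for i
    have disj: "C i \<inter> A = {} \<or> C i \<inter> B = {}" for i
    proof (rule ccontr)
      assume "\<not> ?thesis"
      then obtain x y where "x \<in> C i" "x \<in> A" "y \<in> C i" "y \<in> B" by blast
      then show False
        using sep(2)[of x y] diameter_bounded_bound[OF C(2), of x i y] C(3)[of i] \<delta> by linarith
    qed
    have "H2_delta \<delta> A \<le> (\<Sum>i. ennreal (pi / 4 * (diameter (CA i))\<^sup>2))"
    proof (rule H2_delta_le)
      show "A \<subseteq> (\<Union>i. CA i)"
      proof
        fix x assume x: "x \<in> A"
        then obtain i where "x \<in> C i" using C(1) by blast
        then have "x \<in> CA i" using x by (auto simp: CA_def)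
        then show "x \<in> (\<Union>i. CA i)" by blast
      qed
    qed (use C \<delta> in \<open>auto simp: CA_def\<close>)
    moreover have "H2_delta \<delta> B \<le> (\<Sum>i. ennreal (pi / 4 * (diameter (CB i))\<^sup>2))"
    proof (rule H2_delta_le)
      show "B \<subseteq> (\<Union>i. CB i)"
      proof
        fix x assume x: "x \<in> B"
        then obtain i where "x \<in> C i" using C(1) by blast
        then have "x \<in> CB i" using x by (auto simp: CB_def)
        then show "x \<in> (\<Union>i. CB i)" by blast
      qed
    qed (use C \<delta> in \<open>auto simp: CB_def\<close>)
    moreover have "(\<Sum>i. ennreal (pi / 4 * (diameter (CA i))\<^sup>2)) + (\<Sum>i. ennreal (pi / 4 * (diameter (CB i))\<^sup>2))
        \<le> (\<Sum>i. ennreal (pi / 4 * (diameter (C i))\<^sup>2))"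
    proof (subst suminf_add)
      show "(\<Sum>i. ennreal (pi / 4 * (diameter (CA i))\<^sup>2) + ennreal (pi / 4 * (diameter (CB i))\<^sup>2))
        \<le> (\<Sum>i. ennreal (pi / 4 * (diameter (C i))\<^sup>2))"
        using disj by (intro suminf_le) (auto simp: CA_def CB_def)
    qed auto
    ultimately show "H2_delta \<delta> A + H2_delta \<delta> B \<le> (\<Sum>i. ennreal (pi / 4 * (diameter (C i))\<^sup>2))"
      by (meson add_mono order_trans)
  qed
  have "H2 A + H2 B = (SUP \<delta>\<in>{0<..}. H2_delta \<delta> A + H2_delta \<delta> B)"
    unfolding H2_def
  proof (rule SUP_add_directed_ennreal[symmetric])
    fix i j :: real assume "i \<in> {0<..}" "j \<in> {0<..}"
    then show "\<exists>k\<in>{0<..}. H2_delta i A + H2_delta j B \<le> H2_delta k A + H2_delta k B"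
      by (intro bexI[of _ "min i j"] add_mono H2_delta_antimono) auto
  qed
  also have "\<dots> \<le> H2 (A \<union> B)"
  proof (rule SUP_least)
    fix \<delta> :: real assume "\<delta> \<in> {0<..}"
    then have "H2_delta \<delta> A + H2_delta \<delta> B \<le> H2_delta (min \<delta> (d/2)) A + H2_delta (min \<delta> (d/2)) B"
      by (intro add_mono H2_delta_antimono) auto
    also have "\<dots> \<le> H2_delta (min \<delta> (d/2)) (A \<union> B)"
      using \<open>\<delta> \<in> {0<..}\<close> \<open>0 < d\<close> by (intro key) auto
    also have "\<dots> \<le> H2 (A \<union> B)" using \<open>\<delta> \<in> {0<..}\<close> \<open>0 < d\<close> by (intro H2_delta_le_H2) auto
    finally show "H2_delta \<delta> A + H2_delta \<delta> B \<le> H2 (A \<union> B)" .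
  qed
  finally show ?thesis .
qed

text \<open>Caratheodory's criterion. A - C is exhausted by the sets \<open>B n\<close> at distance
  at least 1/(n+1) from C, where separation applies. The rest is controlled by the layers D: layers
  of equal parity are mutually separated, so each of the two subseries sums to at most
  \<open>H2 A\<close>, and the tails of the full series tend to 0.\<close>

lemma H2_closed_split:
  fixes C :: "(real^3) set"
  assumes "closed C"
  shows "H2 (A \<inter> C) + H2 (A - C) \<le> H2 A"
\<comment> \<open>The empty C is split off because \<open>infdist x {}\<close> is 0, which would
  leave every \<open>B n\<close> empty.\<close>
proof (cases "H2 A = \<top> \<or> C = {}")
  case True
  then show ?thesis by auto
next
  case False
  then have fin: "H2 A < \<top>" and ne: "C \<noteq> {}" by (auto simp: less_top)
  define B where "B n = {x \<in> A. 1 / real (Suc n) \<le> infdist x C}" for n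
  define D where "D n = B (Suc n) - B n" for n
  have B_mono: "B m \<subseteq> B n" if "m \<le> n" for m n
  proof -
    have "1 / real (Suc n) \<le> 1 / real (Suc m)" using that by (simp add: field_simps)
    then show ?thesis by (auto simp: B_def)
  qed
  have BA: "B n \<subseteq> A - C" for n
    by (auto simp: B_def)
  have sepB: "1 / real (Suc n) \<le> dist x y" if "x \<in> A \<inter> C" "y \<in> B n" for x y n
    using that infdist_le[of x C y] by (auto simp: B_def dist_commute)
  have AC: "A - C \<subseteq> B n \<union> (\<Union>k. D (n + k))" for n
  proof
    fix x assume x: "x \<in> A - C"
    then have "0 < infdist x C"
      using assms ne infdist_nonneg[of x C] in_closed_iff_infdist_zero[of C x] by fastforce
    then obtain m where "1 / real (Suc m) < infdist x C"
      using nat_approx_posE by blast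
    then have "x \<in> B m" using x by (auto simp: B_def)
    then have ex: "\<exists>m. x \<in> B m" ..
    define l where "l = (LEAST m. x \<in> B m)"
    have l: "x \<in> B l" "\<And>m. m < l \<Longrightarrow> x \<notin> B m"
      using LeastI_ex[OF ex] not_less_Least unfolding l_def by auto
    show "x \<in> B n \<union> (\<Union>k. D (n + k))"
    proof (cases "l \<le> n")
      case True then show ?thesis using l(1) B_mono by blast
    next
      case False
      then have "x \<in> D (n + (l - 1 - n))"
        using l by (auto simp: D_def)
      then show ?thesis by blast
    qed
  qed
  have sepD: "(\<Sum>i<N. H2 (D (2 * i + p))) \<le> H2 (\<Union>i<N. D (2 * i + p))" for N p
  proof (induction N)
    case (Suc N)
    let ?U = "\<Union>i<N. D (2 * i + p)"
    \<comment> \<open>Earlier layers keep distance 1/(2N+p) from C, the new one lies closer than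
      1/(2N+p+1). For N = 0 the union is empty and any positive d will do; the formula would involve
      1/0 = 0 when p = 0 and be negative.\<close>
    define d where "d = (if N = 0 then 1 else 1 / real (2 * N + p) - 1 / real (Suc (2 * N + p)))"
    have a: "H2 ?U + H2 (D (2 * N + p)) \<le> H2 (?U \<union> D (2 * N + p))"
    proof (rule H2_add_separated)
      show "0 < d" unfolding d_def by (auto simp: divide_simps)
      fix x y assume x: "x \<in> ?U" and y: "y \<in> D (2 * N + p)"
      then obtain i where i: "i < N" "x \<in> D (2 * i + p)" by blast
      then have "Suc (2 * i + p) \<le> 2 * N + p - 1" by linarith
      then have "x \<in> B (2 * N + p - 1)"
        using i B_mono[of "Suc (2 * i + p)" "2 * N + p - 1"] by (auto simp: D_def)
      then have 1: "1 / real (2 * N + p) \<le> infdist x C" using i(1) by (auto simp: B_def)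
      have "y \<notin> B (2 * N + p)" "y \<in> A" using y by (auto simp: D_def B_def)
      then have 2: "infdist y C < 1 / real (Suc (2 * N + p))" by (auto simp: B_def)
      have "infdist x C \<le> infdist y C + dist x y" by (rule infdist_triangle)
      moreover have "d = 1 / real (2 * N + p) - 1 / real (Suc (2 * N + p))"
        using i(1) unfolding d_def by simp
      ultimately show "d \<le> dist x y" using 1 2 by linarith
    qed
    have b: "(\<Union>i<Suc N. D (2 * i + p)) = ?U \<union> D (2 * N + p)"
      by (auto simp: lessThan_Suc)
    have c: "(\<Sum>i<Suc N. H2 (D (2 * i + p))) \<le> H2 ?U + H2 (D (2 * N + p))"
      unfolding sum.lessThan_Suc by (rule add_right_mono[OF Suc])
    show ?case unfolding b by (rule order_trans[OF c a])
  qed simp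
  have parity: "(\<Sum>i. H2 (D (2 * i + p))) \<le> H2 A" for p
  proof (rule suminf_le_const)
    show "(\<Sum>i<N. H2 (D (2 * i + p))) \<le> H2 A" for N
      by (rule order_trans[OF sepD H2_mono]) (auto simp: D_def B_def)
  qed simp
  have "(\<Sum>i. H2 (D i)) \<le> H2 A + H2 A"
  proof (rule suminf_le_const)
    fix n
    have "(\<Sum>i<n. H2 (D i)) \<le> (\<Sum>i<2*n. H2 (D i))" by (intro sum_mono2) auto
    also have "\<dots> = (\<Sum>i<n. H2 (D (2 * i))) + (\<Sum>i<n. H2 (D (2 * i + 1)))"
      by (induction n) (auto simp: algebra_simps)
    also have "\<dots> \<le> (\<Sum>i. H2 (D (2 * i + 0))) + (\<Sum>i. H2 (D (2 * i + 1)))"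
      by (intro add_mono) (auto intro!: sum_le_suminf)
    also have "\<dots> \<le> H2 A + H2 A" by (intro add_mono parity)
    finally show "(\<Sum>i<n. H2 (D i)) \<le> H2 A + H2 A" .
  qed simp
  also have "\<dots> < \<top>" using fin by simp
  finally have finD: "(\<Sum>i. H2 (D i)) < \<top>" .
  have "H2 (A \<inter> C) + H2 (A - C) \<le> H2 A + (\<Sum>k. H2 (D (n + k)))" for n
  proof -
    have "H2 (A - C) \<le> H2 (B n) + H2 (\<Union>k. D (n + k))"
      using H2_mono[OF AC] H2_Un order_trans by blast
    also have "\<dots> \<le> H2 (B n) + (\<Sum>k. H2 (D (n + k)))" by (intro add_left_mono H2_UN)
    finally have "H2 (A \<inter> C) + H2 (A - C) \<le> (H2 (A \<inter> C) + H2 (B n)) + (\<Sum>k. H2 (D (n + k)))"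
      by (metis add.assoc add_left_mono)
    also have "H2 (A \<inter> C) + H2 (B n) \<le> H2 (A \<inter> C \<union> B n)"
      using sepB by (intro H2_add_separated[of "1 / real (Suc n)"]) auto
    also have "\<dots> \<le> H2 A" by (rule H2_mono) (auto simp: B_def)
    finally show ?thesis by (simp add: add_right_mono)
  qed
  moreover have "(\<lambda>n. H2 A + (\<Sum>k. H2 (D (n + k)))) \<longlonglongrightarrow> H2 A + 0"
  proof (intro tendsto_add tendsto_const)
    have eq: "(\<Sum>k. H2 (D (n + k))) = (\<Sum>k. H2 (D k)) - (\<Sum>k<n. H2 (D k))" for n
    proof -
      have "(\<Sum>k. H2 (D k)) = (\<Sum>k. H2 (D (k + n))) + (\<Sum>k<n. H2 (D k))"
        by (rule suminf_offset) simp
      moreover have "(\<Sum>k<n. H2 (D k)) \<noteq> \<top>"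
        using finD sum_le_suminf[of "\<lambda>k. H2 (D k)" "{..<n}"]
        by (metis finite_lessThan linorder_not_less summableI top_greatest zero_le)
      ultimately show ?thesis by (simp add: add.commute)
    qed
    have "(\<lambda>n. (\<Sum>k. H2 (D k)) - (\<Sum>k<n. H2 (D k))) \<longlonglongrightarrow> (\<Sum>k. H2 (D k)) - (\<Sum>k. H2 (D k))"
      using finD by (intro tendsto_diff_ennreal tendsto_const summable_LIMSEQ) auto
    then show "(\<lambda>n. \<Sum>k. H2 (D (n + k))) \<longlonglongrightarrow> 0"
      using finD by (simp add: eq)
  qed
  ultimately show ?thesis
    using LIMSEQ_le_const by fastforce
qed

text \<open>\<open>measure_of\<close> falls back to the zero measure on a set function that is not
  countably additive, so the definitions built on \<open>H2\<close> carry content only after this.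
  The Caratheodory-measurable sets form a sigma-algebra containing the closed sets, hence all Borel
  sets.\<close>

lemma measure_space_H2_borel: "measure_space UNIV (sets borel) H2"
proof -
  interpret sigma_algebra "UNIV :: (real^3) set" UNIV
    using sigma_algebra_Pow[of UNIV] by simp
  have oms: "outer_measure_space UNIV H2"
    unfolding outer_measure_space_def positive_def increasing_def countably_subadditive_def
    using H2_mono H2_UN by auto
  let ?L = "lambda_system UNIV UNIV H2"
  have ms: "measure_space UNIV ?L H2" by (rule caratheodory_lemma[OF oms])
  have "closed C \<Longrightarrow> C \<in> ?L" for C
    unfolding lambda_system_def
  proof safe
    fix x assume "closed C"
    have "H2 x \<le> H2 (x \<inter> C) + H2 (x - C)" using H2_Un[of "x \<inter> C" "x - C"]
      by (metis Int_Diff_Un)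
    with H2_closed_split[OF \<open>closed C\<close>, of x]
    show "H2 (C \<inter> x) + H2 ((UNIV - C) \<inter> x) = H2 x"
      by (simp add: Int_commute Diff_eq Compl_eq_Diff_UNIV[symmetric] antisym)
  qed auto
  moreover have "sigma_algebra UNIV ?L" using ms by (simp add: measure_space_def)
  ultimately have "sets borel \<subseteq> ?L"
    unfolding borel_eq_closed
    by (simp add: sets_measure_of) (metis (no_types, lifting) mem_Collect_eq sigma_algebra.sigma_sets_subset subsetI)
  moreover have "sigma_algebra UNIV (sets (borel :: (real^3) measure))"
    using sets.sigma_algebra_axioms[of "borel :: (real^3) measure"] by simp
  ultimately show ?thesis using measure_down[OF ms] by blast
qed

section \<open>Surface measure as the restriction of two-dimensional Hausdorff measure\<close>

lemma sets_surface_measure: "T \<in> sets borel \<Longrightarrow> sets (surface_measure T) = sets (restrict_space borel T)"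
  and space_surface_measure: "space (surface_measure T) = T"
proof -
  have sub: "sets (restrict_space borel T) \<subseteq> Pow T" for T :: "(real^3) set"
    using sets.space_closed[of "restrict_space borel T"] by (simp add: space_restrict_space)
  show "space (surface_measure T) = T"
    unfolding surface_measure_def by (rule space_measure_of[OF sub])
  show "sets (surface_measure T) = sets (restrict_space borel T)"
    unfolding surface_measure_def using sets.sigma_sets_eq[of "restrict_space borel T"]
    by (simp add: sets_measure_of[OF sub] space_restrict_space)
qed

lemma emeasure_surface_measure:
  assumes T: "T \<in> sets borel" and A: "A \<in> sets borel" "A \<subseteq> T"
  shows "emeasure (surface_measure T) A = H2 A"
proof -
  let ?R = "restrict_space borel T"
  have sp: "space ?R = T" by (simp add: space_restrict_space)
  have "countably_additive (sets ?R) H2"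
    unfolding countably_additive_def
  proof (intro allI impI)
    fix B :: "nat \<Rightarrow> (real^3) set"
    assume B: "range B \<subseteq> sets ?R" "disjoint_family B"
    have "range B \<subseteq> sets borel"
      using B(1) T by (auto simp: sets_restrict_space_iff image_subset_iff)
    then show "(\<Sum>i. H2 (B i)) = H2 (\<Union>i. B i)"
      using measure_space_H2_borel B(2)
      unfolding measure_space_def countably_additive_def by blast
  qed
  then show ?thesis
    unfolding surface_measure_def using T A sets.sigma_algebra_axioms[of ?R]
    by (intro emeasure_measure_of_sigma)
      (auto simp: sp positive_def sets_restrict_space_iff)
qed

section \<open>Polar coordinates and the cone measure\<close>

lemma borel_measurable_sgn_vec [measurable]:
  "(sgn :: 'a::euclidean_space \<Rightarrow> 'a) \<in> borel_measurable borel"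
  unfolding sgn_div_norm[abs_def] by measurable

text \<open>Surface measure of the unit sphere, obtained by projecting the solid ball radially. The
  factor \<open>DIM('a)\<close> turns the volume of the ball into the area of the sphere, because
  the integral of s^(n-1) over [0,1] is 1/n. \<open>sgn\<close> sends only the null point 0 off the
  sphere.\<close>

definition cone_measure :: "'a::euclidean_space measure" where
  "cone_measure = distr (density lborel (\<lambda>x. ennreal (DIM('a)) * indicator (cball 0 1) x)) borel sgn"

lemma sets_cone_measure [simp, measurable_cong]: "sets cone_measure = sets borel"
  and space_cone_measure [simp]: "space cone_measure = UNIV"
  by (simp_all add: cone_measure_def)

lemma cone_density_measurable [measurable]:
  "(\<lambda>x::'a::euclidean_space. ennreal c * indicator (cball 0 1) x) \<in> borel_measurable borel"
  by (intro borel_measurable_times_ennreal borel_measurable_const borel_measurable_indicator) simp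

lemma emeasure_cone_measure:
  fixes B :: "'a::euclidean_space set"
  assumes "B \<in> sets borel"
  shows "emeasure cone_measure B
    = ennreal (DIM('a)) * emeasure lborel {x. norm x \<le> 1 \<and> sgn x \<in> B}"
proof -
  have [measurable]: "sgn -` B \<in> sets borel"
    using measurable_sets[OF borel_measurable_sgn_vec assms] by simp
  have "emeasure cone_measure B
      = (\<integral>\<^sup>+x. ennreal (DIM('a)) * indicator (cball 0 1 \<inter> sgn -` B) x \<partial>lborel)"
    unfolding cone_measure_def using assms
    by (subst emeasure_distr, simp, simp, subst emeasure_density)
      (auto simp: indicator_inter_arith mult.assoc intro!: nn_integral_cong cone_density_measurable)
  also have "\<dots> = ennreal (DIM('a)) * emeasure lborel (cball 0 1 \<inter> sgn -` B)"
    by (simp add: nn_integral_cmult_indicator)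
  also have "cball 0 1 \<inter> sgn -` B = {x. norm x \<le> 1 \<and> sgn x \<in> B}" by auto
  finally show ?thesis .
qed

lemma emeasure_cone_measure_UNIV:
  "emeasure (cone_measure :: 'a::euclidean_space measure) UNIV
    = ennreal (DIM('a) * unit_ball_vol (DIM('a)))"
proof -
  have "{x::'a. norm x \<le> 1} = cball 0 1" by auto
  then show ?thesis
    by (simp add: emeasure_cone_measure emeasure_cball ennreal_mult)
qed

lemma finite_measure_cone_measure: "finite_measure (cone_measure :: 'a::euclidean_space measure)"
  by (rule finite_measureI) (simp add: emeasure_cone_measure_UNIV)

lemma AE_cone_measure_norm: "AE w in (cone_measure :: 'a::euclidean_space measure). norm w = 1"
proof -
  have "AE x in lborel. x \<noteq> (0::'a)" by (rule AE_lborel_singleton)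
  then show ?thesis
    unfolding cone_measure_def
    by (subst AE_distr_iff, simp, simp, subst AE_density) (auto simp: norm_sgn elim!: eventually_mono intro!: cone_density_measurable)
qed

lemma emeasure_lborel_scaled_sector:
  fixes B :: "'a::euclidean_space set"
  assumes B [measurable]: "B \<in> sets borel" and b: "0 \<le> b"
  shows "emeasure lborel {x. norm x \<le> b \<and> sgn x \<in> B}
    = ennreal (b ^ DIM('a)) * emeasure lborel {x. norm x \<le> 1 \<and> sgn x \<in> B}"
proof (cases "b = 0")
  case True
  have "emeasure lborel {x. norm x \<le> b \<and> sgn x \<in> B} \<le> emeasure lborel {0::'a}"
    using True by (intro emeasure_mono) auto
  then show ?thesis using True by (simp add: zero_power)
next
  case False
  with b have b: "0 < b" by simp
  have [measurable]: "Measurable.pred borel (\<lambda>x. norm x \<le> c \<and> sgn x \<in> B)" for c :: real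
    by measurable
  have "emeasure lborel {x. norm x \<le> b \<and> sgn x \<in> B}
    = emeasure (density (distr lborel borel (\<lambda>x::'a. 0 + b *\<^sub>R x)) (\<lambda>_. \<bar>b\<bar>^DIM('a))) {x. norm x \<le> b \<and> sgn x \<in> B}"
    using b by (subst lborel_affine[of b 0]) auto
  also have "\<dots> = ennreal (b ^ DIM('a)) * emeasure lborel ((\<lambda>x. b *\<^sub>R x) -` {x. norm x \<le> b \<and> sgn x \<in> B})"
    using b by (simp add: emeasure_density nn_integral_cmult_indicator emeasure_distr)
  also have "(\<lambda>x. b *\<^sub>R x) -` {x. norm x \<le> b \<and> sgn x \<in> B} = {x. norm x \<le> 1 \<and> sgn x \<in> B}"
    using b by (auto simp: sgn_scaleR)
  finally show ?thesis .
qed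

lemma nn_integral_power_Ioc:
  assumes "0 \<le> b" and "0 < n"
  shows "(\<integral>\<^sup>+s. ennreal (s ^ (n - 1)) * indicator {0<..b} s \<partial>lborel) = ennreal (b ^ n / n)"
proof -
  have "(\<integral>\<^sup>+s. ennreal (s ^ (n - 1)) * indicator {0<..b} s \<partial>lborel)
      = (\<integral>\<^sup>+s. ennreal (s ^ (n - 1)) * indicator {0..b} s \<partial>lborel)"
    by (intro nn_integral_cong_AE, rule AE_mp[OF AE_lborel_singleton[of 0]])
      (auto split: split_indicator)
  also have "\<dots> = ennreal (b ^ n / n - 0 ^ n / n)"
    using assms
    by (intro nn_integral_FTC_Icc[where F = "\<lambda>s. s ^ n / n"])
      (auto intro!: derivative_eq_intros simp: power_divide)
  finally show ?thesis using assms by (simp add: zero_power)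
qed

lemma emeasure_radial_atMost:
  assumes "0 < n"
  shows "emeasure (density lborel (\<lambda>s. ennreal (s ^ (n - 1)) * indicator {0<..} s)) {..b}
    = ennreal (max 0 b ^ n / n)"
proof -
  have "emeasure (density lborel (\<lambda>s. ennreal (s ^ (n - 1)) * indicator {0<..} s)) {..b}
      = (\<integral>\<^sup>+s. ennreal (s ^ (n - 1)) * indicator {0<..max 0 b} s \<partial>lborel)"
    by (subst emeasure_density) (auto intro!: nn_integral_cong split: split_indicator)
  also have "\<dots> = ennreal (max 0 b ^ n / n)"
    using assms by (rule nn_integral_power_Ioc[rotated]) simp
  finally show ?thesis .
qed

lemma sigma_finite_radial:
  assumes "0 < n"
  shows "sigma_finite_measure (density lborel (\<lambda>s. ennreal (s ^ (n - 1)) * indicator {0<..} s))"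
proof
  let ?R = "density lborel (\<lambda>s. ennreal (s ^ (n - 1)) * indicator {0<..} s)"
  show "\<exists>A. countable A \<and> A \<subseteq> sets ?R \<and> \<Union>A = space ?R \<and> (\<forall>a\<in>A. emeasure ?R a \<noteq> \<infinity>)"
  proof (intro exI[of _ "range (\<lambda>k::nat. {..real k})"] conjI ballI)
    show "\<Union> (range (\<lambda>k::nat. {..real k})) = space ?R" by (auto simp: real_arch_simple)
    fix a assume "a \<in> range (\<lambda>k::nat. {..real k})"
    then show "emeasure ?R a \<noteq> \<infinity>" using emeasure_radial_atMost[OF assms] by auto
  qed auto
qed

text \<open>It suffices to compare rectangles A x B. For fixed B both sides are measures in A, and
  they agree on half-lines by homogeneity of sectors: the part of a cone within radius b has b^n
  times the volume of the part within radius 1.\<close>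

lemma distr_lborel_polar:
  "density lborel (\<lambda>s. ennreal (s ^ (DIM('a) - 1)) * indicator {0<..} s) \<Otimes>\<^sub>M cone_measure
    = distr lborel (borel \<Otimes>\<^sub>M borel) (\<lambda>x::'a::euclidean_space. (norm x, sgn x))"
    (is "?R \<Otimes>\<^sub>M _ = ?D")
proof (rule pair_measure_eqI)
  let ?n = "DIM('a)"
  note R_atMost = emeasure_radial_atMost[OF DIM_positive[where 'a = 'a]]
  show "sigma_finite_measure ?R" by (rule sigma_finite_radial[OF DIM_positive])
  show "sigma_finite_measure (cone_measure :: 'a measure)"
    using finite_measure_cone_measure by (rule finite_measure.axioms)
  show "sets (?R \<Otimes>\<^sub>M (cone_measure :: 'a measure)) = sets ?D"
    by (simp cong: sets_pair_measure_cong)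
  fix A B assume "A \<in> sets ?R" and "B \<in> sets (cone_measure :: 'a measure)"
  then have A [measurable]: "A \<in> sets borel" and B [measurable]: "B \<in> sets borel" by auto
  have [measurable]: "sgn -` B \<in> sets borel"
    using measurable_sets[OF borel_measurable_sgn_vec B] by simp
  have [measurable]: "Measurable.pred borel (\<lambda>x. norm x \<le> c \<and> sgn x \<in> B)" for c :: real
    by measurable
  let ?c = "emeasure cone_measure B"
  let ?M = "density ?R (\<lambda>_. ?c)"
  let ?N = "distr (density lborel (indicator (sgn -` B))) borel (norm :: 'a \<Rightarrow> real)"
  have "?M = ?N"
  proof (rule measure_eqI_generator_eq[where E = "range atMost" and \<Omega> = UNIV and A = "\<lambda>n. {..real n}"])
    show "Int_stable (range (atMost :: real \<Rightarrow> _))"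
      by (auto simp: Int_stable_def)
    have *: "emeasure ?M {..b} = ?c * ennreal (max 0 b ^ ?n / ?n)" for b
      using R_atMost[of b] by (subst emeasure_density) (auto simp: nn_integral_cmult_indicator)
    have N: "emeasure ?N {..b} = emeasure lborel {x. norm x \<le> b \<and> sgn x \<in> B}" for b
      by (subst emeasure_distr)
        (auto simp: emeasure_density indicator_inter_arith[symmetric] Int_def vimage_def conj_commute)
    show "emeasure ?M X = emeasure ?N X" if X: "X \<in> range atMost" for X
    proof -
      obtain b where X: "X = {..b}" using X by auto
      show ?thesis
      proof (cases "0 \<le> b")
        case True
        have "?c * ennreal (b ^ ?n / ?n) =
          emeasure lborel {x. norm x \<le> 1 \<and> sgn x \<in> B} * (ennreal ?n * ennreal (b ^ ?n / ?n))"
          by (simp add: emeasure_cone_measure mult_ac)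
        also have "ennreal ?n * ennreal (b ^ ?n / ?n) = ennreal (b ^ ?n)"
          using True by (simp flip: ennreal_mult)
        finally show ?thesis
          unfolding X * N emeasure_lborel_scaled_sector[OF B True] using True
          by (simp only: max_absorb2 mult.commute)
      next
        case False
        then have "{x. norm x \<le> b \<and> sgn x \<in> B} = {}" by (auto dest: order_trans[OF norm_ge_zero])
        then have "emeasure lborel {x. norm x \<le> b \<and> sgn x \<in> B} = 0" by (simp only: emeasure_empty)
        then show ?thesis using False unfolding X * N by (simp add: max_def zero_power)
      qed
    qed
    show "emeasure ?M {..real i} \<noteq> \<infinity>" for i
      using finite_measure.emeasure_finite[OF finite_measure_cone_measure]
      unfolding * by (auto simp: ennreal_mult_eq_top_iff)
  qed (auto simp: borel_eq_atMost real_arch_simple)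
  then have "emeasure ?M A = emeasure ?N A" by simp
  also have "emeasure ?M A = emeasure ?R A * ?c"
    by (subst emeasure_density_const) (simp_all add: mult.commute)
  also have "emeasure ?N A = emeasure ?D (A \<times> B)"
    by (subst (1 2) emeasure_distr)
      (auto simp: emeasure_density indicator_inter_arith[symmetric] Int_def vimage_def conj_commute)
  finally show "emeasure ?R A * ?c = emeasure ?D (A \<times> B)" .
qed

theorem nn_integral_polar:
  fixes F :: "'a::euclidean_space \<Rightarrow> ennreal"
  assumes F [measurable]: "F \<in> borel_measurable borel"
  shows "(\<integral>\<^sup>+x. F x \<partial>lborel)
    = (\<integral>\<^sup>+w. \<integral>\<^sup>+s. ennreal (s ^ (DIM('a) - 1)) * indicator {0<..} s * F (s *\<^sub>R w) \<partial>lborel \<partial>cone_measure)"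
proof -
  let ?R = "density lborel (\<lambda>s. ennreal (s ^ (DIM('a) - 1)) * indicator {0<..} s)"
  have sf: "sigma_finite_measure ?R"
    by (rule sigma_finite_radial[OF DIM_positive])
  interpret C: finite_measure "cone_measure :: 'a measure" by (rule finite_measure_cone_measure)
  interpret R: sigma_finite_measure ?R by (rule sf)
  interpret pair_sigma_finite ?R "cone_measure :: 'a measure" ..
  have "norm x *\<^sub>R sgn x = x" for x :: 'a
    by (cases "x = 0") (auto simp: sgn_div_norm)
  then have "(\<integral>\<^sup>+x. F x \<partial>lborel) = (\<integral>\<^sup>+x. (\<lambda>(s, w). F (s *\<^sub>R w)) (norm x, sgn x) \<partial>lborel)"
    by simp
  also have "\<dots> = (\<integral>\<^sup>+p. (\<lambda>(s, w). F (s *\<^sub>R w)) p \<partial>distr lborel (borel \<Otimes>\<^sub>M borel) (\<lambda>x::'a. (norm x, sgn x)))"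
    by (rule nn_integral_distr[symmetric]) measurable
  also have "\<dots> = (\<integral>\<^sup>+p. (\<lambda>(s, w). F (s *\<^sub>R w)) p \<partial>(?R \<Otimes>\<^sub>M cone_measure))"
    by (simp only: distr_lborel_polar)
  also have "\<dots> = (\<integral>\<^sup>+w. \<integral>\<^sup>+s. F (s *\<^sub>R w) \<partial>?R \<partial>cone_measure)"
    by (subst nn_integral_snd[symmetric]) auto
  also have "\<dots> = (\<integral>\<^sup>+w. \<integral>\<^sup>+s. ennreal (s ^ (DIM('a) - 1)) * indicator {0<..} s * F (s *\<^sub>R w) \<partial>lborel \<partial>cone_measure)"
    by (intro nn_integral_cong, subst nn_integral_density) auto
  finally show ?thesis .
qed

section \<open>Volume of a spherical sector and area of a spherical cap\<close>

definition cyl :: "complex \<times> real \<Rightarrow> real^3" where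
  "cyl p = vector [Re (fst p), Im (fst p), snd p]"

lemma cyl_nth [simp]:
  "cyl p $ 1 = Re (fst p)" "cyl p $ 2 = Im (fst p)" "cyl p $ 3 = snd p"
  by (simp_all add: cyl_def)

lemma norm_cyl: "(norm (cyl p))\<^sup>2 = (norm (fst p))\<^sup>2 + (snd p)\<^sup>2"
  by (simp add: norm_vec_def L2_set_def sum_3 cmod_power2)

lemma cyl_measurable [measurable]: "cyl \<in> borel_measurable borel"
proof -
  have A: "cyl = (\<lambda>p. \<chi> i. if i = 1 then Re (fst p) else if i = 2 then Im (fst p) else snd p)"
    by (auto simp: fun_eq_iff vec_eq_iff forall_3)
  have B: "continuous_on UNIV (\<lambda>p::complex \<times> real. if i = 1 then Re (fst p) else if i = 2 then Im (fst p) else snd p)"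
    for i :: 3
    by (cases "i = 1"; cases "i = 2") (auto intro!: continuous_intros)
  have "continuous_on UNIV cyl"
    unfolding A by (rule continuous_on_vec_lambda) (rule B)
  then show ?thesis by (rule borel_measurable_continuous_onI)
qed

lemma distr_cyl: "distr lborel borel cyl = (lborel :: (real^3) measure)"
proof (rule lborel_eqI[symmetric])
  fix l u :: "real^3" assume le: "\<And>b. b \<in> Basis \<Longrightarrow> l \<bullet> b \<le> u \<bullet> b"
  have le': "l $ i \<le> u $ i" for i
    using le[of "axis i 1"] by (simp add: inner_axis)
  have "cyl -` box l u = box (Complex (l $ 1) (l $ 2), l $ 3) (Complex (u $ 1) (u $ 2), u $ 3)"
    by (auto simp: mem_box_cart forall_3 box_prod Basis_prod_def mem_box Basis_complex_def)
  then have "emeasure (distr lborel borel cyl) (box l u)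
    = emeasure lborel (box (Complex (l $ 1) (l $ 2), l $ 3) (Complex (u $ 1) (u $ 2), u $ 3))"
    by (simp add: emeasure_distr)
  also have "\<dots> = ennreal ((u $ 1 - l $ 1) * (u $ 2 - l $ 2) * (u $ 3 - l $ 3))"
    using le'[of 1] le'[of 2] le'[of 3]
    by (subst emeasure_lborel_box)
      (auto simp: Basis_prod_def Basis_complex_def prod.union_disjoint prod.insert_if complex_eq_iff mult.assoc)
  also have "(u $ 1 - l $ 1) * (u $ 2 - l $ 2) * (u $ 3 - l $ 3) = (\<Prod>b\<in>Basis. (u - l) \<bullet> b)"
  proof -
    have "(\<Prod>b\<in>Basis. (u - l) \<bullet> b) = (\<Prod>i\<in>UNIV. (u - l) $ i)"
      by (simp add: Basis_vec_def UNION_singleton_eq_range prod.reindex inj_on_def axis_eq_axis inner_axis)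
    also have "\<dots> = (u $ 1 - l $ 1) * (u $ 2 - l $ 2) * (u $ 3 - l $ 3)"
      unfolding UNIV_3 by (simp add: mult.assoc)
    finally show ?thesis by (rule sym)
  qed
  finally show "emeasure (distr lborel borel cyl) (box l u) = ennreal (\<Prod>b\<in>Basis. (u - l) \<bullet> b)" .
qed simp

text \<open>Slicing at height t: identifying R^3 with complex times real makes each slice a
  \<open>cball\<close> in the plane, whose area is known. Below t = c the cone is the active
  constraint, above it the unit sphere.\<close>

lemma emeasure_axis_sector:
  assumes c: "0 < c" "c \<le> 1"
  shows "emeasure lborel {x :: real^3. norm x \<le> 1 \<and> c * norm x \<le> x $ 3} = ennreal (2 * pi * (1 - c) / 3)"
proof -
  \<comment> \<open>The squared tangent of the half-angle: for t > 0 the cone condition reads |z|^2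
    <= k t^2.\<close>
  define k where "k = 1 / c\<^sup>2 - 1"
  have k0: "0 \<le> k" using c by (simp add: k_def field_simps power_le_one)
  have [measurable]: "Measurable.pred borel (\<lambda>x :: real^3. norm x \<le> 1 \<and> c * norm x \<le> x $ 3)"
    by measurable
  let ?S = "{x :: real^3. norm x \<le> 1 \<and> c * norm x \<le> x $ 3}"
  define A where "A t = (if 0 < t \<and> t \<le> 1 then cball (0::complex) (sqrt (min (1 - t\<^sup>2) (k * t\<^sup>2))) else if t = 0 then {0} else {})" for t
  have sec: "(\<lambda>z. (z, t)) -` (cyl -` ?S) = A t" for t
  proof (intro set_eqI)
    fix z :: complex
    have n: "norm (cyl (z, t)) = sqrt ((norm z)\<^sup>2 + t\<^sup>2)"
      using norm_cyl[of "(z, t)"] by (simp add: real_sqrt_unique)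
    show "z \<in> (\<lambda>z. (z, t)) -` (cyl -` ?S) \<longleftrightarrow> z \<in> A t"
    proof (cases "0 < t")
      case t: True
      have "c * sqrt ((norm z)\<^sup>2 + t\<^sup>2) \<le> t \<longleftrightarrow> sqrt (c\<^sup>2 * ((norm z)\<^sup>2 + t\<^sup>2)) \<le> sqrt (t\<^sup>2)"
        using c t by (simp add: real_sqrt_mult)
      also have "\<dots> \<longleftrightarrow> c\<^sup>2 * ((norm z)\<^sup>2 + t\<^sup>2) \<le> t\<^sup>2" by (rule real_sqrt_le_iff)
      also have "\<dots> \<longleftrightarrow> (norm z)\<^sup>2 \<le> k * t\<^sup>2" using c by (simp add: k_def field_simps)
      finally have e: "c * sqrt ((norm z)\<^sup>2 + t\<^sup>2) \<le> t \<longleftrightarrow> (norm z)\<^sup>2 \<le> k * t\<^sup>2" .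
      show ?thesis
      proof (cases "t \<le> 1")
        case True
        have "0 \<le> min (1 - t\<^sup>2) (k * t\<^sup>2)" using True t k0 by (simp add: power_le_one)
        then have "norm z \<le> sqrt (min (1 - t\<^sup>2) (k * t\<^sup>2)) \<longleftrightarrow> (norm z)\<^sup>2 \<le> min (1 - t\<^sup>2) (k * t\<^sup>2)"
          by (metis norm_ge_zero real_le_rsqrt real_sqrt_le_iff real_sqrt_unique)
        then show ?thesis using t True n e by (auto simp: A_def)
      next
        case False
        then have "1 < t\<^sup>2" by (simp add: one_less_power)
        then have "1 < (norm z)\<^sup>2 + t\<^sup>2" using zero_le_power2[of "norm z"] by linarith
        then show ?thesis using False n by (auto simp: A_def)
      qed
    next
      case False
      have "c * norm (cyl (z, t)) \<le> t \<longleftrightarrow> t = 0 \<and> z = 0"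
      proof
        assume a: "c * norm (cyl (z, t)) \<le> t"
        moreover have "0 \<le> c * norm (cyl (z, t))" using c by simp
        ultimately have t: "t = 0" using False by linarith
        with a c have "norm (cyl (z, t)) = 0" by (metis mult_le_0_iff norm_le_zero_iff norm_zero not_le)
        then show "t = 0 \<and> z = 0" using t norm_cyl[of "(z, t)"] by simp
      qed (use norm_cyl[of "(0, 0)"] in auto)
      then show ?thesis using False norm_cyl[of "(0, 0)"] by (auto simp: A_def)
    qed
  qed
  have area: "emeasure lborel (A t) = ennreal (pi * min (1 - t\<^sup>2) (k * t\<^sup>2)) * indicator {0..1} t" for t
  proof (cases "0 < t \<and> t \<le> 1")
    case True
    then have "0 \<le> min (1 - t\<^sup>2) (k * t\<^sup>2)" using k0 by (simp add: power_le_one)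
    then show ?thesis using True by (simp add: A_def emeasure_cball unit_ball_vol_2)
  qed (auto simp: A_def k0)
  have "emeasure lborel ?S = emeasure (distr lborel borel cyl) ?S" by (simp add: distr_cyl)
  also have "\<dots> = emeasure (lborel \<Otimes>\<^sub>M lborel) (cyl -` ?S)"
    by (subst emeasure_distr) (auto simp: lborel_prod)
  also have "\<dots> = (\<integral>\<^sup>+t. emeasure lborel ((\<lambda>z. (z, t)) -` (cyl -` ?S)) \<partial>lborel)"
  proof (rule lborel_pair.emeasure_pair_measure_alt2)
    have "cyl -` ?S \<inter> space borel \<in> sets borel" by measurable
    then show "cyl -` ?S \<in> sets (lborel \<Otimes>\<^sub>M lborel)"
      by (simp only: lborel_prod sets_lborel space_borel Int_UNIV_right)
  qed
  also have "\<dots> = (\<integral>\<^sup>+t. ennreal (pi * min (1 - t\<^sup>2) (k * t\<^sup>2)) * indicator {0..1} t \<partial>lborel)"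
    by (simp only: sec area)
  also have "\<dots> = (\<integral>\<^sup>+t. ennreal (pi * (k * t\<^sup>2)) * indicator {0..c} t
       + ennreal (pi * (1 - t\<^sup>2)) * indicator {c..1} t \<partial>lborel)"
  \<comment> \<open>The height t = c lies in both intervals and is discarded as a null set.\<close>
  proof (intro nn_integral_cong_AE, rule AE_mp[OF AE_lborel_singleton[of c]], intro AE_I2 impI)
    fix t assume "t \<noteq> c"
    have "k * t\<^sup>2 \<le> 1 - t\<^sup>2 \<longleftrightarrow> t\<^sup>2 \<le> c\<^sup>2" using c by (simp add: k_def field_simps)
    also have "\<dots> \<longleftrightarrow> t \<le> c" if "0 \<le> t" using c that by (simp add: power2_le_iff_abs_le)
    finally have "0 \<le> t \<Longrightarrow> k * t\<^sup>2 \<le> 1 - t\<^sup>2 \<longleftrightarrow> t \<le> c" .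
    then show "ennreal (pi * min (1 - t\<^sup>2) (k * t\<^sup>2)) * indicator {0..1} t = ennreal (pi * (k * t\<^sup>2)) * indicator {0..c} t
       + ennreal (pi * (1 - t\<^sup>2)) * indicator {c..1} t"
      using \<open>t \<noteq> c\<close> c by (auto simp: indicator_def min_def)
  qed
  also have "\<dots> = (\<integral>\<^sup>+t. ennreal (pi * (k * t\<^sup>2)) * indicator {0..c} t \<partial>lborel)
       + (\<integral>\<^sup>+t. ennreal (pi * (1 - t\<^sup>2)) * indicator {c..1} t \<partial>lborel)"
    by (rule nn_integral_add) auto
  also have "(\<integral>\<^sup>+t. ennreal (pi * (k * t\<^sup>2)) * indicator {0..c} t \<partial>lborel) = ennreal (pi * k * c^3 / 3 - pi * k * 0^3 / 3)"
    using c k0 by (intro nn_integral_FTC_Icc[where F = "\<lambda>t. pi * k * t^3 / 3"])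
      (auto intro!: derivative_eq_intros simp: power2_eq_square)
  also have "(\<integral>\<^sup>+t. ennreal (pi * (1 - t\<^sup>2)) * indicator {c..1} t \<partial>lborel)
      = ennreal (pi * (1 - 1^3 / 3) - pi * (c - c^3 / 3))"
    using c by (intro nn_integral_FTC_Icc[where F = "\<lambda>t. pi * (t - t^3 / 3)"])
      (auto intro!: derivative_eq_intros simp: power2_eq_square power_le_one mult_le_one)
  also have "ennreal (pi * k * c^3 / 3 - pi * k * 0^3 / 3) + ennreal (pi * (1 - 1^3 / 3) - pi * (c - c^3 / 3))
     = ennreal (2 * pi * (1 - c) / 3)"
  proof -
    have k3: "k * c^3 = c - c^3" using c by (simp add: k_def field_simps power2_eq_square power3_eq_cube)
    \<comment> \<open>The two \<open>ennreal\<close> terms can be merged only once this difference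
      is known to be nonnegative; three times it is 2 - 3 c + c^3, which has the double root
      1.\<close>
    have "0 \<le> 1 - 1^3 / 3 - (c - c^3 / 3)"
    proof -
      have "0 \<le> (1 - c)^2 * (2 + c)" using c by simp
      also have "\<dots> = 3 * (1 - 1^3 / 3 - (c - c^3 / 3))"
        by (simp add: power2_eq_square power3_eq_cube algebra_simps)
      finally show ?thesis by simp
    qed
    then have "0 \<le> pi * (1 - 1^3 / 3) - pi * (c - c^3 / 3)"
      by (metis mult_nonneg_nonneg pi_ge_zero right_diff_distrib)
    moreover have "0 \<le> pi * k * c^3 / 3" using k0 c by simp
    ultimately have "ennreal (pi * k * c^3 / 3 - pi * k * 0^3 / 3) + ennreal (pi * (1 - 1^3 / 3) - pi * (c - c^3 / 3))
      = ennreal (pi * (k * c^3) / 3 + (pi * (1 - 1^3 / 3) - pi * (c - c^3 / 3)))"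
      by (simp add: mult.assoc flip: ennreal_plus)
    also have "pi * (k * c^3) / 3 + (pi * (1 - 1^3 / 3) - pi * (c - c^3 / 3)) = 2 * pi * (1 - c) / 3"
      unfolding k3 by (simp add: field_simps)
    finally show ?thesis .
  qed
  finally show ?thesis .
qed

text \<open>An orthogonal map carries the third coordinate axis to e and preserves volume.\<close>

lemma emeasure_sector:
  fixes e :: "real^3"
  assumes c: "0 < c" "c \<le> 1" and e: "norm e = 1"
  shows "emeasure lborel {x. norm x \<le> 1 \<and> c * norm x \<le> x \<bullet> e} = ennreal (2 * pi * (1 - c) / 3)"
proof -
  let ?a = "axis 3 1 :: real^3"
  obtain f where f: "orthogonal_transformation f" "f ?a = e"
    using orthogonal_transformation_exists[of ?a e] e by auto
  let ?S = "{x :: real^3. norm x \<le> 1 \<and> c * norm x \<le> x \<bullet> ?a}"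
  let ?T = "{x. norm x \<le> 1 \<and> c * norm x \<le> x \<bullet> e}"
  have bor: "{x :: real^3. norm x \<le> 1 \<and> c * norm x \<le> x \<bullet> d} \<in> sets borel" for d
    by measurable
  have bd: "bounded {x :: real^3. norm x \<le> 1 \<and> c * norm x \<le> x \<bullet> d}" for d
    by (rule bounded_subset[OF bounded_cball[of 0 1]]) auto
  have lm: "{x :: real^3. norm x \<le> 1 \<and> c * norm x \<le> x \<bullet> d} \<in> lmeasurable" for d
    using bounded_set_imp_lmeasurable[OF bd] bor by auto
  have "f ` ?S = ?T"
  proof safe
    fix x assume "norm x \<le> 1" "c * norm x \<le> x \<bullet> ?a"
    then show "norm (f x) \<le> 1" "c * norm (f x) \<le> f x \<bullet> e"
      using f by (auto simp: orthogonal_transformation_norm orthogonal_transformation_def)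
  next
    fix y assume y: "norm y \<le> 1" "c * norm y \<le> y \<bullet> e"
    obtain x where "y = f x"
      using orthogonal_transformation_surj[OF f(1)] by (meson surjD)
    then show "y \<in> f ` ?S"
      using y f by (auto simp: orthogonal_transformation_norm orthogonal_transformation_def)
  qed
  then have "measure lebesgue ?T = measure lebesgue ?S"
    using measure_orthogonal_image[OF f(1) lm, of ?a] by simp
  then have "emeasure lebesgue ?T = emeasure lebesgue ?S"
    using lm by (simp add: emeasure_eq_measure2 fmeasurableD2)
  also have "\<dots> = emeasure lborel ?S" using bor by simp
  also have "\<dots> = ennreal (2 * pi * (1 - c) / 3)"
    using emeasure_axis_sector[OF c] by (simp add: inner_axis)
  finally show ?thesis using bor by simp
qed

text \<open>Archimedes: for unit vectors |e - v|^2 = 2 - 2 (e . v), so a chordal ball of radius r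
  cuts out the cap with cosine 1 - r^2/2, and the sector volume is linear in the cosine. The bound r
  <= 1 keeps the cosine positive.\<close>

lemma emeasure_cone_measure_cap:
  fixes e :: "real^3"
  assumes e: "norm e = 1" and r: "0 < r" "r \<le> 1"
  shows "emeasure cone_measure (cball e r) = ennreal (pi * r\<^sup>2)"
proof -
  have *: "sgn x \<in> cball e r \<longleftrightarrow> (1 - r\<^sup>2 / 2) * norm x \<le> x \<bullet> e" if "x \<noteq> 0" for x
  proof -
    have "(dist e (sgn x))\<^sup>2 = 2 - 2 * (sgn x \<bullet> e)"
    proof -
      have "e \<bullet> e = 1" "sgn x \<bullet> sgn x = 1" using that e by (simp_all add: norm_sgn flip: norm_eq_1)
      then show ?thesis
        by (simp add: dist_norm power2_norm_eq_inner inner_diff_left inner_diff_right inner_commute)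
    qed
    moreover have "sgn x \<in> cball e r \<longleftrightarrow> (dist e (sgn x))\<^sup>2 \<le> r\<^sup>2"
      using r by (simp add: power_mono_iff)
    ultimately have "sgn x \<in> cball e r \<longleftrightarrow> 1 - r\<^sup>2 / 2 \<le> sgn x \<bullet> e" by auto
    also have "\<dots> \<longleftrightarrow> (1 - r\<^sup>2 / 2) * norm x \<le> (sgn x \<bullet> e) * norm x" using that by simp
    also have "(sgn x \<bullet> e) * norm x = x \<bullet> e" using that by (simp add: sgn_div_norm)
    finally show ?thesis .
  qed
  have r1: "r\<^sup>2 \<le> 1" using r by (simp add: power_le_one)
  have "emeasure lborel {x. norm x \<le> 1 \<and> sgn x \<in> cball e r}
      = emeasure lborel {x. norm x \<le> 1 \<and> (1 - r\<^sup>2 / 2) * norm x \<le> x \<bullet> e}"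
  proof (rule emeasure_eq_AE)
    show "AE x in lborel. x \<in> {x. norm x \<le> 1 \<and> sgn x \<in> cball e r}
        \<longleftrightarrow> x \<in> {x. norm x \<le> 1 \<and> (1 - r\<^sup>2 / 2) * norm x \<le> x \<bullet> e}"
      by (rule AE_mp[OF AE_lborel_singleton[of 0]], intro AE_I2 impI) (simp only: mem_Collect_eq * simp_thms)
    have [measurable]: "Measurable.pred borel (\<lambda>x. sgn x \<in> cball e r)"
      unfolding mem_cball by measurable
    show "{x. norm x \<le> 1 \<and> sgn x \<in> cball e r} \<in> sets lborel"
      "{x. norm x \<le> 1 \<and> (1 - r\<^sup>2 / 2) * norm x \<le> x \<bullet> e} \<in> sets lborel"
      unfolding sets_lborel by measurable
  qed
  also have "\<dots> = ennreal (2 * pi * (1 - (1 - r\<^sup>2 / 2)) / 3)"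
    using r1 by (intro emeasure_sector e) auto
  finally have "emeasure cone_measure (cball e r) = ennreal 3 * ennreal (2 * pi * (1 - (1 - r\<^sup>2 / 2)) / 3)"
    by (simp add: emeasure_cone_measure)
  also have "\<dots> = ennreal (pi * r\<^sup>2)"
    by (subst ennreal_mult[symmetric]) auto
  finally show ?thesis .
qed

lemma emeasure_cone_measure_UNIV_3: "emeasure (cone_measure :: (real^3) measure) UNIV = ennreal (4 * pi)"
  by (simp add: emeasure_cone_measure_UNIV unit_ball_vol_3)

section \<open>Comparison of Hausdorff and cone measure on the sphere\<close>

text \<open>Vitali families are indexed by their centres, whereas the covers in
  \<open>H2_delta\<close> are sequences. Indices outside the enumeration receive the empty set,
  which costs nothing because f vanishes there.\<close>

lemma countable_family_as_sequence:
  fixes C :: "'i \<Rightarrow> 'a set" and f :: "'a set \<Rightarrow> ennreal"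
  assumes "countable I" and "f {} = 0"
  obtains D :: "nat \<Rightarrow> 'a set" where "(\<Union>n. D n) = (\<Union>i\<in>I. C i)" "\<And>n. D n \<in> insert {} (C ` I)"
    "(\<Sum>n. f (D n)) = (\<integral>\<^sup>+i. f (C i) \<partial>count_space I)"
proof
  let ?J = "to_nat_on I ` I"
  let ?D = "\<lambda>n. if n \<in> ?J then C (from_nat_into I n) else {}"
  show "(\<Union>n. ?D n) = (\<Union>i\<in>I. C i)"
    using assms(1) by (auto split: if_splits)
  show "?D n \<in> insert {} (C ` I)" for n
    using assms(1) by auto
  have b: "bij_betw (to_nat_on I) I ?J"
    using assms(1) by (simp add: bij_betw_def inj_on_to_nat_on)
  have "(\<Sum>n. f (?D n)) = (\<integral>\<^sup>+n. f (?D n) \<partial>count_space UNIV)"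
    by (rule nn_integral_count_space_nat[symmetric])
  also have "\<dots> = (\<integral>\<^sup>+n. f (C (from_nat_into I n)) * indicator ?J n \<partial>count_space UNIV)"
    using assms(2) by (intro nn_integral_cong) auto
  also have "\<dots> = (\<integral>\<^sup>+n. f (C (from_nat_into I n)) \<partial>count_space ?J)"
    by (rule nn_integral_count_space_indicator[symmetric]) simp
  also have "\<dots> = (\<integral>\<^sup>+i. f (C (from_nat_into I (to_nat_on I i))) \<partial>count_space I)"
    by (rule nn_integral_bij_count_space[OF b, symmetric])
  also have "\<dots> = (\<integral>\<^sup>+i. f (C i) \<partial>count_space I)"
    using assms(1) by (intro nn_integral_cong) simp
  finally show "(\<Sum>n. f (?D n)) = (\<integral>\<^sup>+i. f (C i) \<partial>count_space I)" .
qed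

lemma H2_delta_le_countable:
  assumes I: "countable I" and cov: "A \<subseteq> (\<Union>i\<in>I. C i)"
    and C: "\<And>i. i \<in> I \<Longrightarrow> bounded (C i)" "\<And>i. i \<in> I \<Longrightarrow> diameter (C i) \<le> \<delta>" and \<delta>: "0 \<le> \<delta>"
  shows "H2_delta \<delta> A \<le> (\<integral>\<^sup>+i. ennreal (pi / 4 * (diameter (C i))\<^sup>2) \<partial>count_space I)"
proof -
  obtain D where D: "(\<Union>n. D n) = (\<Union>i\<in>I. C i)" "\<And>n. D n \<in> insert {} (C ` I)"
    "(\<Sum>n. ennreal (pi / 4 * (diameter (D n))\<^sup>2)) = (\<integral>\<^sup>+i. ennreal (pi / 4 * (diameter (C i))\<^sup>2) \<partial>count_space I)"
    by (rule countable_family_as_sequence[OF I, of "\<lambda>X. ennreal (pi / 4 * (diameter X)\<^sup>2)" C]) (simp, rule that)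
  have "bounded (D n) \<and> diameter (D n) \<le> \<delta>" for n
  proof -
    consider "D n = {}" | i where "i \<in> I" "D n = C i" using D(2)[of n] by blast
    then show ?thesis by cases (simp_all add: C \<delta>)
  qed
  then have "H2_delta \<delta> A \<le> (\<Sum>n. ennreal (pi / 4 * (diameter (D n))\<^sup>2))"
    using cov by (intro H2_delta_le) (auto simp: D(1))
  then show ?thesis by (simp only: D(3))
qed

lemma emeasure_UN_countable_le:
  assumes "countable I" "\<And>i. i \<in> I \<Longrightarrow> C i \<in> sets M"
  shows "emeasure M (\<Union>i\<in>I. C i) \<le> (\<integral>\<^sup>+i. emeasure M (C i) \<partial>count_space I)"
proof -
  obtain D where D: "(\<Union>n. D n) = (\<Union>i\<in>I. C i)" "\<And>n. D n \<in> insert {} (C ` I)"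
    "(\<Sum>n. emeasure M (D n)) = (\<integral>\<^sup>+i. emeasure M (C i) \<partial>count_space I)"
    by (rule countable_family_as_sequence[OF assms(1), of "emeasure M" C]) (simp, rule that)
  have "D n \<in> sets M" for n using D(2)[of n] assms(2) by auto
  then have "emeasure M (\<Union>n. D n) \<le> (\<Sum>n. emeasure M (D n))"
    by (intro emeasure_subadditive_countably) auto
  then show ?thesis by (simp only: D)
qed

text \<open>Both the crude comparison of $H^2$ with the cone measure and its self-improvement come
  from one disjoint family of small caps whose fivefold enlargements cover $U$.\<close>

lemma cap_packing:
  assumes U: "open U" and \<delta>: "0 < \<delta>"
  obtains I :: "(real^3) set" and r :: "real^3 \<Rightarrow> real"
  where "countable I" "\<And>x. x \<in> I \<Longrightarrow> norm x = 1 \<and> 0 < r x \<and> 10 * r x \<le> min \<delta> 1 \<and> cball x (r x) \<subseteq> U"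
    "disjoint_family_on (\<lambda>x. cball x (r x)) I" "U \<inter> sphere 0 1 \<subseteq> (\<Union>x\<in>I. cball x (5 * r x))"
proof -
  \<comment> \<open>With 10 r <= min \<delta> 1 the fivefold ball has diameter at most \<delta> and
    radius at most 1/2, within the range of the cap formula.\<close>
  have "\<exists>r>0. 10 * r \<le> min \<delta> 1 \<and> cball x r \<subseteq> U" if "x \<in> U" for x
  proof -
    obtain e where "0 < e" "cball x e \<subseteq> U" using U \<open>x \<in> U\<close> open_contains_cball by blast
    then show ?thesis using \<delta>
      by (intro exI[of _ "min e (min \<delta> 1 / 10)"]) (auto simp: subset_eq)
  qed
  then obtain r where r: "\<And>x. x \<in> U \<Longrightarrow> 0 < r x \<and> 10 * r x \<le> min \<delta> 1 \<and> cball x (r x) \<subseteq> U"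
    by metis
  let ?K = "U \<inter> sphere 0 1"
  have 1: "?K \<subseteq> (\<Union>x\<in>?K. cball x (r x))" using r by (force intro: less_imp_le)
  have 2: "0 < r x \<and> r x \<le> 1" if "x \<in> ?K" for x using r[of x] that by auto
  obtain I where I: "countable I" "I \<subseteq> ?K"
     "pairwise (\<lambda>i j. disjnt (cball i (r i)) (cball j (r j))) I"
     "?K \<subseteq> (\<Union>i\<in>I. cball i (5 * r i))"
    by (rule Vitali_covering_lemma_cballs[OF 1 2])
  show ?thesis
  proof (rule that[of I r])
    show "norm x = 1 \<and> 0 < r x \<and> 10 * r x \<le> min \<delta> 1 \<and> cball x (r x) \<subseteq> U" if "x \<in> I" for x
    proof -
      have "x \<in> U" "norm x = 1" using that I(2) by auto
      then show ?thesis using r[of x] by simp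
    qed
    show "disjoint_family_on (\<lambda>x. cball x (r x)) I"
      using I(3) unfolding disjoint_family_on_def pairwise_def disjnt_def by simp
  qed (use I in auto)
qed

lemma cone_measure_inter_sphere:
  assumes "B \<in> sets (borel :: (real^3) measure)"
  shows "emeasure cone_measure (B \<inter> sphere 0 1) = emeasure cone_measure B"
  by (rule emeasure_eq_AE) (use AE_cone_measure_norm assms in \<open>auto elim!: eventually_mono\<close>)

text \<open>Fivefold enlargement multiplies the area of a cap by 25. On the packing V itself nothing
  is lost: its caps cover V and their areas add up exactly by disjointness, so V obeys the
  comparison with constant 1 at scale \<delta> while carrying a fixed share of U.\<close>

lemma
  assumes U: "open (U :: (real^3) set)" and \<delta>: "0 < \<delta>"
  shows H2_delta_le_25_cone: "H2_delta \<delta> (U \<inter> sphere 0 1) \<le> 25 * emeasure cone_measure U"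
    and cone_packing: "\<exists>V. V \<in> sets borel \<and> V \<subseteq> U \<and>
      H2_delta \<delta> (V \<inter> sphere 0 1) \<le> emeasure cone_measure V \<and>
      emeasure cone_measure U \<le> 25 * emeasure cone_measure V"
proof -
  obtain I and r :: "real^3 \<Rightarrow> real"
    where I: "countable I" "\<And>x. x \<in> I \<Longrightarrow> norm x = 1 \<and> 0 < r x \<and> 10 * r x \<le> min \<delta> 1 \<and> cball x (r x) \<subseteq> U"
    "disjoint_family_on (\<lambda>x. cball x (r x)) I" "U \<inter> sphere 0 1 \<subseteq> (\<Union>x\<in>I. cball x (5 * r x))"
    by (rule cap_packing[OF U \<delta>]) (rule that)
  define V where "V = (\<Union>x\<in>I. cball x (r x))"
  have V: "V \<in> sets borel" "V \<subseteq> U" using I by (auto simp: V_def)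
  have meas: "emeasure cone_measure V = (\<integral>\<^sup>+x. ennreal (pi * (r x)\<^sup>2) \<partial>count_space I)"
  proof -
    have "emeasure cone_measure V = (\<integral>\<^sup>+x. emeasure cone_measure (cball x (r x)) \<partial>count_space I)"
      unfolding V_def using I by (intro emeasure_UN_countable) auto
    also have "\<dots> = (\<integral>\<^sup>+x. ennreal (pi * (r x)\<^sup>2) \<partial>count_space I)"
    proof (rule nn_integral_cong)
      fix x assume "x \<in> space (count_space I)"
      then have "norm x = 1" "0 < r x" "r x \<le> 1" using I(2)[of x] by auto
      then show "emeasure cone_measure (cball x (r x)) = ennreal (pi * (r x)\<^sup>2)"
        by (rule emeasure_cone_measure_cap)
    qed
    finally show ?thesis .
  qed
  \<comment> \<open>Applied with c = 5 to the cover of U, and with c = 1 to V covered by its own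
    balls.\<close>
  have diam: "H2_delta \<delta> A \<le> (\<integral>\<^sup>+x. ennreal (pi * (c * r x)\<^sup>2) \<partial>count_space I)"
    if "A \<subseteq> (\<Union>x\<in>I. cball x (c * r x))" "0 \<le> c" "c \<le> 5" for A c
  proof -
    have "H2_delta \<delta> A \<le> (\<integral>\<^sup>+x. ennreal (pi / 4 * (diameter (cball x (c * r x)))\<^sup>2) \<partial>count_space I)"
    proof (rule H2_delta_le_countable[OF I(1) that(1)])
      fix x assume x: "x \<in> I"
      have r: "0 < r x" "10 * r x \<le> \<delta>" using I(2)[OF x] by auto
      have "c * r x \<le> 5 * r x" using that r by (intro mult_right_mono) auto
      moreover have n: "\<not> c * r x < 0" using that r by (simp add: not_less)
      ultimately show "diameter (cball x (c * r x)) \<le> \<delta>"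
        unfolding diameter_cball if_not_P[OF n] using r by linarith
    qed (use \<delta> in auto)
    also have "\<dots> = (\<integral>\<^sup>+x. ennreal (pi * (c * r x)\<^sup>2) \<partial>count_space I)"
    proof (rule nn_integral_cong)
      fix x assume "x \<in> space (count_space I)"
      then have "0 < r x" using I(2)[of x] by simp
      then have n: "\<not> c * r x < 0" using that by (simp add: not_less)
      show "ennreal (pi / 4 * (diameter (cball x (c * r x)))\<^sup>2) = ennreal (pi * (c * r x)\<^sup>2)"
        unfolding diameter_cball if_not_P[OF n] by (simp add: power_mult_distrib)
    qed
    finally show ?thesis .
  qed
  have "(\<integral>\<^sup>+x. ennreal (pi * (5 * r x)\<^sup>2) \<partial>count_space I) = (\<integral>\<^sup>+x. 25 * ennreal (pi * (r x)\<^sup>2) \<partial>count_space I)"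
    by (intro nn_integral_cong) (simp add: power_mult_distrib ennreal_mult[symmetric] mult_ac flip: ennreal_numeral)
  also have "\<dots> = 25 * emeasure cone_measure V"
    unfolding meas by (intro nn_integral_cmult) simp
  finally have 25: "(\<integral>\<^sup>+x. ennreal (pi * (5 * r x)\<^sup>2) \<partial>count_space I) = 25 * emeasure cone_measure V" .
  have "H2_delta \<delta> (U \<inter> sphere 0 1) \<le> 25 * emeasure cone_measure V"
    using diam[OF I(4)] unfolding 25 by simp
  also have "\<dots> \<le> 25 * emeasure cone_measure U"
    using U V by (intro mult_left_mono emeasure_mono) auto
  finally show "H2_delta \<delta> (U \<inter> sphere 0 1) \<le> 25 * emeasure cone_measure U" .
  have "H2_delta \<delta> (V \<inter> sphere 0 1) \<le> emeasure cone_measure V"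
    unfolding meas using diam[of "V \<inter> sphere 0 1" 1] by (simp add: V_def Int_lower1)
  moreover have "emeasure cone_measure U \<le> 25 * emeasure cone_measure V"
  proof -
    have "emeasure cone_measure U = emeasure cone_measure (U \<inter> sphere 0 1)"
      using U by (simp add: cone_measure_inter_sphere)
    also have "\<dots> \<le> emeasure cone_measure (\<Union>x\<in>I. cball x (5 * r x))"
      using I by (intro emeasure_mono) auto
    also have "\<dots> \<le> (\<integral>\<^sup>+x. emeasure cone_measure (cball x (5 * r x)) \<partial>count_space I)"
      using I(1) by (intro emeasure_UN_countable_le) auto
    also have "\<dots> = (\<integral>\<^sup>+x. ennreal (pi * (5 * r x)\<^sup>2) \<partial>count_space I)"
    proof (rule nn_integral_cong)
      fix x assume "x \<in> space (count_space I)"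
      then have "norm x = 1" "0 < 5 * r x" "5 * r x \<le> 1" using I(2)[of x] by auto
      then show "emeasure cone_measure (cball x (5 * r x)) = ennreal (pi * (5 * r x)\<^sup>2)"
        by (rule emeasure_cone_measure_cap)
    qed
    finally show ?thesis unfolding 25 .
  qed
  ultimately show "\<exists>V. V \<in> sets borel \<and> V \<subseteq> U \<and>
      H2_delta \<delta> (V \<inter> sphere 0 1) \<le> emeasure cone_measure V \<and>
      emeasure cone_measure U \<le> 25 * emeasure cone_measure V"
    using V by blast
qed

lemma H2_delta_Un:
  assumes "0 < \<delta>"
  shows "H2_delta \<delta> (A \<union> B) \<le> H2_delta \<delta> A + H2_delta \<delta> B"
proof -
  have "H2_delta \<delta> (A \<union> B) = H2_delta \<delta> (\<Union>i. binaryset A B i)" by (simp only: UN_binaryset_eq)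
  also have "\<dots> \<le> (\<Sum>i. H2_delta \<delta> (binaryset A B i))" by (rule H2_delta_UN)
  also have "\<dots> = H2_delta \<delta> A + H2_delta \<delta> B"
    by (rule suminf_binaryset_eq) (use assms in \<open>simp add: H2_delta_empty\<close>)
  finally show ?thesis .
qed

text \<open>Outer regularity of the finite measure \<open>cone_measure\<close>: B has an open
  superset of excess less than e/c, to which the assumed bound applies.\<close>

lemma H2_le_cone_borel:
  assumes c: "0 < (c::real)"
    and open_bd: "\<And>U. open U \<Longrightarrow> H2 (U \<inter> sphere 0 1) \<le> ennreal c * emeasure cone_measure U"
    and B: "B \<in> sets borel"
  shows "H2 (B \<inter> sphere 0 1) \<le> ennreal c * emeasure cone_measure B"
proof (rule ennreal_le_epsilon)
  fix e :: real assume e: "0 < e"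
  interpret C: finite_measure "cone_measure :: (real^3) measure" by (rule finite_measure_cone_measure)
  have "emeasure cone_measure B = (INF U\<in>{U. B \<subseteq> U \<and> open U}. emeasure cone_measure U)"
    using B by (intro outer_regular) auto
  moreover have "0 < ennreal (e / c)" using e c by simp
  then have "emeasure cone_measure B < emeasure cone_measure B + ennreal (e / c)"
    using C.emeasure_finite[of B] by (cases "emeasure cone_measure B") (simp_all add: ennreal_less_iff flip: ennreal_plus)
  ultimately obtain U where U: "B \<subseteq> U" "open U"
      "emeasure cone_measure U < emeasure cone_measure B + ennreal (e / c)"
    by (auto simp: INF_less_iff)
  have "H2 (B \<inter> sphere 0 1) \<le> H2 (U \<inter> sphere 0 1)" using U by (intro H2_mono) auto
  also have "\<dots> \<le> ennreal c * emeasure cone_measure U" by (rule open_bd[OF U(2)])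
  also have "\<dots> \<le> ennreal c * (emeasure cone_measure B + ennreal (e / c))"
    using U(3) by (intro mult_left_mono) auto
  also have "\<dots> = ennreal c * emeasure cone_measure B + ennreal e"
    using c e by (simp add: distrib_left flip: ennreal_mult)
  finally show "H2 (B \<inter> sphere 0 1) \<le> ennreal c * emeasure cone_measure B + ennreal e" .
qed

text \<open>At each scale \<delta>, at least 1/25 of the measure of U sits in a packing V that
  satisfies the bound with constant 1, and the remainder U - V satisfies it with constant c. The
  average of the two constants is at most c - (c - 1)/25, whatever \<delta> is.\<close>

lemma H2_le_cone_improve:
  assumes c: "1 \<le> (c::real)"
    and open_bd: "\<And>U. open U \<Longrightarrow> H2 (U \<inter> sphere 0 1) \<le> ennreal c * emeasure cone_measure U"
    and U: "open U"
  shows "H2 (U \<inter> sphere 0 1) \<le> ennreal (c - (c - 1) / 25) * emeasure cone_measure U"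
proof (rule H2_leI)
  fix \<delta> :: real assume \<delta>: "0 < \<delta>"
  interpret C: finite_measure "cone_measure :: (real^3) measure" by (rule finite_measure_cone_measure)
  obtain V where V: "V \<in> sets borel" "V \<subseteq> U"
    "H2_delta \<delta> (V \<inter> sphere 0 1) \<le> emeasure cone_measure V"
    "emeasure cone_measure U \<le> 25 * emeasure cone_measure V"
    using cone_packing[OF U \<delta>] by blast
  let ?m = "measure cone_measure U" and ?v = "measure cone_measure V"
  have Ub: "U \<in> sets borel" using U by simp
  have UV: "measure cone_measure (U - V) = ?m - ?v"
    using V Ub by (intro C.finite_measure_Diff) auto
  have vm: "?v \<le> ?m" using V Ub by (intro C.finite_measure_mono) auto
  have "ennreal ?m \<le> ennreal (25 * ?v)"
    using V(4) by (simp add: C.emeasure_eq_measure ennreal_mult)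
  then have m25: "?m \<le> 25 * ?v" by (simp add: ennreal_le_iff)
  have "H2_delta \<delta> (U \<inter> sphere 0 1) \<le> H2_delta \<delta> (V \<inter> sphere 0 1 \<union> ((U - V) \<inter> sphere 0 1))"
    by (rule H2_delta_mono) auto
  also have "\<dots> \<le> H2_delta \<delta> (V \<inter> sphere 0 1) + H2_delta \<delta> ((U - V) \<inter> sphere 0 1)"
    by (rule H2_delta_Un[OF \<delta>])
  also have "\<dots> \<le> emeasure cone_measure V + ennreal c * emeasure cone_measure (U - V)"
  proof (rule add_mono[OF V(3)])
    have "H2_delta \<delta> ((U - V) \<inter> sphere 0 1) \<le> H2 ((U - V) \<inter> sphere 0 1)"
      by (rule H2_delta_le_H2[OF \<delta>])
    also have "\<dots> \<le> ennreal c * emeasure cone_measure (U - V)"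
      by (rule H2_le_cone_borel[OF _ open_bd]) (use c V(1) Ub in auto)
    finally show "H2_delta \<delta> ((U - V) \<inter> sphere 0 1) \<le> ennreal c * emeasure cone_measure (U - V)" .
  qed
  also have "\<dots> = ennreal (?v + c * (?m - ?v))"
    using c vm by (simp add: C.emeasure_eq_measure UV flip: ennreal_mult ennreal_plus)
  also have "\<dots> \<le> ennreal ((c - (c - 1) / 25) * ?m)"
  proof (rule ennreal_leI)
    have "(c - 1) * ?m \<le> (c - 1) * (25 * ?v)" using m25 c by (intro mult_left_mono) auto
    then show "?v + c * (?m - ?v) \<le> (c - (c - 1) / 25) * ?m" by (simp add: field_simps)
  qed
  also have "\<dots> = ennreal (c - (c - 1) / 25) * emeasure cone_measure U"
    using c by (simp add: C.emeasure_eq_measure ennreal_mult)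
  finally show "H2_delta \<delta> (U \<inter> sphere 0 1) \<le> ennreal (c - (c - 1) / 25) * emeasure cone_measure U" .
qed

theorem H2_le_cone_measure:
  assumes "B \<in> sets borel"
  shows "H2 (B \<inter> sphere 0 1) \<le> emeasure cone_measure B"
proof -
  \<comment> \<open>The iterates of c -> c - (c - 1)/25 started at 25: each step multiplies the
    distance to 1 by 24/25.\<close>
  let ?c = "\<lambda>n. 1 + 24 * (24 / 25) ^ n :: real"
  have bd: "H2 (U \<inter> sphere 0 1) \<le> ennreal (?c n) * emeasure cone_measure U" if "open U" for U n
    using that
  proof (induction n arbitrary: U)
    case 0
    have "H2_delta \<delta> (U \<inter> sphere 0 1) \<le> 25 * emeasure cone_measure U" if "0 < \<delta>" for \<delta>
      using H2_delta_le_25_cone[OF 0 that] .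
    then have "H2 (U \<inter> sphere 0 1) \<le> 25 * emeasure cone_measure U" by (rule H2_leI)
    then show ?case by simp
  next
    case (Suc n)
    have "H2 (U \<inter> sphere 0 1) \<le> ennreal (?c n - (?c n - 1) / 25) * emeasure cone_measure U"
      by (rule H2_le_cone_improve[OF _ Suc.IH Suc.prems]) auto
    also have "?c n - (?c n - 1) / 25 = ?c (Suc n)" by simp
    finally show ?case .
  qed
  have "H2 (B \<inter> sphere 0 1) \<le> ennreal (?c n) * emeasure cone_measure B" for n
    by (rule H2_le_cone_borel[OF _ bd assms]) (auto intro: add_pos_nonneg)
  moreover have "(\<lambda>n. ennreal (?c n) * emeasure cone_measure B) \<longlonglongrightarrow> ennreal (1 + 24 * 0) * emeasure cone_measure B"
    using finite_measure.emeasure_finite[OF finite_measure_cone_measure, of B]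
    by (intro tendsto_mult_ennreal tendsto_ennrealI tendsto_intros LIMSEQ_realpow_zero) auto
  ultimately show ?thesis
    using LIMSEQ_le_const by fastforce
qed

section \<open>The scattering kernel\<close>

lemma sets_sphere_measure: "sets sphere_measure = sets (restrict_space borel (sphere 0 1))"
  and space_sphere_measure: "space sphere_measure = sphere 0 1"
  unfolding sphere_measure_def by (simp_all add: sets_surface_measure space_surface_measure)

lemma measurable_sphere_measureI:
  "f \<in> borel \<rightarrow>\<^sub>M N \<Longrightarrow> f \<in> sphere_measure \<rightarrow>\<^sub>M N"
  by (simp add: measurable_cong_sets[OF sets_sphere_measure refl] measurable_restrict_space1)

text \<open>With constant 1 here, averages over \<open>sphere_measure\<close> normalised by 4 pi are
  dominated by a kernel of total mass 1.\<close>

lemma sphere_measure_le_cone: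
  assumes f: "f \<in> borel_measurable borel"
  shows "(\<integral>\<^sup>+w. f w \<partial>sphere_measure) \<le> (\<integral>\<^sup>+w. f w \<partial>cone_measure)"
proof -
  let ?R = "restrict_space cone_measure (sphere 0 1) :: (real^3) measure"
  have sets: "sets sphere_measure = sets ?R"
    unfolding sets_sphere_measure by (rule sets_restrict_space_cong) simp
  have le: "sphere_measure \<le> ?R"
  proof (subst le_measure[OF sets], intro ballI)
    fix A assume "A \<in> sets sphere_measure"
    then have A: "A \<in> sets borel" "A \<subseteq> sphere 0 1"
      by (auto simp: sets_sphere_measure sets_restrict_space_iff)
    have "emeasure sphere_measure A = H2 (A \<inter> sphere 0 1)"
      unfolding sphere_measure_def using A by (simp add: emeasure_surface_measure Int_absorb2)
    also have "\<dots> \<le> emeasure cone_measure A" by (rule H2_le_cone_measure[OF A(1)])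
    also have "\<dots> = emeasure ?R A" using A by (simp add: emeasure_restrict_space)
    finally show "emeasure sphere_measure A \<le> emeasure ?R A" .
  qed
  have "(\<integral>\<^sup>+w. f w \<partial>sphere_measure) \<le> (\<integral>\<^sup>+w. f w \<partial>?R)"
    by (rule nn_integral_mono_measure[OF sets le])
  also have "\<dots> = (\<integral>\<^sup>+w. f w * indicator (sphere 0 1) w \<partial>cone_measure)"
    by (rule nn_integral_restrict_space) simp
  also have "\<dots> \<le> (\<integral>\<^sup>+w. f w \<partial>cone_measure)"
    by (intro nn_integral_mono) (simp add: indicator_def)
  finally show ?thesis .
qed

lemma emeasure_sphere_measure_le: "emeasure sphere_measure (space sphere_measure) \<le> ennreal (4 * pi)"
proof -
  have "(\<integral>\<^sup>+w. 1 \<partial>sphere_measure) \<le> (\<integral>\<^sup>+w. 1 \<partial>cone_measure :: (real^3) measure)"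
    by (rule sphere_measure_le_cone) simp
  then show ?thesis by (simp add: emeasure_cone_measure_UNIV_3)
qed

lemma finite_measure_sphere_measure: "finite_measure sphere_measure"
  by (rule finite_measureI) (use emeasure_sphere_measure_le in \<open>auto simp: top_unique\<close>)

section \<open>Exponential path lengths and moments of the kernel\<close>

definition exp_law :: "real \<Rightarrow> real measure" where
  "exp_law \<epsilon> = density lborel (exponential_density (1 / \<epsilon>))"

lemma sets_exp_law [simp, measurable_cong]: "sets (exp_law \<epsilon>) = sets borel"
  and space_exp_law [simp]: "space (exp_law \<epsilon>) = UNIV"
  by (simp_all add: exp_law_def)

lemma prob_space_exp_law: "0 < \<epsilon> \<Longrightarrow> prob_space (exp_law \<epsilon>)"
  unfolding exp_law_def by (rule prob_space_exponential_density) simp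

lemma nn_integral_exp_law:
  assumes [measurable]: "f \<in> borel_measurable borel"
  shows "(\<integral>\<^sup>+s. f s \<partial>exp_law \<epsilon>) = (\<integral>\<^sup>+s. ennreal (exponential_density (1 / \<epsilon>) s) * f s \<partial>lborel)"
  unfolding exp_law_def by (rule nn_integral_density) auto

lemma nn_integral_exp_law_power:
  assumes "0 < \<epsilon>"
  shows "(\<integral>\<^sup>+s. ennreal (s ^ i) \<partial>exp_law \<epsilon>) = ennreal (fact i * \<epsilon> ^ i)"
proof -
  have "(\<integral>\<^sup>+s. ennreal (s ^ i) \<partial>exp_law \<epsilon>) = (\<integral>\<^sup>+s. ennreal (exponential_density (1 / \<epsilon>) s * s ^ i) \<partial>lborel)"
    using assms by (subst nn_integral_exp_law, measurable)
      (intro nn_integral_cong, auto simp: exponential_density_def simp flip: ennreal_mult)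
  also have "\<dots> = ennreal (fact i * \<epsilon> ^ i)"
    using assms by (subst nn_integral_erlang_ith_moment) (auto simp: power_divide)
  finally show ?thesis .
qed

definition kern :: "real \<Rightarrow> real^3 \<Rightarrow> real" where
  "kern \<epsilon> z = exp (- norm z / \<epsilon>) / (4 * pi * \<epsilon> * (norm z)\<^sup>2)"

lemma kern_measurable [measurable]: "kern \<epsilon> \<in> borel_measurable borel"
  unfolding kern_def[abs_def] by measurable

lemma kern_nonneg: "0 < \<epsilon> \<Longrightarrow> 0 \<le> kern \<epsilon> z"
  by (simp add: kern_def)

lemma kern_minus: "kern \<epsilon> (- z) = kern \<epsilon> z"
  by (simp add: kern_def)

text \<open>The Jacobian s^2 of polar coordinates cancels the inverse square in \<open>kern\<close>
  and leaves the exponential density in s.\<close>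

lemma cone_exp_law_eq_kern:
  assumes e: "0 < \<epsilon>" and H [measurable]: "H \<in> borel_measurable borel"
  shows "(\<integral>\<^sup>+w. \<integral>\<^sup>+s. H (s *\<^sub>R w) \<partial>exp_law \<epsilon> \<partial>cone_measure)
    = ennreal (4 * pi) * (\<integral>\<^sup>+z. ennreal (kern \<epsilon> z) * H z \<partial>lborel)"
proof -
  have "ennreal (4 * pi) * (\<integral>\<^sup>+z. ennreal (kern \<epsilon> z) * H z \<partial>lborel)
      = (\<integral>\<^sup>+z. ennreal (4 * pi) * (ennreal (kern \<epsilon> z) * H z) \<partial>lborel)"
    by (rule nn_integral_cmult[symmetric]) measurable
  also have "\<dots> = (\<integral>\<^sup>+w. \<integral>\<^sup>+s. ennreal (s ^ (DIM(real^3) - 1)) * indicator {0<..} s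
       * (ennreal (4 * pi) * (ennreal (kern \<epsilon> (s *\<^sub>R w)) * H (s *\<^sub>R w))) \<partial>lborel \<partial>cone_measure)"
    by (rule nn_integral_polar) measurable
  also have "\<dots> = (\<integral>\<^sup>+w. \<integral>\<^sup>+s. H (s *\<^sub>R w) \<partial>exp_law \<epsilon> \<partial>cone_measure)"
  proof (intro nn_integral_cong_AE, rule AE_mp[OF AE_cone_measure_norm], intro AE_I2 impI)
    fix w :: "real^3" assume w: "norm w = 1"
    have [measurable]: "(\<lambda>s. H (s *\<^sub>R w)) \<in> borel_measurable borel" by measurable
    have "(\<integral>\<^sup>+s. H (s *\<^sub>R w) \<partial>exp_law \<epsilon>)
        = (\<integral>\<^sup>+s. ennreal (exponential_density (1 / \<epsilon>) s) * H (s *\<^sub>R w) \<partial>lborel)"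
      by (rule nn_integral_exp_law) measurable
    also have "\<dots> = (\<integral>\<^sup>+s. ennreal (s ^ (DIM(real^3) - 1)) * indicator {0<..} s
       * (ennreal (4 * pi) * (ennreal (kern \<epsilon> (s *\<^sub>R w)) * H (s *\<^sub>R w))) \<partial>lborel)"
    \<comment> \<open>At s = 0 the exponential density is 1/\<epsilon> while the polar integrand is
      0, so this null point is left out.\<close>
    proof (intro nn_integral_cong_AE, rule AE_mp[OF AE_lborel_singleton[of 0]], intro AE_I2 impI)
      fix s :: real assume s: "s \<noteq> 0"
      have "ennreal (exponential_density (1 / \<epsilon>) s) = ennreal (s ^ (DIM(real^3) - 1)) * indicator {0<..} s
         * (ennreal (4 * pi) * ennreal (kern \<epsilon> (s *\<^sub>R w)))"
      proof (cases "0 < s")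
        case True
        have "exponential_density (1 / \<epsilon>) s = s\<^sup>2 * (4 * pi * kern \<epsilon> (s *\<^sub>R w))"
          using True e w by (simp add: exponential_density_def kern_def field_simps)
        then show ?thesis using True e
          by (simp add: ennreal_mult kern_nonneg)
      qed (use s in \<open>simp add: exponential_density_def\<close>)
      then show "ennreal (exponential_density (1 / \<epsilon>) s) * H (s *\<^sub>R w)
        = ennreal (s ^ (DIM(real^3) - 1)) * indicator {0<..} s
         * (ennreal (4 * pi) * (ennreal (kern \<epsilon> (s *\<^sub>R w)) * H (s *\<^sub>R w)))"
        by (simp only: mult.assoc)
    qed
    finally show "(\<integral>\<^sup>+s. ennreal (s ^ (DIM(real^3) - 1)) * indicator {0<..} s
       * (ennreal (4 * pi) * (ennreal (kern \<epsilon> (s *\<^sub>R w)) * H (s *\<^sub>R w))) \<partial>lborel) = (\<integral>\<^sup>+s. H (s *\<^sub>R w) \<partial>exp_law \<epsilon>)"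
      by (rule sym)
  qed
  finally show ?thesis by (rule sym)
qed

text \<open>For a radial integrand the integral over directions contributes only the factor 4 pi,
  which cancels.\<close>

lemma nn_integral_kern_radial:
  assumes e: "0 < \<epsilon>" and G [measurable]: "G \<in> borel_measurable borel"
  shows "(\<integral>\<^sup>+z. ennreal (kern \<epsilon> z) * G (norm z) \<partial>lborel) = (\<integral>\<^sup>+s. G s \<partial>exp_law \<epsilon>)"
proof -
  have AE_pos: "AE s in exp_law \<epsilon>. 0 \<le> s"
    unfolding exp_law_def by (subst AE_density) (auto simp: exponential_density_def)
  have "ennreal (4 * pi) * (\<integral>\<^sup>+z. ennreal (kern \<epsilon> z) * G (norm z) \<partial>lborel)
      = (\<integral>\<^sup>+w. \<integral>\<^sup>+s. G (norm (s *\<^sub>R w)) \<partial>exp_law \<epsilon> \<partial>(cone_measure :: (real^3) measure))"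
    by (rule cone_exp_law_eq_kern[OF e, of "\<lambda>z. G (norm z)", symmetric]) measurable
  also have "\<dots> = (\<integral>\<^sup>+w. (\<integral>\<^sup>+s. G s \<partial>exp_law \<epsilon>) \<partial>(cone_measure :: (real^3) measure))"
  proof (intro nn_integral_cong_AE, rule AE_mp[OF AE_cone_measure_norm], intro AE_I2 impI)
    fix w :: "real^3" assume w: "norm w = 1"
    show "(\<integral>\<^sup>+s. G (norm (s *\<^sub>R w)) \<partial>exp_law \<epsilon>) = (\<integral>\<^sup>+s. G s \<partial>exp_law \<epsilon>)"
      by (rule nn_integral_cong_AE, rule AE_mp[OF AE_pos], intro AE_I2 impI) (simp add: w)
  qed
  also have "\<dots> = ennreal (4 * pi) * (\<integral>\<^sup>+s. G s \<partial>exp_law \<epsilon>)"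
    by (simp add: emeasure_cone_measure_UNIV_3 mult.commute)
  finally show ?thesis
    using pi_gt_zero by (subst (asm) ennreal_mult_cancel_left) (auto simp: ennreal_eq_0_iff)
qed

lemma nn_integral_kern_power:
  assumes e: "0 < \<epsilon>"
  shows "(\<integral>\<^sup>+z. ennreal (kern \<epsilon> z * norm z ^ i) \<partial>lborel) = ennreal (fact i * \<epsilon> ^ i)"
proof -
  have "(\<integral>\<^sup>+z. ennreal (kern \<epsilon> z * norm z ^ i) \<partial>lborel)
      = (\<integral>\<^sup>+z. ennreal (kern \<epsilon> z) * ennreal (norm z ^ i) \<partial>lborel)"
    using e by (intro nn_integral_cong) (simp add: ennreal_mult kern_nonneg)
  also have "\<dots> = (\<integral>\<^sup>+s. ennreal (s ^ i) \<partial>exp_law \<epsilon>)"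
    by (rule nn_integral_kern_radial[OF e]) measurable
  finally show ?thesis using nn_integral_exp_law_power[OF e] by simp
qed

text \<open>The exponential density is at most 1/\<epsilon>, so radii up to \<epsilon>/2 carry mass
  at most 1/2. This fixes the radius at which the kernel is later split.\<close>

lemma nn_integral_kern_small_ball:
  assumes e: "0 < \<epsilon>"
  shows "(\<integral>\<^sup>+z. ennreal (kern \<epsilon> z) * indicator {..\<epsilon> / 2} (norm z) \<partial>lborel) \<le> ennreal (1 / 2)"
proof -
  have "(\<integral>\<^sup>+z. ennreal (kern \<epsilon> z) * indicator {..\<epsilon> / 2} (norm z) \<partial>lborel)
      = (\<integral>\<^sup>+s. indicator {..\<epsilon> / 2} s \<partial>exp_law \<epsilon>)"
    by (rule nn_integral_kern_radial[OF e]) measurable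
  also have "\<dots> = (\<integral>\<^sup>+s. ennreal (exponential_density (1 / \<epsilon>) s) * indicator {..\<epsilon> / 2} s \<partial>lborel)"
    by (rule nn_integral_exp_law) measurable
  also have "\<dots> \<le> (\<integral>\<^sup>+s. ennreal (1 / \<epsilon>) * indicator {0..\<epsilon> / 2} s \<partial>lborel)"
    using e by (intro nn_integral_mono) (auto simp: exponential_density_def indicator_def intro!: ennreal_leI divide_right_mono)
  also have "\<dots> = ennreal (1 / \<epsilon>) * ennreal (\<epsilon> / 2)"
    using e by (subst nn_integral_cmult_indicator) auto
  also have "\<dots> = ennreal (1 / 2)" using e by (simp flip: ennreal_mult)
  finally show ?thesis .
qed

lemma kern_le_outside:
  assumes e: "0 < \<epsilon>" and z: "\<epsilon> / 2 \<le> norm z"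
  shows "kern \<epsilon> z \<le> 1 / (pi * \<epsilon> ^ 3)"
proof -
  have "(\<epsilon> / 2)\<^sup>2 \<le> (norm z)\<^sup>2" using e z by (intro power_mono) auto
  then have "4 * pi * \<epsilon> * (\<epsilon> / 2)\<^sup>2 \<le> 4 * pi * \<epsilon> * (norm z)\<^sup>2"
    using e by (intro mult_left_mono) auto
  then have "kern \<epsilon> z \<le> 1 / (4 * pi * \<epsilon> * (\<epsilon> / 2)\<^sup>2)"
    unfolding kern_def using e by (intro frac_le) auto
  also have "4 * pi * \<epsilon> * (\<epsilon> / 2)\<^sup>2 = pi * \<epsilon> ^ 3" by (simp add: power2_eq_square power3_eq_cube)
  finally show ?thesis .
qed

text \<open>Flights of exponential length from x, averaged over directions, amount to convolution
  with \<open>kern\<close>. The only inequality is the passage from \<open>sphere_measure\<close> to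
  \<open>cone_measure\<close>.\<close>

lemma sphere_exp_law_le_kern:
  assumes e: "0 < \<epsilon>" and h [measurable]: "h \<in> borel_measurable borel"
  shows "(\<integral>\<^sup>+w. \<integral>\<^sup>+s. h (x - s *\<^sub>R w) \<partial>exp_law \<epsilon> \<partial>sphere_measure)
    \<le> ennreal (4 * pi) * (\<integral>\<^sup>+y. ennreal (kern \<epsilon> (x - y)) * h y \<partial>lborel)"
proof -
  interpret prob_space "exp_law \<epsilon>" by (rule prob_space_exp_law[OF e])
  have "(\<integral>\<^sup>+w. \<integral>\<^sup>+s. h (x - s *\<^sub>R w) \<partial>exp_law \<epsilon> \<partial>sphere_measure)
      \<le> (\<integral>\<^sup>+w. \<integral>\<^sup>+s. h (x - s *\<^sub>R w) \<partial>exp_law \<epsilon> \<partial>cone_measure)"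
    by (rule sphere_measure_le_cone) measurable
  also have "\<dots> = ennreal (4 * pi) * (\<integral>\<^sup>+z. ennreal (kern \<epsilon> z) * h (x - z) \<partial>lborel)"
    by (rule cone_exp_law_eq_kern[OF e, of "\<lambda>z. h (x - z)"]) measurable
  also have "(\<integral>\<^sup>+z. ennreal (kern \<epsilon> z) * h (x - z) \<partial>lborel)
      = (\<integral>\<^sup>+y. ennreal (kern \<epsilon> (x - y)) * h y \<partial>lborel)"
  proof -
    have "(lborel :: (real^3) measure) = distr lborel borel (\<lambda>y. x - y)"
      using lborel_affine[of "-1" x] by (simp add: density_1)
    then have "(\<integral>\<^sup>+z. ennreal (kern \<epsilon> z) * h (x - z) \<partial>lborel)
        = (\<integral>\<^sup>+z. ennreal (kern \<epsilon> z) * h (x - z) \<partial>distr lborel borel (\<lambda>y. x - y))"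
      by (rule arg_cong)
    also have "\<dots> = (\<integral>\<^sup>+y. ennreal (kern \<epsilon> (x - y)) * h (x - (x - y)) \<partial>lborel)"
      by (rule nn_integral_distr) measurable
    finally show ?thesis by simp
  qed
  finally show ?thesis .
qed

section \<open>Finite area of the boundary of a bounded convex set\<close>

lemma H2_lipschitz_finite:
  assumes fin: "H2 A < \<infinity>" and L: "0 < L"
    and f: "\<And>x y. x \<in> A \<Longrightarrow> y \<in> A \<Longrightarrow> dist (f x) (f y) \<le> L * dist x y"
  shows "H2 (f ` A) < \<infinity>"
proof -
  have "H2 (f ` A) \<le> ennreal (L\<^sup>2) * (H2 A + 1)"
  proof (rule H2_leI)
    fix \<eta> :: real assume \<eta>: "0 < \<eta>"
    have "H2_delta (\<eta> / L) A \<le> H2 A" using \<eta> L by (intro H2_delta_le_H2) simp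
    \<comment> \<open>The slack 1 gives a strict inequality and thereby an actual cover; for
      finiteness its size is immaterial.\<close>
    also have "\<dots> < H2 A + 1" using fin by (cases "H2 A") (simp_all add: ennreal_less_iff flip: ennreal_plus ennreal_1)
    finally obtain C where C: "A \<subseteq> (\<Union>i. C i)" "\<And>i. bounded (C i)" "\<And>i. diameter (C i) \<le> \<eta> / L"
      "(\<Sum>i. ennreal (pi / 4 * (diameter (C i))\<^sup>2)) < H2 A + 1"
      by (rule H2_delta_near_cover) (rule that)
    have d: "dist x y \<le> L * diameter (C i)" if "x \<in> f ` (C i \<inter> A)" "y \<in> f ` (C i \<inter> A)" for x y i
    proof -
      obtain a b where ab: "a \<in> C i" "a \<in> A" "b \<in> C i" "b \<in> A" "x = f a" "y = f b"
        using \<open>x \<in> _\<close> \<open>y \<in> _\<close> by blast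
      have "dist x y \<le> L * dist a b" using f ab by simp
      also have "\<dots> \<le> L * diameter (C i)"
        using L ab C(2)[of i] by (intro mult_left_mono diameter_bounded_bound) auto
      finally show ?thesis .
    qed
    have dn: "0 \<le> diameter (C i)" for i using C(2) by (rule diameter_ge_0)
    have dia: "diameter (f ` (C i \<inter> A)) \<le> L * diameter (C i)" for i
      using d dn L by (intro diameter_le) (auto simp: dist_norm)
    have bd: "bounded (f ` (C i \<inter> A))" for i
      unfolding bounded_two_points using d by blast
    have dn': "0 \<le> diameter (f ` (C i \<inter> A))" for i using bd by (rule diameter_ge_0)
    have "H2_delta \<eta> (f ` A) \<le> (\<Sum>i. ennreal (pi / 4 * (diameter (f ` (C i \<inter> A)))\<^sup>2))"
    proof (rule H2_delta_le[OF _ bd])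
      show "f ` A \<subseteq> (\<Union>i. f ` (C i \<inter> A))" using C(1) by blast
      show "diameter (f ` (C i \<inter> A)) \<le> \<eta>" for i
        using dia[of i] C(3)[of i] L by (simp add: field_simps)
    qed
    also have "\<dots> \<le> (\<Sum>i. ennreal (L\<^sup>2) * ennreal (pi / 4 * (diameter (C i))\<^sup>2))"
    proof (intro suminf_le)
      fix i
      have "(diameter (f ` (C i \<inter> A)))\<^sup>2 \<le> (L * diameter (C i))\<^sup>2" using dia dn' by (intro power_mono)
      then have "pi / 4 * (diameter (f ` (C i \<inter> A)))\<^sup>2 \<le> L\<^sup>2 * (pi / 4 * (diameter (C i))\<^sup>2)"
        by (simp add: power_mult_distrib)
      then show "ennreal (pi / 4 * (diameter (f ` (C i \<inter> A)))\<^sup>2) \<le> ennreal (L\<^sup>2) * ennreal (pi / 4 * (diameter (C i))\<^sup>2)"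
        by (subst ennreal_mult[symmetric]) (auto intro: ennreal_leI)
    qed auto
    also have "\<dots> = ennreal (L\<^sup>2) * (\<Sum>i. ennreal (pi / 4 * (diameter (C i))\<^sup>2))" by (rule ennreal_suminf_cmult)
    also have "\<dots> \<le> ennreal (L\<^sup>2) * (H2 A + 1)" using C(4) by (intro mult_left_mono) auto
    finally show "H2_delta \<eta> (f ` A) \<le> ennreal (L\<^sup>2) * (H2 A + 1)" .
  qed
  also have "\<dots> < \<infinity>" using fin by (simp add: ennreal_mult_less_top)
  finally show ?thesis .
qed

lemma H2_sphere_finite: "H2 (sphere 0 1) < \<infinity>"
proof -
  have "H2 (UNIV \<inter> sphere 0 1) \<le> emeasure (cone_measure :: (real^3) measure) UNIV" by (rule H2_le_cone_measure) simp
  also have "\<dots> < \<infinity>" by (simp add: emeasure_cone_measure_UNIV_3)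
  finally show ?thesis by simp
qed

text \<open>Nearest-point projection onto the closure is 1-Lipschitz, and the image of a large
  sphere contains the boundary: from a boundary point one follows the outer normal of a supporting
  hyperplane until the sphere is met, and the projection leads back. Finiteness makes Fubini
  available for the boundary measure.\<close>

lemma H2_frontier_convex_finite:
  fixes \<Omega> :: "(real^3) set"
  assumes \<Omega>: "open \<Omega>" "convex \<Omega>" "bounded \<Omega>" "\<Omega> \<noteq> {}"
  shows "H2 (frontier \<Omega>) < \<infinity>"
proof -
  let ?K = "closure \<Omega>"
  have K: "convex ?K" "closed ?K" "?K \<noteq> {}" using \<Omega> by (auto simp: convex_closure)
  obtain R where R: "0 < R" "\<And>x. x \<in> ?K \<Longrightarrow> norm x \<le> R"
    using bounded_closure[OF \<Omega>(3)] unfolding bounded_pos by blast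
  define f where "f y = closest_point ?K (R *\<^sub>R y)" for y
  have "frontier \<Omega> \<subseteq> f ` sphere 0 1"
  proof
    fix x assume x: "x \<in> frontier \<Omega>"
    then have xK: "x \<in> ?K" and "x \<notin> \<Omega>" using \<Omega> by (auto simp: frontier_def interior_open)
    then obtain a b where a: "a \<noteq> 0" "a \<bullet> x \<le> b" "\<And>y. y \<in> \<Omega> \<Longrightarrow> b \<le> a \<bullet> y"
      using separating_hyperplane_sets[of "{x}" \<Omega>] \<Omega> by auto
    have "?K \<subseteq> {y. b \<le> a \<bullet> y}"
      using a(3) by (intro closure_minimal) (auto simp: closed_halfspace_ge)
    then have aK: "a \<bullet> x \<le> a \<bullet> y" if "y \<in> ?K" for y using a(2) that by force
    \<comment> \<open>A shift of length 2 R takes a point of norm at most R to norm at least R, so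
      the sphere of radius R is met within this range.\<close>
    have "\<exists>t\<ge>0. t \<le> (2 * R) / norm a \<and> norm (x - t *\<^sub>R a) = R"
    proof (rule IVT')
      show "norm (x - 0 *\<^sub>R a) \<le> R" using R xK by simp
      have "norm ((2 * R / norm a) *\<^sub>R a) \<le> norm (x - (2 * R / norm a) *\<^sub>R a) + norm x"
        by (metis norm_minus_commute norm_triangle_sub add.commute)
      then show "R \<le> norm (x - (2 * R / norm a) *\<^sub>R a)" using a(1) R(1) R(2)[OF xK] by simp
      show "continuous_on {0..2 * R / norm a} (\<lambda>t. norm (x - t *\<^sub>R a))" by (intro continuous_intros)
    qed (use R in auto)
    then obtain t where t: "0 \<le> t" "norm (x - t *\<^sub>R a) = R" by blast
    have "x = closest_point ?K (x - t *\<^sub>R a)"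
    proof (rule closest_point_unique[OF K(1,2) xK], intro ballI)
      fix z assume z: "z \<in> ?K"
      have "(dist (x - t *\<^sub>R a) x)\<^sup>2 \<le> (dist (x - t *\<^sub>R a) z)\<^sup>2"
      proof -
        have "0 \<le> t * (a \<bullet> (z - x))" using t aK[OF z] by (simp add: inner_diff_right)
        moreover have "(dist (x - t *\<^sub>R a) z)\<^sup>2 = (norm (z - x))\<^sup>2 + 2 * (t * (a \<bullet> (z - x))) + (norm (t *\<^sub>R a))\<^sup>2"
          unfolding dist_norm power2_norm_eq_inner
          by (simp add: inner_diff_left inner_diff_right inner_commute power2_eq_square algebra_simps)
        ultimately show ?thesis by (simp add: dist_norm)
      qed
      then show "dist (x - t *\<^sub>R a) x \<le> dist (x - t *\<^sub>R a) z" by (rule power2_le_imp_le) simp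
    qed
    also have "\<dots> = f ((1 / R) *\<^sub>R (x - t *\<^sub>R a))" using R by (simp add: f_def)
    finally have "x = f ((1 / R) *\<^sub>R (x - t *\<^sub>R a))" .
    moreover have "(1 / R) *\<^sub>R (x - t *\<^sub>R a) \<in> sphere 0 1" using t(2) R(1) by simp
    ultimately show "x \<in> f ` sphere 0 1" by (rule image_eqI)
  qed
  then have "H2 (frontier \<Omega>) \<le> H2 (f ` sphere 0 1)" by (rule H2_mono)
  also have "\<dots> < \<infinity>"
  proof (rule H2_lipschitz_finite[OF H2_sphere_finite R(1)])
    fix x y :: "real^3"
    have "dist (f x) (f y) \<le> dist (R *\<^sub>R x) (R *\<^sub>R y)"
      unfolding f_def by (rule closest_point_lipschitz[OF K])
    also have "\<dots> = R * dist x y" using R(1) by (simp add: dist_norm flip: scaleR_diff_right)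
    finally show "dist (f x) (f y) \<le> R * dist x y" .
  qed
  finally show ?thesis .
qed

section \<open>Geometry of the boundary\<close>

lemma Ck_subset: "Ck k U f \<Longrightarrow> V \<subseteq> U \<Longrightarrow> Ck k V f"
proof (induction k arbitrary: f)
  case 0 then show ?case by (auto intro: continuous_on_subset)
next
  case (Suc k) then show ?case by auto
qed

lemma has_derivative_grad:
  assumes "f differentiable (at x)"
  shows "(f has_derivative (\<lambda>h. grad f x \<bullet> h)) (at x)"
proof -
  let ?D = "frechet_derivative f (at x)"
  have D: "(f has_derivative ?D) (at x)" using assms by (simp add: frechet_derivative_works)
  then have lin: "linear ?D" by (rule has_derivative_linear)
  have "?D h = grad f x \<bullet> h" for h
  proof -
    have "?D h = ?D (\<Sum>i\<in>UNIV. h $ i *\<^sub>R axis i 1)" by (simp add: basis_expansion flip: scalar_mult_eq_scaleR)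
    also have "\<dots> = (\<Sum>i\<in>UNIV. h $ i * ?D (axis i 1))"
      using lin by (simp add: linear_sum linear_scale)
    also have "\<dots> = grad f x \<bullet> h" by (simp add: grad_def inner_vec_def mult.commute)
    finally show ?thesis .
  qed
  then have "?D = (\<lambda>h. grad f x \<bullet> h)" by (rule ext)
  with D show ?thesis by simp
qed

lemma DERIV_along_line:
  assumes "f differentiable (at x)"
  shows "((\<lambda>t. f (x + t *\<^sub>R d)) has_real_derivative grad f x \<bullet> d) (at 0)"
proof -
  have "(f has_derivative (\<lambda>h. grad f x \<bullet> h)) (at (x + 0 *\<^sub>R d))"
    using has_derivative_grad[OF assms] by simp
  moreover have "((\<lambda>t. x + t *\<^sub>R d) has_derivative (\<lambda>t. t *\<^sub>R d)) (at 0)"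
    by (auto intro!: derivative_eq_intros)
  ultimately have "((\<lambda>t. f (x + t *\<^sub>R d)) has_derivative (\<lambda>t. grad f x \<bullet> (t *\<^sub>R d))) (at 0)"
    by (rule has_derivative_compose[rotated])
  then show ?thesis
    by (simp add: has_field_derivative_def mult.commute[of _ "grad f x \<bullet> d"])
qed

lemma Ck3_continuous_grad:
  assumes "Ck 3 U f"
  shows "continuous_on U (grad f)"
proof -
  have "\<forall>i. \<forall>x\<in>U. (\<lambda>x. grad f x $ i) differentiable (at x)"
    using assms by (simp add: numeral_3_eq_3)
  then have "continuous_on U (\<lambda>x. grad f x $ i)" for i
    by (intro continuous_at_imp_continuous_on) (auto intro: differentiable_imp_continuous_within)
  then have "continuous_on U (\<lambda>x. \<chi> i. grad f x $ i)" by (rule continuous_on_vec_lambda)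
  then show ?thesis by simp
qed

section \<open>Supporting half-spaces and the outward normal\<close>

lemma local_defining_fn_differentiable:
  "local_defining_fn \<Omega> x0 r \<rho> \<Longrightarrow> x \<in> ball x0 r \<Longrightarrow> \<rho> differentiable (at x)"
  by (simp add: local_defining_fn_def numeral_3_eq_3)

text \<open>One defining function serves all nearby boundary points; this is what makes the normal
  field continuous.\<close>

lemma local_defining_fn_recenter:
  assumes "local_defining_fn \<Omega> x0 r \<rho>" and x: "x \<in> ball x0 r"
  shows "local_defining_fn \<Omega> x (r - dist x0 x) \<rho>"
proof -
  have sub: "ball x (r - dist x0 x) \<subseteq> ball x0 r"
  proof
    fix y assume "y \<in> ball x (r - dist x0 x)"
    then show "y \<in> ball x0 r" using dist_triangle[of x0 y x] by simp
  qed
  then show ?thesis using assms Ck_subset[OF _ sub, of 3 \<rho>]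
    unfolding local_defining_fn_def by auto
qed

text \<open>The definition only says where \<rho> is negative. The value 0 on the boundary comes
  from continuity: a positive value at x0 would keep \<Omega> away from x0.\<close>

lemma local_defining_fn_frontier:
  assumes \<Omega>: "open \<Omega>" and x0: "x0 \<in> frontier \<Omega>" and l: "local_defining_fn \<Omega> x0 r \<rho>"
  shows "\<rho> x0 = 0"
proof -
  have r: "0 < r" "\<And>x. x \<in> ball x0 r \<Longrightarrow> x \<in> \<Omega> \<longleftrightarrow> \<rho> x < 0" using l by (auto simp: local_defining_fn_def)
  have c: "continuous (at x0) \<rho>"
    using local_defining_fn_differentiable[OF l, of x0] r by (simp add: differentiable_imp_continuous_within)
  have "x0 \<notin> \<Omega>" "x0 \<in> closure \<Omega>" using x0 \<Omega> by (auto simp: frontier_def interior_open)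
  then have "0 \<le> \<rho> x0" using r(1) r(2)[of x0] by auto
  moreover have "\<not> 0 < \<rho> x0"
  proof
    assume "0 < \<rho> x0"
    then have "\<forall>\<^sub>F x in at x0. 0 < \<rho> x" using c by (auto simp: continuous_at intro: order_tendstoD)
    then obtain d where d: "0 < d" "\<And>x. x \<noteq> x0 \<Longrightarrow> dist x x0 < d \<Longrightarrow> 0 < \<rho> x"
      unfolding eventually_at by blast
    obtain y where y: "y \<in> \<Omega>" "dist y x0 < min d r"
      using \<open>x0 \<in> closure \<Omega>\<close> d(1) r(1) unfolding closure_approachable by (metis min_less_iff_conj)
    then have "y \<noteq> x0" using \<open>x0 \<notin> \<Omega>\<close> by auto
    then have "0 < \<rho> y" using d(2) y by simp
    then show False using r(2)[of y] y by (simp add: dist_commute)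
  qed
  ultimately show ?thesis by simp
qed

lemma local_defining_fn_inward:
  assumes \<Omega>: "open \<Omega>" and x0: "x0 \<in> frontier \<Omega>" and l: "local_defining_fn \<Omega> x0 r \<rho>"
    and d: "grad \<rho> x0 \<bullet> d < 0"
  shows "\<exists>t>0. x0 + t *\<^sub>R d \<in> \<Omega>"
proof -
  have r: "0 < r" "\<And>x. x \<in> ball x0 r \<Longrightarrow> x \<in> \<Omega> \<longleftrightarrow> \<rho> x < 0" using l by (auto simp: local_defining_fn_def)
  obtain e where e: "0 < e" "\<And>h. 0 < h \<Longrightarrow> h < e \<Longrightarrow> \<rho> (x0 + (0 + h) *\<^sub>R d) < \<rho> (x0 + 0 *\<^sub>R d)"
    using DERIV_neg_dec_right[OF DERIV_along_line[OF local_defining_fn_differentiable[OF l, of x0]] d] r(1) by auto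
  define t where "t = min (e / 2) (r / (norm d + 1) / 2)"
  have nd: "0 < norm d + 1" using norm_ge_zero[of d] by linarith
  have t: "0 < t" "t < e" using e(1) r(1) nd by (auto simp: t_def)
  have "t \<le> r / (norm d + 1) / 2" by (simp add: t_def)
  then have "t * (norm d + 1) \<le> r / 2" using nd by (simp add: field_simps)
  then have "t * norm d < r" using t(1) r(1) by (simp add: distrib_left)
  then have "x0 + t *\<^sub>R d \<in> ball x0 r" using t(1) by (simp add: dist_norm)
  moreover have "\<rho> (x0 + t *\<^sub>R d) < 0"
    using e(2)[OF t] local_defining_fn_frontier[OF \<Omega> x0 l] by simp
  ultimately show ?thesis using r(2) t(1) by blast
qed

text \<open>If \<rho> increased from x0 towards a point z of \<Omega>, it would be positive on the
  first part of the segment to z, yet by convexity that segment lies in \<Omega> apart from x0.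
  Openness, tested by pushing y along the gradient, makes the inequality strict.\<close>

lemma local_defining_fn_support:
  assumes \<Omega>: "open \<Omega>" "convex \<Omega>" and x0: "x0 \<in> frontier \<Omega>" and l: "local_defining_fn \<Omega> x0 r \<rho>"
    and y: "y \<in> \<Omega>"
  shows "grad \<rho> x0 \<bullet> (y - x0) < 0"
proof -
  have r: "0 < r" "\<And>x. x \<in> ball x0 r \<Longrightarrow> x \<in> \<Omega> \<longleftrightarrow> \<rho> x < 0" "grad \<rho> x0 \<noteq> 0"
    using l by (auto simp: local_defining_fn_def)
  have cl: "x0 \<in> closure \<Omega>" using x0 by (simp add: frontier_def)
  have le: "grad \<rho> x0 \<bullet> (z - x0) \<le> 0" if z: "z \<in> \<Omega>" for z
  proof (rule ccontr)
    assume "\<not> ?thesis"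
    then have pos: "0 < grad \<rho> x0 \<bullet> (z - x0)" by simp
    obtain e where e: "0 < e" "\<And>h. 0 < h \<Longrightarrow> h < e \<Longrightarrow> \<rho> (x0 + 0 *\<^sub>R (z - x0)) < \<rho> (x0 + (0 + h) *\<^sub>R (z - x0))"
      using DERIV_pos_inc_right[OF DERIV_along_line[OF local_defining_fn_differentiable[OF l, of x0]] pos] r(1) by auto
    define t where "t = min (min (e / 2) 1) (r / (norm (z - x0) + 1) / 2)"
    have nd: "0 < norm (z - x0) + 1" using norm_ge_zero[of "z - x0"] by linarith
    have t: "0 < t" "t < e" "t \<le> 1" using e(1) r(1) nd by (auto simp: t_def)
    have "t \<le> r / (norm (z - x0) + 1) / 2" by (simp add: t_def)
    then have "t * (norm (z - x0) + 1) \<le> r / 2" using nd by (simp add: field_simps)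
    then have "t * norm (z - x0) < r" using t(1) r(1) by (simp add: distrib_left)
    then have "x0 + t *\<^sub>R (z - x0) \<in> ball x0 r" using t(1) by (simp add: dist_norm)
    moreover have "0 < \<rho> (x0 + t *\<^sub>R (z - x0))"
      using e(2)[OF t(1,2)] local_defining_fn_frontier[OF \<Omega>(1) x0 l] by simp
    moreover have "x0 - t *\<^sub>R (x0 - z) \<in> interior \<Omega>"
      using z \<Omega> cl t by (intro mem_interior_closure_convex_shrink) (auto simp: interior_open)
    then have "x0 + t *\<^sub>R (z - x0) \<in> \<Omega>" using \<Omega>(1) by (simp add: interior_open algebra_simps)
    ultimately show False using r(2) by fastforce
  qed
  obtain e where e: "0 < e" "cball y e \<subseteq> \<Omega>" using \<Omega>(1) y open_contains_cball by blast
  define s where "s = e / norm (grad \<rho> x0)"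
  have s: "0 < s" using e r(3) by (simp add: s_def)
  have "y + s *\<^sub>R grad \<rho> x0 \<in> cball y e" using e r(3) by (simp add: dist_norm s_def)
  then have "grad \<rho> x0 \<bullet> (y + s *\<^sub>R grad \<rho> x0 - x0) \<le> 0" using e(2) le by blast
  then have "grad \<rho> x0 \<bullet> (y - x0) + s * (grad \<rho> x0 \<bullet> grad \<rho> x0) \<le> 0"
    by (simp add: inner_diff_right inner_add_right)
  moreover have "0 < s * (grad \<rho> x0 \<bullet> grad \<rho> x0)" using s r(3) by simp
  ultimately show ?thesis by linarith
qed

text \<open>\<open>outward_normal\<close> selects a defining function by choice, so independence of
  it has to be shown. If the unit normals n1 and n2 differed, the direction n2 - n1 would enter
  \<Omega> by the first function and leave the supporting half-space of the second.\<close>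

lemma local_defining_fn_normal_unique:
  assumes \<Omega>: "open \<Omega>" "convex \<Omega>" and x0: "x0 \<in> frontier \<Omega>"
    and l1: "local_defining_fn \<Omega> x0 r1 \<rho>1" and l2: "local_defining_fn \<Omega> x0 r2 \<rho>2"
  shows "sgn (grad \<rho>1 x0) = sgn (grad \<rho>2 x0)"
proof (rule ccontr)
  let ?n1 = "sgn (grad \<rho>1 x0)" and ?n2 = "sgn (grad \<rho>2 x0)"
  assume ne: "?n1 \<noteq> ?n2"
  have g: "grad \<rho>1 x0 \<noteq> 0" "grad \<rho>2 x0 \<noteq> 0"
    using l1 l2 by (auto simp: local_defining_fn_def)
  then have n: "?n1 \<bullet> ?n1 = 1" "?n2 \<bullet> ?n2 = 1" by (simp_all add: norm_sgn flip: norm_eq_1)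
  have "0 < (?n2 - ?n1) \<bullet> (?n2 - ?n1)" using ne by simp
  then have lt: "?n1 \<bullet> ?n2 < 1" using n by (simp add: inner_diff_left inner_diff_right inner_commute)
  have sgn_inner: "sgn v \<bullet> d < 0 \<longleftrightarrow> v \<bullet> d < 0" if "v \<noteq> 0" for v d :: "real^3"
    using that by (simp add: sgn_div_norm mult_less_0_iff)
  have "?n1 \<bullet> (?n2 - ?n1) < 0" using lt n by (simp add: inner_diff_right)
  then have "grad \<rho>1 x0 \<bullet> (?n2 - ?n1) < 0" using sgn_inner[OF g(1)] by blast
  from local_defining_fn_inward[OF \<Omega>(1) x0 l1 this] obtain t where t: "0 < t" "x0 + t *\<^sub>R (?n2 - ?n1) \<in> \<Omega>" by blast
  have "grad \<rho>2 x0 \<bullet> (x0 + t *\<^sub>R (?n2 - ?n1) - x0) < 0"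
    by (rule local_defining_fn_support[OF \<Omega> x0 l2 t(2)])
  then have "grad \<rho>2 x0 \<bullet> (?n2 - ?n1) < 0" using t(1) by (simp add: mult_less_0_iff)
  then have "?n2 \<bullet> (?n2 - ?n1) < 0" using sgn_inner[OF g(2)] by blast
  then show False using lt n by (simp add: inner_diff_right inner_commute)
qed

lemma outward_normal_eq:
  assumes \<Omega>: "open \<Omega>" "convex \<Omega>" and x0: "x0 \<in> frontier \<Omega>" and l: "local_defining_fn \<Omega> x0 r \<rho>"
  shows "outward_normal \<Omega> x0 = sgn (grad \<rho> x0)"
proof -
  have "\<exists>r \<rho>. local_defining_fn \<Omega> x0 r \<rho> \<and> outward_normal \<Omega> x0 = (1 / norm (grad \<rho> x0)) *\<^sub>R grad \<rho> x0"
    unfolding outward_normal_def by (rule someI_ex) (use l in blast)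
  then obtain r' \<rho>' where "local_defining_fn \<Omega> x0 r' \<rho>'" "outward_normal \<Omega> x0 = sgn (grad \<rho>' x0)"
    by (auto simp: sgn_div_norm inverse_eq_divide)
  then show ?thesis using local_defining_fn_normal_unique[OF \<Omega> x0 _ l] by simp
qed

lemma continuous_on_outward_normal:
  assumes \<Omega>: "open \<Omega>" "convex \<Omega>" "C3_boundary \<Omega>"
  shows "continuous_on (frontier \<Omega>) (outward_normal \<Omega>)"
  unfolding continuous_on_eq_continuous_within
proof
  fix x0 assume x0: "x0 \<in> frontier \<Omega>"
  then obtain r \<rho> where l: "local_defining_fn \<Omega> x0 r \<rho>"
    using \<Omega>(3) unfolding C3_boundary_def by blast
  have r: "0 < r" "Ck 3 (ball x0 r) \<rho>" "\<And>x. x \<in> ball x0 r \<Longrightarrow> grad \<rho> x \<noteq> 0"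
    using l by (auto simp: local_defining_fn_def)
  have "continuous_on (ball x0 r) (\<lambda>x. sgn (grad \<rho> x))"
    unfolding sgn_div_norm using r(3) by (intro continuous_intros Ck3_continuous_grad r(2)) auto
  then have "continuous (at x0) (\<lambda>x. sgn (grad \<rho> x))"
    using r(1) by (simp add: continuous_on_eq_continuous_at)
  then have "continuous (at x0 within frontier \<Omega>) (\<lambda>x. sgn (grad \<rho> x))"
    by (rule continuous_at_imp_continuous_at_within)
  then show "continuous (at x0 within frontier \<Omega>) (outward_normal \<Omega>)"
  proof (rule continuous_transform_within[OF _ r(1) x0])
    fix x assume "x \<in> frontier \<Omega>" "dist x x0 < r"
    then show "sgn (grad \<rho> x) = outward_normal \<Omega> x"
      using outward_normal_eq[OF \<Omega>(1,2) _ local_defining_fn_recenter[OF l, of x]]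
      by (simp add: dist_commute)
  qed
qed

lemma outward_normal_support:
  assumes \<Omega>: "open \<Omega>" "convex \<Omega>" "C3_boundary \<Omega>" and x0: "x0 \<in> frontier \<Omega>" and y: "y \<in> \<Omega>"
  shows "outward_normal \<Omega> x0 \<bullet> (y - x0) < 0"
proof -
  obtain r \<rho> where l: "local_defining_fn \<Omega> x0 r \<rho>"
    using \<Omega>(3) x0 unfolding C3_boundary_def by blast
  then have "grad \<rho> x0 \<noteq> 0" by (auto simp: local_defining_fn_def)
  then show ?thesis
    using local_defining_fn_support[OF \<Omega>(1,2) x0 l y]
    by (simp add: outward_normal_eq[OF \<Omega>(1,2) x0 l] sgn_div_norm mult_less_0_iff)
qed

text \<open>Statements about the density with this indicator can be unfolded for a measurable set;
  continuity of the normal field provides measurability.\<close>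

lemma Gamma_minus_sets:
  assumes \<Omega>: "open \<Omega>" "convex \<Omega>" "C3_boundary \<Omega>"
  shows "Gamma_minus \<Omega> \<in> sets (bdry_phase_measure \<Omega>)"
proof -
  have fr: "frontier \<Omega> \<in> sets borel" by simp
  let ?M = "surface_measure (frontier \<Omega>)"
  have "outward_normal \<Omega> \<in> borel_measurable (restrict_space borel (frontier \<Omega>))"
    by (rule borel_measurable_continuous_on_restrict[OF continuous_on_outward_normal[OF \<Omega>]])
  then have [measurable]: "outward_normal \<Omega> \<in> borel_measurable ?M"
    by (simp add: measurable_cong_sets[OF sets_surface_measure[OF fr] refl])
  have [measurable]: "(\<lambda>w. w) \<in> borel_measurable sphere_measure"
    by (rule measurable_sphere_measureI) simp
  have "(\<lambda>z. snd z \<bullet> outward_normal \<Omega> (fst z)) \<in> borel_measurable (?M \<Otimes>\<^sub>M sphere_measure)"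
    by measurable
  then have "{z \<in> space (?M \<Otimes>\<^sub>M sphere_measure). snd z \<bullet> outward_normal \<Omega> (fst z) < 0} \<in> sets (?M \<Otimes>\<^sub>M sphere_measure)"
    by measurable
  also have "{z \<in> space (?M \<Otimes>\<^sub>M sphere_measure). snd z \<bullet> outward_normal \<Omega> (fst z) < 0} = Gamma_minus \<Omega>"
    by (auto simp: Gamma_minus_def space_pair_measure space_surface_measure space_sphere_measure)
  finally show ?thesis by (simp add: bdry_phase_measure_def)
qed

section \<open>Exit times and the trace on the boundary\<close>

lemma back_exit_props:
  assumes \<Omega>: "open \<Omega>" "convex \<Omega>" "bounded \<Omega>" and x: "x \<in> \<Omega>" and w: "norm w = 1"
  defines "\<tau> \<equiv> back_exit \<Omega> x w"
  shows back_exit_frontier: "x - \<tau> *\<^sub>R w \<in> frontier \<Omega>"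
    and back_exit_pos: "0 < \<tau>"
    and less_back_exit_iff: "0 \<le> t \<Longrightarrow> t < \<tau> \<longleftrightarrow> x - t *\<^sub>R w \<in> \<Omega>"
proof -
  let ?A = "{s. 0 \<le> s \<and> x - s *\<^sub>R w \<notin> \<Omega>}"
  obtain R where R: "\<And>y. y \<in> \<Omega> \<Longrightarrow> norm y \<le> R" using \<Omega>(3) unfolding bounded_iff by blast
  \<comment> \<open>A time beyond the diameter bound 2 R belongs to ?A, so the infimum defining the
    exit time is not taken over the empty set.\<close>
  have "x - (2 * R + 1) *\<^sub>R w \<notin> \<Omega>"
  proof
    assume "x - (2 * R + 1) *\<^sub>R w \<in> \<Omega>"
    then have "norm (x - (2 * R + 1) *\<^sub>R w) \<le> R" by (rule R)
    moreover have "norm ((2 * R + 1) *\<^sub>R w) \<le> norm (x - (2 * R + 1) *\<^sub>R w) + norm x"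
      by (metis norm_minus_commute norm_triangle_sub add.commute)
    ultimately show False using R[OF x] w norm_ge_zero[of x] by simp
  qed
  moreover have "0 \<le> 2 * R + 1" using R[OF x] norm_ge_zero[of x] by linarith
  ultimately have ne: "?A \<noteq> {}" by blast
  have bdd: "bdd_below ?A" by (rule bdd_belowI[of _ 0]) simp
  have cl: "closed ?A"
  proof -
    have "?A = {0..} \<inter> (\<lambda>s. x - s *\<^sub>R w) -` (- \<Omega>)" by auto
    moreover have "closed ((\<lambda>s. x - s *\<^sub>R w) -` (- \<Omega>))"
      using \<Omega>(1) by (intro closed_vimage continuous_intros) (simp add: closed_Compl)
    ultimately show ?thesis by (simp add: closed_Int)
  qed
  have in_A: "\<tau> \<in> ?A"
    unfolding \<tau>_def back_exit_def by (rule closed_contains_Inf[OF ne bdd cl])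
  then have \<tau>: "0 \<le> \<tau>" "x - \<tau> *\<^sub>R w \<notin> \<Omega>" by auto
  show pos: "0 < \<tau>" using \<tau> x by (cases "\<tau> = 0") auto
  have below: "x - t *\<^sub>R w \<in> \<Omega>" if "0 \<le> t" "t < \<tau>" for t
    using cInf_lower[OF _ bdd, of t] that unfolding \<tau>_def back_exit_def by fastforce
  show "t < \<tau> \<longleftrightarrow> x - t *\<^sub>R w \<in> \<Omega>" if t: "0 \<le> t"
  proof
    assume a: "x - t *\<^sub>R w \<in> \<Omega>"
    show "t < \<tau>"
    proof (rule ccontr)
      assume "\<not> t < \<tau>"
      then have "\<tau> \<le> t" "0 < t" using pos by auto
      \<comment> \<open>A line that has left the convex set cannot return: the exit point would be a
        convex combination of x and the later point x - t w.\<close>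
      have "(1 - \<tau> / t) *\<^sub>R x + (\<tau> / t) *\<^sub>R (x - t *\<^sub>R w) \<in> \<Omega>"
        using \<Omega>(2) x a \<open>\<tau> \<le> t\<close> \<open>0 < t\<close> \<tau>(1) by (intro convexD) auto
      also have "(1 - \<tau> / t) *\<^sub>R x + (\<tau> / t) *\<^sub>R (x - t *\<^sub>R w) = x - \<tau> *\<^sub>R w"
        using \<open>0 < t\<close> by (simp add: algebra_simps)
      finally show False using \<tau>(2) by simp
    qed
  qed (rule below[OF t])
  have "x - \<tau> *\<^sub>R w \<in> closure \<Omega>"
  proof (rule closure_approachable[THEN iffD2], intro allI impI)
    fix e :: real assume e: "0 < e"
    define t where "t = max 0 (\<tau> - e / 2)"
    have "0 \<le> t" "t < \<tau>" using pos e by (auto simp: t_def)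
    then have "x - t *\<^sub>R w \<in> \<Omega>" by (rule below)
    moreover have "dist (x - t *\<^sub>R w) (x - \<tau> *\<^sub>R w) < e"
    proof -
      have "(x - t *\<^sub>R w) - (x - \<tau> *\<^sub>R w) = (\<tau> - t) *\<^sub>R w" by (simp add: algebra_simps)
      then have "dist (x - t *\<^sub>R w) (x - \<tau> *\<^sub>R w) = \<bar>\<tau> - t\<bar>" using w by (simp add: dist_norm)
      then show ?thesis using e pos by (auto simp: t_def)
    qed
    ultimately show "\<exists>y\<in>\<Omega>. dist y (x - \<tau> *\<^sub>R w) < e" by blast
  qed
  then show "x - \<tau> *\<^sub>R w \<in> frontier \<Omega>" using \<tau>(2) \<Omega>(1) by (simp add: frontier_def interior_open)
qed

text \<open>A covering set of diameter d, swept in direction w over a length 2 L, is covered by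
  about 2 L/d balls of radius 2 d, whose total volume is of order L d^2. Summed over a cover of N
  this is a multiple of the sum in \<open>H2_delta\<close>, which can be made arbitrarily
  small.\<close>

lemma negligible_bounded_cylinder:
  fixes N :: "(real^3) set"
  assumes N: "H2 N = 0" and w: "norm w = 1" and L: "0 < L"
  shows "negligible {p + s *\<^sub>R w | p s. p \<in> N \<and> \<bar>s\<bar> \<le> L}"
  unfolding negligible_outer_le
proof (intro allI impI)
  let ?S = "{p + s *\<^sub>R w | p s. p \<in> N \<and> \<bar>s\<bar> \<le> L}"
  fix e :: real assume e: "0 < e"
  \<comment> \<open>The 2 n + 1 balls satisfy (2 n + 1) d <= 2 (L + d) + d <= 2 L + 6, since d <= 2;
    the factor 32/3 pi is the volume of a ball of radius 2 d divided by d^3.\<close>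
  let ?K = "(2 * L + 6) * (32 / 3 * pi)"
  have K: "0 < ?K" using L by simp
  define \<eta> where "\<eta> = min 1 (e / (?K * 3))"
  have \<eta>: "0 < \<eta>" "\<eta> \<le> 1" "?K * (3 * \<eta>) \<le> e"
  proof -
    have K3: "0 < ?K * 3" using K by simp
    show "0 < \<eta>" "\<eta> \<le> 1" using divide_pos_pos[OF e K3] by (auto simp: \<eta>_def)
    have "\<eta> \<le> e / (?K * 3)" by (simp add: \<eta>_def)
    then have "\<eta> * (?K * 3) \<le> e" using K3 by (simp only: pos_le_divide_eq)
    then show "?K * (3 * \<eta>) \<le> e" by (simp only: mult_ac)
  qed
  have "H2_delta 1 N \<le> 0" using H2_delta_le_H2[of 1 N] N by simp
  then have "H2_delta 1 N < ennreal \<eta>" using \<eta> by (simp add: le_less_trans)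
  then obtain C where C: "N \<subseteq> (\<Union>i. C i)" "\<And>i. bounded (C i)" "\<And>i. diameter (C i) \<le> 1"
      "(\<Sum>i. ennreal (pi / 4 * (diameter (C i))\<^sup>2)) < ennreal \<eta>"
    by (rule H2_delta_near_cover) (rule that)
  have dn: "0 \<le> diameter (C i)" for i using C(2) by (rule diameter_ge_0)
  \<comment> \<open>The summable extra term keeps \<open>d i\<close> positive even if
    \<open>C i\<close> is empty or a single point, at the total cost \<eta>.\<close>
  define d where "d i = sqrt ((diameter (C i))\<^sup>2 + \<eta> * (1 / 2) ^ Suc i)" for i
  have d2: "(d i)\<^sup>2 = (diameter (C i))\<^sup>2 + \<eta> * (1 / 2) ^ Suc i" for i
    using \<eta> by (simp add: d_def)
  have dpos: "0 < d i" for i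
    using \<eta> by (simp add: d_def add_nonneg_pos)
  have dge: "diameter (C i) \<le> d i" for i
    using \<eta> by (intro power2_le_imp_le[OF _ less_imp_le[OF dpos]]) (simp add: d2)
  have dle: "d i \<le> 2" for i
  proof (rule power2_le_imp_le)
    have "(diameter (C i))\<^sup>2 \<le> 1" using C(3) dn by (simp add: power_le_one)
    moreover have "\<eta> * (1 / 2) ^ Suc i \<le> 1 * 1" using \<eta> by (intro mult_mono power_le_one) auto
    ultimately show "(d i)\<^sup>2 \<le> 2\<^sup>2" by (simp add: d2)
  qed simp
  \<comment> \<open>For an empty \<open>C i\<close> the centre is arbitrary and merely adds a small
    tube to the cover.\<close>
  define p where "p i = (SOME x. x \<in> C i)" for i
  define n where "n i = \<lceil>L / d i\<rceil>" for i
  define T where "T i = (\<Union>j\<in>{- n i..n i}. cball (p i + (of_int j * d i) *\<^sub>R w) (2 * d i))" for i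
  have Tb: "T i \<in> sets borel" for i by (auto simp: T_def)
  have Tm: "emeasure lborel (T i) \<le> ennreal (?K * (d i)\<^sup>2)" for i
  proof -
    have "0 < L / d i" using L dpos[of i] by simp
    then have n0: "0 \<le> n i" unfolding n_def by linarith
    have "emeasure lborel (T i) \<le> (\<Sum>j\<in>{- n i..n i}. emeasure lborel (cball (p i + (of_int j * d i) *\<^sub>R w) (2 * d i)))"
      unfolding T_def by (rule emeasure_subadditive_finite) auto
    also have "\<dots> = (\<Sum>j\<in>{- n i..n i}. ennreal (4 / 3 * pi * (2 * d i) ^ 3))"
      using dpos[of i] by (intro sum.cong refl, subst emeasure_cball) (auto simp: unit_ball_vol_3)
    also have "\<dots> = ennreal ((2 * of_int (n i) + 1) * (4 / 3 * pi * (2 * d i) ^ 3))"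
      using n0 dpos[of i] by (subst sum_ennreal) (auto simp: algebra_simps)
    also have "\<dots> \<le> ennreal (?K * (d i)\<^sup>2)"
    proof (rule ennreal_leI)
      have "of_int (n i) \<le> L / d i + 1" unfolding n_def by linarith
      then have "of_int (n i) * d i \<le> (L / d i + 1) * d i" using dpos[of i] by (intro mult_right_mono) auto
      then have "of_int (n i) * d i \<le> L + d i" using dpos[of i] by (simp add: distrib_right)
      then have "(2 * of_int (n i) + 1) * d i \<le> 2 * L + 6" using dle[of i] by (simp add: distrib_right)
      then have "(2 * of_int (n i) + 1) * d i * (32 / 3 * pi * (d i)\<^sup>2) \<le> (2 * L + 6) * (32 / 3 * pi * (d i)\<^sup>2)"
        by (intro mult_right_mono) auto
      then show "(2 * of_int (n i) + 1) * (4 / 3 * pi * (2 * d i) ^ 3) \<le> ?K * (d i)\<^sup>2"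
        by (simp add: power2_eq_square power3_eq_cube mult_ac)
    qed
    finally show ?thesis .
  qed
  have "?S \<subseteq> (\<Union>i. T i)"
  proof
    fix y assume "y \<in> ?S"
    then obtain q s where q: "q \<in> N" "\<bar>s\<bar> \<le> L" and y: "y = q + s *\<^sub>R w" by blast
    obtain i where i: "q \<in> C i" using C(1) q(1) by blast
    then have pi: "p i \<in> C i" unfolding p_def by (rule someI)
    have qp: "dist q (p i) \<le> d i"
      using diameter_bounded_bound[OF C(2) i pi] dge[of i] by simp
    define j where "j = \<lfloor>s / d i\<rfloor>"
    have "of_int j \<le> s / d i" "s / d i < of_int j + 1" unfolding j_def by linarith+
    then have js: "of_int j * d i \<le> s" "s < of_int j * d i + d i"
      using dpos[of i] by (simp_all add: field_simps)
    have "- (L / d i) \<le> s / d i" "s / d i \<le> L / d i"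
      using q(2) dpos[of i] by (simp_all add: field_simps abs_le_iff)
    then have "j \<in> {- n i..n i}"
      unfolding j_def n_def by (auto simp: le_floor_iff) linarith+
    moreover have "y \<in> cball (p i + (of_int j * d i) *\<^sub>R w) (2 * d i)"
    proof -
      have "p i + (of_int j * d i) *\<^sub>R w - y = (p i - q) + (of_int j * d i - s) *\<^sub>R w"
        by (simp add: y algebra_simps)
      then have "dist (p i + (of_int j * d i) *\<^sub>R w) y \<le> norm (p i - q) + norm ((of_int j * d i - s) *\<^sub>R w)"
        unfolding dist_norm by (metis norm_triangle_ineq)
      also have "norm ((of_int j * d i - s) *\<^sub>R w) \<le> d i" using w js by simp
      also have "norm (p i - q) \<le> d i" using qp by (simp add: dist_norm norm_minus_commute)
      finally show ?thesis by simp
    qed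
    ultimately show "y \<in> (\<Union>i. T i)" unfolding T_def by blast
  qed
  moreover have em: "emeasure lborel (\<Union>i. T i) \<le> ennreal e"
  proof -
    \<comment> \<open>2 \<eta> comes from the cover, by 1 <= pi/2, and \<eta> from the extra terms
      in \<open>d i\<close>.\<close>
    have sd: "(\<Sum>i. ennreal ((d i)\<^sup>2)) \<le> ennreal (3 * \<eta>)"
    proof -
      have "(\<Sum>i. ennreal ((diameter (C i))\<^sup>2)) \<le> (\<Sum>i. ennreal 2 * ennreal (pi / 4 * (diameter (C i))\<^sup>2))"
      proof (intro suminf_le)
        fix i
        have "1 * (diameter (C i))\<^sup>2 \<le> 2 * (pi / 4) * (diameter (C i))\<^sup>2"
          using pi_ge_two by (intro mult_right_mono) auto
        then show "ennreal ((diameter (C i))\<^sup>2) \<le> ennreal 2 * ennreal (pi / 4 * (diameter (C i))\<^sup>2)"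
          by (subst ennreal_mult[symmetric]) (auto intro: ennreal_leI)
      qed auto
      also have "\<dots> = ennreal 2 * (\<Sum>i. ennreal (pi / 4 * (diameter (C i))\<^sup>2))" by (rule ennreal_suminf_cmult)
      also have "\<dots> \<le> ennreal 2 * ennreal \<eta>" using C(4) by (intro mult_left_mono) auto
      finally have sA: "(\<Sum>i. ennreal ((diameter (C i))\<^sup>2)) \<le> ennreal 2 * ennreal \<eta>" .
      have "(\<Sum>i. ennreal ((d i)\<^sup>2)) = (\<Sum>i. ennreal ((diameter (C i))\<^sup>2) + ennreal (\<eta> * (1 / 2) ^ Suc i))"
        using \<eta> by (intro suminf_cong) (simp add: d2)
      also have "\<dots> = (\<Sum>i. ennreal ((diameter (C i))\<^sup>2)) + (\<Sum>i. ennreal (\<eta> * (1 / 2) ^ Suc i))"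
        by (intro suminf_add[symmetric]) auto
      also have "(\<Sum>i. ennreal (\<eta> * (1 / 2) ^ Suc i)) = ennreal \<eta>"
      proof (rule suminf_ennreal_eq)
        show "(\<lambda>i. \<eta> * (1 / 2) ^ Suc i) sums \<eta>"
          using sums_mult[OF power_half_series, of \<eta>] by (simp only: mult_1_right)
      qed (use \<eta> in auto)
      also have "(\<Sum>i. ennreal ((diameter (C i))\<^sup>2)) + ennreal \<eta> \<le> ennreal 2 * ennreal \<eta> + ennreal \<eta>"
        by (rule add_right_mono[OF sA])
      also have "ennreal 2 * ennreal \<eta> + ennreal \<eta> = ennreal (3 * \<eta>)"
        using \<eta> by (subst ennreal_mult[symmetric]) (auto simp flip: ennreal_plus)
      finally show ?thesis .
    qed
    have "emeasure lborel (\<Union>i. T i) \<le> (\<Sum>i. emeasure lborel (T i))"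
      using Tb by (intro emeasure_subadditive_countably) auto
    also have "\<dots> \<le> (\<Sum>i. ennreal ?K * ennreal ((d i)\<^sup>2))"
      using Tm K by (intro suminf_le) (auto simp flip: ennreal_mult)
    also have "\<dots> = ennreal ?K * (\<Sum>i. ennreal ((d i)\<^sup>2))" by (rule ennreal_suminf_cmult)
    also have "\<dots> \<le> ennreal ?K * ennreal (3 * \<eta>)" by (intro mult_left_mono sd) simp
    also have "\<dots> = ennreal (?K * (3 * \<eta>))" using K \<eta> by (intro ennreal_mult[symmetric]) auto
    also have "\<dots> \<le> ennreal e" by (intro ennreal_leI \<eta>(3))
    finally show ?thesis .
  qed
  moreover have Ub: "(\<Union>i. T i) \<in> sets borel" using Tb by auto
  ultimately show "\<exists>T'. ?S \<subseteq> T' \<and> T' \<in> lmeasurable \<and> measure lebesgue T' \<le> e"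
  proof (intro exI[of _ "\<Union>i. T i"] conjI)
    show "(\<Union>i. T i) \<in> lmeasurable"
      using Ub em by (auto simp: fmeasurable_def le_less_trans)
    have "measure lebesgue (\<Union>i. T i) = measure lborel (\<Union>i. T i)"
      using Ub by (simp add: measure_completion)
    also have "\<dots> \<le> e" using em e by (simp add: measure_def enn2real_leI)
    finally show "measure lebesgue (\<Union>i. T i) \<le> e" .
  qed auto
qed

lemma finite_measure_surface_frontier:
  assumes "open \<Omega>" "convex \<Omega>" "bounded \<Omega>" "\<Omega> \<noteq> {}"
  shows "finite_measure (surface_measure (frontier \<Omega>))"
  using H2_frontier_convex_finite[OF assms]
  by (intro finite_measureI) (simp add: space_surface_measure emeasure_surface_measure)

lemma finite_measure_lebesgue_on_bounded:
  fixes \<Omega> :: "'a::euclidean_space set"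
  assumes "open \<Omega>" "bounded \<Omega>"
  shows "finite_measure (lebesgue_on \<Omega>)"
proof (rule finite_measureI)
  have "emeasure lborel \<Omega> < \<infinity>" using assms(2) by (rule emeasure_bounded_finite)
  then show "emeasure (lebesgue_on \<Omega>) (space (lebesgue_on \<Omega>)) \<noteq> \<infinity>"
    using assms(1) by (simp add: emeasure_restrict_space)
qed

lemma id_measurable_lebesgue_on: "(\<lambda>x. x) \<in> lebesgue_on \<Omega> \<rightarrow>\<^sub>M borel"
  by (rule measurable_restrict_space1) (rule measurable_completion, simp)

lemma phase_measure_fst_measurable: "fst \<in> phase_measure \<Omega> \<rightarrow>\<^sub>M borel"
  and phase_measure_snd_measurable: "snd \<in> phase_measure \<Omega> \<rightarrow>\<^sub>M borel"
  unfolding phase_measure_def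
  by (rule measurable_compose[OF measurable_fst id_measurable_lebesgue_on],
      rule measurable_compose[OF measurable_snd measurable_sphere_measureI], simp)

lemma space_phase_measure: "space (phase_measure \<Omega>) = \<Omega> \<times> sphere 0 1"
  by (simp add: phase_measure_def space_pair_measure space_sphere_measure space_restrict_space)

text \<open>By convexity the exit time exceeds t >= 0 exactly if the point at time t is still
  inside, so the superlevel sets are preimages of the open set \<Omega>.\<close>

lemma back_exit_measurable:
  assumes \<Omega>: "open \<Omega>" "convex \<Omega>" "bounded \<Omega>"
  shows "(\<lambda>z. back_exit \<Omega> (fst z) (snd z)) \<in> borel_measurable (phase_measure \<Omega>)"
proof (rule borel_measurable_iff_greater[THEN iffD2], intro allI)
  fix t :: real
  note [measurable] = phase_measure_fst_measurable phase_measure_snd_measurable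
  have [measurable]: "\<Omega> \<in> sets borel" using \<Omega> by simp
  show "{z \<in> space (phase_measure \<Omega>). t < back_exit \<Omega> (fst z) (snd z)} \<in> sets (phase_measure \<Omega>)"
  proof (cases "0 \<le> t")
    case True
    have "{z \<in> space (phase_measure \<Omega>). t < back_exit \<Omega> (fst z) (snd z)}
      = {z \<in> space (phase_measure \<Omega>). fst z - t *\<^sub>R snd z \<in> \<Omega>}"
      using less_back_exit_iff[OF \<Omega> _ _ True] by (auto simp: space_phase_measure)
    also have "\<dots> \<in> sets (phase_measure \<Omega>)" by measurable
    finally show ?thesis .
  next
    case False
    have "{z \<in> space (phase_measure \<Omega>). t < back_exit \<Omega> (fst z) (snd z)} = space (phase_measure \<Omega>)"
      using back_exit_pos[OF \<Omega>] False by (force simp: space_phase_measure)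
    then show ?thesis by simp
  qed
qed

text \<open>The mild formula evaluates boundary data at exit points, but they are controlled only
  almost everywhere. By Fubini the exceptional set has an \<open>H2\<close>-null slice for almost
  every w, and the characteristics through such a slice stay in a Lebesgue-null cylinder, of bounded
  length because \<Omega> is bounded.\<close>

lemma AE_boundary_trace:
  assumes \<Omega>: "open \<Omega>" "convex \<Omega>" "bounded \<Omega>" "\<Omega> \<noteq> {}" "C3_boundary \<Omega>"
    and P: "AE z in Gamma_minus_measure \<Omega>. P z"
  shows "AE z in phase_measure \<Omega>. P (fst z - back_exit \<Omega> (fst z) (snd z) *\<^sub>R snd z, snd z)"
proof -
  let ?S = "surface_measure (frontier \<Omega>)" and ?\<tau> = "\<lambda>z. back_exit \<Omega> (fst z) (snd z)"
  let ?\<phi> = "\<lambda>z. (fst z - ?\<tau> z *\<^sub>R snd z, snd z)"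
  interpret S: finite_measure ?S by (rule finite_measure_surface_frontier[OF \<Omega>(1-4)])
  interpret W: finite_measure sphere_measure by (rule finite_measure_sphere_measure)
  interpret L: finite_measure "lebesgue_on \<Omega>" by (rule finite_measure_lebesgue_on_bounded[OF \<Omega>(1,3)])
  interpret SW: pair_sigma_finite ?S sphere_measure ..
  interpret LW: pair_sigma_finite "lebesgue_on \<Omega>" sphere_measure ..
  obtain R where R: "0 < R" "\<And>y. y \<in> \<Omega> \<Longrightarrow> norm y \<le> R" using \<Omega>(3) unfolding bounded_pos by blast
  note [measurable] = phase_measure_fst_measurable phase_measure_snd_measurable back_exit_measurable[OF \<Omega>(1-3)]
  have "AE z in bdry_phase_measure \<Omega>. z \<in> Gamma_minus \<Omega> \<longrightarrow> P z"
    using P Gamma_minus_sets[OF \<Omega>(1,2,5)] unfolding Gamma_minus_measure_def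
    by (subst (asm) AE_density) (auto simp: indicator_def elim!: eventually_mono split: if_splits)
  then obtain N where N: "N \<in> null_sets (?S \<Otimes>\<^sub>M sphere_measure)"
    "\<And>z. z \<in> frontier \<Omega> \<times> sphere 0 1 \<Longrightarrow> z \<notin> N \<Longrightarrow> z \<in> Gamma_minus \<Omega> \<Longrightarrow> P z"
    by (auto simp: bdry_phase_measure_def eventually_ae_filter space_pair_measure space_surface_measure space_sphere_measure)
  have Ns: "N \<in> sets (?S \<Otimes>\<^sub>M sphere_measure)" using N(1) by auto
  have \<phi>: "?\<phi> \<in> phase_measure \<Omega> \<rightarrow>\<^sub>M ?S \<Otimes>\<^sub>M sphere_measure"
  proof (rule measurable_Pair)
    have "(\<lambda>z. fst z - ?\<tau> z *\<^sub>R snd z) \<in> phase_measure \<Omega> \<rightarrow>\<^sub>M restrict_space borel (frontier \<Omega>)"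
    proof (rule measurable_restrict_space2)
      show "(\<lambda>z. fst z - ?\<tau> z *\<^sub>R snd z) \<in> space (phase_measure \<Omega>) \<rightarrow> frontier \<Omega>"
        using back_exit_frontier[OF \<Omega>(1-3)] by (auto simp: space_phase_measure)
    qed measurable
    then show "(\<lambda>z. fst z - ?\<tau> z *\<^sub>R snd z) \<in> phase_measure \<Omega> \<rightarrow>\<^sub>M ?S"
      by (subst measurable_cong_sets[OF refl sets_surface_measure]) auto
    show "snd \<in> phase_measure \<Omega> \<rightarrow>\<^sub>M sphere_measure" unfolding phase_measure_def by simp
  qed
  define E where "E = ?\<phi> -` N \<inter> space (phase_measure \<Omega>)"
  have E: "E \<in> sets (lebesgue_on \<Omega> \<Otimes>\<^sub>M sphere_measure)"
    using measurable_sets[OF \<phi> Ns] by (simp add: E_def phase_measure_def)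
  have "(\<integral>\<^sup>+w. emeasure ?S ((\<lambda>x. (x, w)) -` N) \<partial>sphere_measure) = 0"
    using SW.emeasure_pair_measure_alt2[OF Ns] null_setsD1[OF N(1)] by (simp only:)
  then have "AE w in sphere_measure. emeasure ?S ((\<lambda>x. (x, w)) -` N) = 0"
    by (subst (asm) nn_integral_0_iff_AE) (auto intro!: SW.measurable_emeasure_Pair2 Ns)
  then have "AE w in sphere_measure. emeasure (lebesgue_on \<Omega>) ((\<lambda>x. (x, w)) -` E) = 0"
  proof (rule AE_mp, intro AE_I2 impI)
    fix w assume w: "w \<in> space sphere_measure" and z: "emeasure ?S ((\<lambda>x. (x, w)) -` N) = 0"
    let ?N = "(\<lambda>x. (x, w)) -` N"
    have w1: "norm w = 1" using w by (simp add: space_sphere_measure)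
    have "?N \<in> sets ?S" by (rule sets_Pair2[OF Ns])
    then have "?N \<in> sets borel" "?N \<subseteq> frontier \<Omega>"
      by (auto simp: sets_surface_measure sets_restrict_space_iff)
    then have "H2 ?N = 0" using z by (simp add: emeasure_surface_measure)
    then have neg: "negligible {p + s *\<^sub>R w | p s. p \<in> ?N \<and> \<bar>s\<bar> \<le> 2 * R}"
      using w1 R(1) by (intro negligible_bounded_cylinder) auto
    have "(\<lambda>x. (x, w)) -` E \<subseteq> {p + s *\<^sub>R w | p s. p \<in> ?N \<and> \<bar>s\<bar> \<le> 2 * R}"
    proof
      fix x assume "x \<in> (\<lambda>x. (x, w)) -` E"
      then have x: "x \<in> \<Omega>" and xN: "x - back_exit \<Omega> x w *\<^sub>R w \<in> ?N"
        by (auto simp: E_def space_phase_measure w1)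
      let ?t = "back_exit \<Omega> x w"
      have "?t \<le> 2 * R"
      proof (rule ccontr)
        assume "\<not> ?t \<le> 2 * R"
        then have "2 * R < ?t" by simp
        define t where "t = (2 * R + ?t) / 2"
        have t: "0 \<le> t" "t < ?t" "2 * R < t" using \<open>2 * R < ?t\<close> R(1) by (auto simp: t_def)
        then have "x - t *\<^sub>R w \<in> \<Omega>" using less_back_exit_iff[OF \<Omega>(1-3) x w1, of t] by simp
        then have "norm (x - t *\<^sub>R w) \<le> R" by (rule R)
        moreover have "norm (t *\<^sub>R w) \<le> norm (x - t *\<^sub>R w) + norm x"
          by (metis norm_minus_commute norm_triangle_sub add.commute)
        ultimately show False using R(2)[OF x] w1 t by simp
      qed
      moreover have "0 < ?t" by (rule back_exit_pos[OF \<Omega>(1-3) x w1])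
      ultimately show "x \<in> {p + s *\<^sub>R w | p s. p \<in> ?N \<and> \<bar>s\<bar> \<le> 2 * R}"
        using xN by (intro CollectI exI[of _ "x - ?t *\<^sub>R w"] exI[of _ ?t]) simp
    qed
    then have "negligible ((\<lambda>x. (x, w)) -` E)" by (rule negligible_subset[OF neg])
    then have "(\<lambda>x. (x, w)) -` E \<in> null_sets lebesgue" by (simp add: negligible_iff_null_sets)
    moreover have "(\<lambda>x. (x, w)) -` E \<subseteq> \<Omega>" by (auto simp: E_def space_phase_measure)
    ultimately show "emeasure (lebesgue_on \<Omega>) ((\<lambda>x. (x, w)) -` E) = 0"
      using \<Omega>(1) by (simp add: emeasure_restrict_space null_setsD1)
  qed
  then have "emeasure (phase_measure \<Omega>) E = 0"
    unfolding phase_measure_def LW.emeasure_pair_measure_alt2[OF E]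
    by (subst nn_integral_0_iff_AE) (auto intro!: LW.measurable_emeasure_Pair2 E)
  then have "E \<in> null_sets (phase_measure \<Omega>)" using E by (auto simp: phase_measure_def)
  then show ?thesis
  proof (rule AE_I')
    show "{z \<in> space (phase_measure \<Omega>). \<not> P (?\<phi> z)} \<subseteq> E"
    proof
      fix z assume z: "z \<in> {z \<in> space (phase_measure \<Omega>). \<not> P (?\<phi> z)}"
      then obtain x w where zxw: "z = (x, w)" "x \<in> \<Omega>" "norm w = 1" by (cases z) (auto simp: space_phase_measure)
      let ?t = "back_exit \<Omega> x w"
      have f: "x - ?t *\<^sub>R w \<in> frontier \<Omega>" using zxw by (intro back_exit_frontier[OF \<Omega>(1-3)])
      \<comment> \<open>The strict support inequality, tested at x itself, gives w . \<nu> < 0 at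
        the exit point: a characteristic through an interior point never starts
        tangentially.\<close>
      have "outward_normal \<Omega> (x - ?t *\<^sub>R w) \<bullet> (x - (x - ?t *\<^sub>R w)) < 0"
        by (rule outward_normal_support[OF \<Omega>(1,2,5) f zxw(2)])
      then have "?t * (w \<bullet> outward_normal \<Omega> (x - ?t *\<^sub>R w)) < 0" by (simp add: inner_commute)
      then have "w \<bullet> outward_normal \<Omega> (x - ?t *\<^sub>R w) < 0"
        using back_exit_pos[OF \<Omega>(1-3) zxw(2,3)] by (simp add: mult_less_0_iff)
      then have "?\<phi> z \<in> Gamma_minus \<Omega>" using f zxw by (simp add: Gamma_minus_def)
      moreover have "?\<phi> z \<in> frontier \<Omega> \<times> sphere 0 1" using f zxw by simp
      ultimately have "?\<phi> z \<in> N" using N(2) z by blast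
      then show "z \<in> E" using z by (simp add: E_def)
    qed
  qed
qed

section \<open>Estimates along characteristics and the barrier\<close>

text \<open>\<open>phase_measure\<close> uses the completed Lebesgue measure in x, while composition
  with x - s w calls for Borel sets. Induction over the generated sigma-algebra shows that
  discarding one null set of positions, common to all directions, is enough.\<close>

lemma pair_lebesgue_on_set_mod_null:
  fixes \<Omega> :: "'a::euclidean_space set"
  assumes \<Omega>: "\<Omega> \<in> sets borel" and E: "E \<in> sets (lebesgue_on \<Omega> \<Otimes>\<^sub>M M)"
  shows "\<exists>N\<in>null_sets lborel. E \<inter> (- N) \<times> UNIV \<in> sets (borel \<Otimes>\<^sub>M M)"
  using E unfolding sets_pair_measure[of "lebesgue_on \<Omega>"]
proof induction
  case (Basic a)
  then obtain A B where a: "a = A \<times> B" "A \<in> sets (lebesgue_on \<Omega>)" and B [measurable]: "B \<in> sets M" by blast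
  then have "A \<in> sets lebesgue" using \<Omega> by (auto simp: sets_restrict_space_iff)
  then obtain S N N' where A: "A = S \<union> N" "N \<subseteq> N'" and N': "N' \<in> null_sets lborel" and S: "S \<in> sets lborel"
    by (rule sets_completionE)
  have [measurable]: "S \<in> sets borel" "N' \<in> sets borel" using S N' by auto
  have "a \<inter> (- N') \<times> UNIV = (S - N') \<times> B" using A by (auto simp: a)
  also have "\<dots> \<in> sets (borel \<Otimes>\<^sub>M M)" by simp
  finally show ?case using N' by blast
next
  case Empty
  then show ?case by (intro bexI[of _ "{}"]) auto
next
  case (Compl a)
  then obtain N where N: "N \<in> null_sets lborel" and [measurable]: "a \<inter> (- N) \<times> UNIV \<in> sets (borel \<Otimes>\<^sub>M M)" by blast
  have [measurable]: "N \<in> sets borel" "\<Omega> \<in> sets borel" using N \<Omega> by auto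
  have "(space (lebesgue_on \<Omega>) \<times> space M - a) \<inter> (- N) \<times> UNIV = (\<Omega> - N) \<times> space M - a \<inter> (- N) \<times> UNIV"
    by (auto simp: space_restrict_space)
  also have "\<dots> \<in> sets (borel \<Otimes>\<^sub>M M)" by measurable
  finally show ?case using N by blast
next
  case (Union a)
  then have "\<forall>i. \<exists>N. N \<in> null_sets lborel \<and> a i \<inter> (- N) \<times> UNIV \<in> sets (borel \<Otimes>\<^sub>M M)" by blast
  from choice[OF this] obtain N where N: "\<And>i::nat. N i \<in> null_sets lborel"
    and [measurable]: "\<And>i. a i \<inter> (- N i) \<times> UNIV \<in> sets (borel \<Otimes>\<^sub>M M)" by blast
  have [measurable]: "N i \<in> sets borel" for i using N[of i] by auto
  have "(\<Union>i. a i) \<inter> (- (\<Union>i. N i)) \<times> UNIV = (\<Union>i. a i \<inter> (- N i) \<times> UNIV) - (\<Union>i. N i) \<times> space M"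
  proof -
    have "a i \<inter> (- N i) \<times> UNIV \<subseteq> UNIV \<times> space M" for i
      using sets.sets_into_space[of "a i \<inter> (- N i) \<times> UNIV" "borel \<Otimes>\<^sub>M M"]
      by (simp add: space_pair_measure)
    then have "snd z \<in> space M" if "z \<in> a i" "fst z \<notin> N i" for z i
      using that by (cases z) auto
    then show ?thesis by fastforce
  qed
  also have "\<dots> \<in> sets (borel \<Otimes>\<^sub>M M)" by measurable
  finally show ?case using null_sets_UN[of N lborel] N by blast
qed

text \<open>Superlevel sets at rational heights determine f, so the exceptional null sets are
  countably many and can be united.\<close>

lemma pair_lebesgue_on_fun_mod_null:
  fixes f :: "'a::euclidean_space \<times> 'b \<Rightarrow> real"
  assumes \<Omega>: "\<Omega> \<in> sets borel" and f: "f \<in> borel_measurable (lebesgue_on \<Omega> \<Otimes>\<^sub>M M)"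
  shows "\<exists>N\<in>null_sets lborel. (\<lambda>z. if fst z \<in> \<Omega> - N then f z else 0) \<in> borel_measurable (borel \<Otimes>\<^sub>M M)"
proof -
  let ?P = "lebesgue_on \<Omega> \<Otimes>\<^sub>M M"
  let ?E = "\<lambda>q. {z \<in> space ?P. q < f z}"
  have "?E q \<in> sets ?P" for q using f by measurable
  then have "\<forall>q. \<exists>N. N \<in> null_sets lborel \<and> ?E q \<inter> (- N) \<times> UNIV \<in> sets (borel \<Otimes>\<^sub>M M)"
    using pair_lebesgue_on_set_mod_null[OF \<Omega>] by blast
  from choice[OF this] obtain Q where Q: "\<And>q. Q q \<in> null_sets lborel"
    and [measurable]: "\<And>q. ?E q \<inter> (- Q q) \<times> UNIV \<in> sets (borel \<Otimes>\<^sub>M M)" by blast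
  define N where "N = (\<Union>q\<in>\<rat>. Q q)"
  have N: "N \<in> null_sets lborel"
    unfolding N_def using Q by (intro null_sets_UN' countable_rat)
  then have [measurable]: "N \<in> sets borel" "\<Omega> \<in> sets borel" using \<Omega> by auto
  let ?g = "\<lambda>z. if fst z \<in> \<Omega> - N then f z else 0"
  have E: "?E q \<inter> (- N) \<times> UNIV \<in> sets (borel \<Otimes>\<^sub>M M)" if "q \<in> \<rat>" for q
  proof -
    have "?E q \<inter> (- N) \<times> UNIV = (?E q \<inter> (- Q q) \<times> UNIV) - N \<times> space M"
      using that by (auto simp: N_def space_pair_measure)
    also have "\<dots> \<in> sets (borel \<Otimes>\<^sub>M M)" by measurable
    finally show ?thesis .
  qed
  have "?g \<in> borel_measurable (borel \<Otimes>\<^sub>M M)"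
  proof (rule borel_measurable_iff_greater[THEN iffD2], intro allI)
    fix a :: real
    have 1: "(\<Union>q\<in>{q\<in>\<rat>. a < q}. ?E q \<inter> (- N) \<times> UNIV) \<in> sets (borel \<Otimes>\<^sub>M M)"
      using E by (intro sets.countable_UN' countable_subset[OF _ countable_rat]) auto
    have "{z \<in> space (borel \<Otimes>\<^sub>M M). a < ?g z}
      = (\<Union>q\<in>{q\<in>\<rat>. a < q}. ?E q \<inter> (- N) \<times> UNIV) \<union> (if a < 0 then (- (\<Omega> - N)) \<times> space M else {})"
    proof (intro set_eqI)
      fix z :: "'a \<times> 'b"
      have "(\<exists>q\<in>\<rat>. a < q \<and> q < f z) \<longleftrightarrow> a < f z" using Rats_dense_in_real[of a "f z"] by auto
      then show "z \<in> {z \<in> space (borel \<Otimes>\<^sub>M M). a < ?g z} \<longleftrightarrow>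
        z \<in> (\<Union>q\<in>{q\<in>\<rat>. a < q}. ?E q \<inter> (- N) \<times> UNIV) \<union> (if a < 0 then (- (\<Omega> - N)) \<times> space M else {})"
        by (cases z) (auto simp: space_pair_measure space_restrict_space)
    qed
    also have "\<dots> \<in> sets (borel \<Otimes>\<^sub>M M)" by (intro sets.Un 1) auto
    finally show "{z \<in> space (borel \<Otimes>\<^sub>M M). a < ?g z} \<in> sets (borel \<Otimes>\<^sub>M M)" .
  qed
  then show ?thesis using N by blast
qed

text \<open>The exit value has weight exp(-\<tau>/\<epsilon>) and the path weight 1 -
  exp(-\<tau>/\<epsilon>). They add up to 1, so G comes out with constant 1 and only h is
  integrated.\<close>

lemma exp_line_estimate:
  assumes e: "0 < \<epsilon>" and \<tau>: "0 \<le> \<tau>" and G: "0 \<le> G" "\<bar>g0\<bar> \<le> G"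
    and h [measurable]: "h \<in> borel_measurable borel" and h0: "\<And>s. 0 \<le> h s"
    and F: "F integrable_on {0..\<tau>}" and N: "negligible N"
    and bd: "\<And>s. s \<in> {0..\<tau>} - N \<Longrightarrow> \<bar>F s\<bar> \<le> exp (- s / \<epsilon>) * (G + h s)"
  shows "ennreal \<bar>exp (- \<tau> / \<epsilon>) * g0 + (1 / \<epsilon>) * integral {0..\<tau>} F\<bar>
    \<le> ennreal G + (\<integral>\<^sup>+s. ennreal (h s) \<partial>exp_law \<epsilon>)"
proof (cases "(\<integral>\<^sup>+s. ennreal (h s) \<partial>exp_law \<epsilon>) = \<infinity>")
  case False
  then obtain H where H: "(\<integral>\<^sup>+s. ennreal (h s) \<partial>exp_law \<epsilon>) = ennreal H" "0 \<le> H"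
    by (cases "\<integral>\<^sup>+s. ennreal (h s) \<partial>exp_law \<epsilon>") auto
  define D where "D s = (1 / \<epsilon>) * exp (- s / \<epsilon>) * (G + h s) * indicator {0..\<tau>} s" for s
  have D0: "0 \<le> D s" for s using e G h0 by (simp add: D_def)
  have Dm [measurable]: "D \<in> borel_measurable borel" unfolding D_def[abs_def] by measurable
  have G_int: "(\<integral>\<^sup>+s. ennreal ((1 / \<epsilon>) * exp (- s / \<epsilon>) * G) * indicator {0..\<tau>} s \<partial>lborel)
      = ennreal (- exp (- \<tau> / \<epsilon>) * G - (- exp (- 0 / \<epsilon>) * G))"
    using e G \<tau> by (intro nn_integral_FTC_Icc[where F = "\<lambda>s. - exp (- s / \<epsilon>) * G"])
      (auto intro!: derivative_eq_intros)
  have "(\<integral>\<^sup>+s. ennreal (D s) \<partial>lborel)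
      = (\<integral>\<^sup>+s. ennreal ((1 / \<epsilon>) * exp (- s / \<epsilon>) * G) * indicator {0..\<tau>} s
         + ennreal ((1 / \<epsilon>) * exp (- s / \<epsilon>) * h s) * indicator {0..\<tau>} s \<partial>lborel)"
    using e G h0 by (intro nn_integral_cong)
      (auto simp: D_def indicator_def distrib_left simp flip: ennreal_plus)
  also have "\<dots> = (\<integral>\<^sup>+s. ennreal ((1 / \<epsilon>) * exp (- s / \<epsilon>) * G) * indicator {0..\<tau>} s \<partial>lborel)
      + (\<integral>\<^sup>+s. ennreal ((1 / \<epsilon>) * exp (- s / \<epsilon>) * h s) * indicator {0..\<tau>} s \<partial>lborel)"
    by (rule nn_integral_add) measurable
  also have "\<dots> \<le> ennreal ((1 - exp (- \<tau> / \<epsilon>)) * G) + ennreal H"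
  proof (rule add_mono)
    show "(\<integral>\<^sup>+s. ennreal ((1 / \<epsilon>) * exp (- s / \<epsilon>) * G) * indicator {0..\<tau>} s \<partial>lborel)
      \<le> ennreal ((1 - exp (- \<tau> / \<epsilon>)) * G)"
      unfolding G_int by (simp add: algebra_simps)
    have "(\<integral>\<^sup>+s. ennreal ((1 / \<epsilon>) * exp (- s / \<epsilon>) * h s) * indicator {0..\<tau>} s \<partial>lborel)
        \<le> (\<integral>\<^sup>+s. ennreal (exponential_density (1 / \<epsilon>) s) * ennreal (h s) \<partial>lborel)"
      using e h0 by (intro nn_integral_mono)
        (auto simp: indicator_def exponential_density_def simp flip: ennreal_mult)
    also have "\<dots> = ennreal H" unfolding H(1)[symmetric] by (rule nn_integral_exp_law[symmetric]) measurable
    finally show "(\<integral>\<^sup>+s. ennreal ((1 / \<epsilon>) * exp (- s / \<epsilon>) * h s) * indicator {0..\<tau>} s \<partial>lborel) \<le> ennreal H" .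
  qed
  also have "\<dots> = ennreal ((1 - exp (- \<tau> / \<epsilon>)) * G + H)"
    using e \<tau> G H(2) by (intro ennreal_plus[symmetric]) auto
  finally have Dle: "(\<integral>\<^sup>+s. ennreal (D s) \<partial>lborel) \<le> ennreal ((1 - exp (- \<tau> / \<epsilon>)) * G + H)" .
  then have Dint: "integrable lborel D"
    using D0 by (intro integrableI_nonneg) (auto simp: le_less_trans)
  have rhs0: "0 \<le> (1 - exp (- \<tau> / \<epsilon>)) * G + H" using e \<tau> G H(2) by simp
  have "integral\<^sup>L lborel D \<le> (1 - exp (- \<tau> / \<epsilon>)) * G + H"
    using Dle nn_integral_eq_integral[OF Dint] D0 rhs0 by (simp add: ennreal_le_iff)
  moreover have hasD: "(D has_integral integral\<^sup>L lborel D) UNIV" by (rule has_integral_integral_lborel[OF Dint])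
  then have hasD': "(D has_integral integral\<^sup>L lborel D) {0..\<tau>}"
  proof -
    have "(\<lambda>s. if s \<in> {0..\<tau>} then D s else 0) = D" by (auto simp: D_def)
    then show ?thesis using hasD has_integral_restrict_UNIV[of "{0..\<tau>}" D] by simp
  qed
  \<comment> \<open>F is gauge integrable and bounded only off N. Setting it to 0 on N does not
    change the integral and gives a pointwise bound by the Lebesgue integrable D.\<close>
  let ?F = "\<lambda>s. (1 / \<epsilon>) * (if s \<in> N then 0 else F s)"
  have hasF: "(?F has_integral (1 / \<epsilon>) * integral {0..\<tau>} F) {0..\<tau>}"
    by (intro has_integral_mult_right, rule has_integral_spike[OF N _ integrable_integral[OF F]]) auto
  have "norm ((1 / \<epsilon>) * integral {0..\<tau>} F) \<le> integral\<^sup>L lborel D"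
  proof -
    have "norm (integral {0..\<tau>} ?F) \<le> integral {0..\<tau>} D"
    proof (rule integral_norm_bound_integral)
      show "?F integrable_on {0..\<tau>}" "D integrable_on {0..\<tau>}" using hasF hasD' by blast+
      fix s assume s: "s \<in> {0..\<tau>}"
      show "norm (?F s) \<le> D s"
      proof (cases "s \<in> N")
        case True then show ?thesis using D0 by simp
      next
        case False
        have "\<bar>F s\<bar> / \<epsilon> \<le> exp (- s / \<epsilon>) * (G + h s) / \<epsilon>"
          using bd[of s] s False e by (intro divide_right_mono) auto
        then show ?thesis using s False e by (simp add: D_def abs_mult)
      qed
    qed
    then show ?thesis unfolding integral_unique[OF hasF] integral_unique[OF hasD'] .
  qed
  moreover have "\<bar>exp (- \<tau> / \<epsilon>) * g0\<bar> \<le> exp (- \<tau> / \<epsilon>) * G"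
    using G(2) by (simp add: abs_mult)
  ultimately have "\<bar>exp (- \<tau> / \<epsilon>) * g0 + (1 / \<epsilon>) * integral {0..\<tau>} F\<bar>
    \<le> exp (- \<tau> / \<epsilon>) * G + ((1 - exp (- \<tau> / \<epsilon>)) * G + H)"
    unfolding real_norm_def by linarith
  also have "\<dots> = G + H" by (simp add: algebra_simps)
  finally show ?thesis using G(1) H by (simp add: ennreal_leI flip: ennreal_plus)
qed simp

text \<open>Expanded, this is 1 + 1/(4 b) - |x|^2 + b |x|^4. The term -|x|^2 supplies the drop of
  order \<epsilon>^2 under averaging with \<open>kern\<close>; the quartic term completes a square,
  so the function is at least 1 on all of R^3, over which \<open>kern\<close> spreads.\<close>

definition barrier :: "real \<Rightarrow> real^3 \<Rightarrow> real" where
  "barrier b x = 1 + b * ((norm x)\<^sup>2 - 1 / (2 * b))\<^sup>2"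

lemma barrier_measurable [measurable]: "barrier b \<in> borel_measurable borel"
  unfolding barrier_def[abs_def] by measurable

lemma barrier_ge_1: "0 < b \<Longrightarrow> 1 \<le> barrier b x"
  by (simp add: barrier_def)

lemma barrier_eq: "0 < b \<Longrightarrow> barrier b x = 1 + 1 / (4 * b) - (norm x)\<^sup>2 + b * ((norm x)\<^sup>2)\<^sup>2"
  by (simp add: barrier_def power2_diff power_divide power2_eq_square field_simps)

text \<open>Pairing z with -z removes the odd terms. The cross term 8 (x . z)^2 is at most 8 |x|^2
  |z|^2 by Cauchy-Schwarz, which together with 4 |x|^2 |z|^2 gives the 12.\<close>

lemma barrier_symmetric_difference:
  assumes b: "0 < b"
  shows "barrier b (x + z) + barrier b (x - z) + 2 * (norm z)\<^sup>2
    \<le> 2 * barrier b x + 12 * b * (norm x)\<^sup>2 * (norm z)\<^sup>2 + 2 * b * (norm z) ^ 4"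
proof -
  define a q c where "a = (norm x)\<^sup>2" and "q = (norm z)\<^sup>2" and "c = x \<bullet> z"
  have p: "(norm (x + z))\<^sup>2 = a + q + 2 * c" "(norm (x - z))\<^sup>2 = a + q - 2 * c"
    unfolding a_def q_def c_def power2_norm_eq_inner
    by (simp_all add: inner_add_left inner_add_right inner_diff_left inner_diff_right inner_commute)
  have cc: "c\<^sup>2 \<le> a * q" unfolding a_def q_def c_def power2_norm_eq_inner by (rule Cauchy_Schwarz_ineq)
  have "(a + q + 2 * c)\<^sup>2 + (a + q - 2 * c)\<^sup>2 = 2 * a\<^sup>2 + 4 * (a * q) + 2 * q\<^sup>2 + 8 * c\<^sup>2"
    by (simp add: power2_eq_square algebra_simps)
  also have "\<dots> \<le> 2 * a\<^sup>2 + 12 * (a * q) + 2 * q\<^sup>2" using cc by simp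
  finally have "b * ((a + q + 2 * c)\<^sup>2 + (a + q - 2 * c)\<^sup>2) \<le> b * (2 * a\<^sup>2 + 12 * (a * q) + 2 * q\<^sup>2)"
    using b by (intro mult_left_mono) auto
  moreover have "norm z ^ 4 = q\<^sup>2" by (simp add: q_def flip: power_mult)
  ultimately show ?thesis
    unfolding barrier_eq[OF b] p a_def[symmetric] q_def[symmetric] by (simp add: algebra_simps)
qed

lemma nn_integral_kern_translate:
  assumes [measurable]: "H \<in> borel_measurable borel"
  shows "(\<integral>\<^sup>+y. ennreal (kern \<epsilon> (x - y)) * H y \<partial>lborel) = (\<integral>\<^sup>+z. ennreal (kern \<epsilon> z) * H (x + z) \<partial>lborel)"
proof -
  have "(lborel :: (real^3) measure) = distr lborel borel ((+) x)" by (rule lborel_distr_plus[symmetric])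
  then have "(\<integral>\<^sup>+y. ennreal (kern \<epsilon> (x - y)) * H y \<partial>lborel)
      = (\<integral>\<^sup>+y. ennreal (kern \<epsilon> (x - y)) * H y \<partial>distr lborel borel ((+) x))"
    by (rule arg_cong)
  also have "\<dots> = (\<integral>\<^sup>+z. ennreal (kern \<epsilon> (x - (x + z))) * H (x + z) \<partial>lborel)"
    by (rule nn_integral_distr) measurable
  finally show ?thesis by (simp add: kern_minus)
qed

lemma nn_integral_kern_reflect:
  assumes [measurable]: "H \<in> borel_measurable borel"
  shows "(\<integral>\<^sup>+z. ennreal (kern \<epsilon> z) * H z \<partial>lborel) = (\<integral>\<^sup>+z. ennreal (kern \<epsilon> z) * H (- z) \<partial>lborel)"
proof -
  have "(lborel :: (real^3) measure) = distr lborel borel uminus"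
    using lborel_affine[of "-1" "0 :: real^3"] by (simp add: density_1)
  then have "(\<integral>\<^sup>+z. ennreal (kern \<epsilon> z) * H z \<partial>lborel) = (\<integral>\<^sup>+z. ennreal (kern \<epsilon> z) * H z \<partial>distr lborel borel uminus)"
    by (rule arg_cong)
  also have "\<dots> = (\<integral>\<^sup>+z. ennreal (kern \<epsilon> (- z)) * H (- z) \<partial>lborel)"
    by (rule nn_integral_distr) measurable
  finally show ?thesis by (simp add: kern_minus)
qed

lemma nn_integral_kern_cmult_power:
  assumes e: "0 < \<epsilon>" and c: "0 \<le> c"
  shows "(\<integral>\<^sup>+z. ennreal (kern \<epsilon> z) * ennreal (c * norm z ^ i) \<partial>lborel) = ennreal (c * (fact i * \<epsilon> ^ i))"
proof -
  have "(\<integral>\<^sup>+z. ennreal (kern \<epsilon> z) * ennreal (c * norm z ^ i) \<partial>lborel)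
      = (\<integral>\<^sup>+z. ennreal c * ennreal (kern \<epsilon> z * norm z ^ i) \<partial>lborel)"
    using e c by (intro nn_integral_cong) (simp add: kern_nonneg mult_ac flip: ennreal_mult)
  also have "\<dots> = ennreal c * ennreal (fact i * \<epsilon> ^ i)"
    by (subst nn_integral_cmult) (auto simp: nn_integral_kern_power[OF e])
  finally show ?thesis using e c by (simp add: ennreal_mult)
qed

text \<open>\<open>kern\<close> is even, with moments 2 \<epsilon>^2 and 24 \<epsilon>^4 of orders 2
  and 4. In the symmetrised integral, twice the one sought, the quadratic part gains 4 \<epsilon>^2,
  and b is chosen so that the quartic errors 24 b |x|^2 \<epsilon>^2 + 48 b \<epsilon>^4 consume at
  most 2 \<epsilon>^2 of it.\<close>

lemma kern_barrier:
  assumes e: "0 < \<epsilon>" "\<epsilon> \<le> 1" and R: "norm x \<le> R" and b: "b = 1 / (12 * R\<^sup>2 + 24)"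
  shows "(\<integral>\<^sup>+y. ennreal (kern \<epsilon> (x - y)) * ennreal (barrier b y) \<partial>lborel) \<le> ennreal (barrier b x - \<epsilon>\<^sup>2)"
proof -
  have b0: "0 < b" unfolding b by (simp add: add_nonneg_pos)
  let ?I = "\<integral>\<^sup>+z. ennreal (kern \<epsilon> z) * ennreal (barrier b (x + z)) \<partial>lborel"
  let ?J = "\<integral>\<^sup>+z. ennreal (kern \<epsilon> z) * ennreal (barrier b (x - z)) \<partial>lborel"
  have IJ: "?I = ?J"
    using nn_integral_kern_reflect[of "\<lambda>z. ennreal (barrier b (x + z))"] by simp
  have bn: "0 \<le> barrier b y" for y using barrier_ge_1[OF b0, of y] by simp
  have "?I + ?J + ennreal (2 * (fact 2 * \<epsilon>\<^sup>2))
      = (\<integral>\<^sup>+z. ennreal (kern \<epsilon> z) * ennreal (barrier b (x + z)) + ennreal (kern \<epsilon> z) * ennreal (barrier b (x - z))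
          + ennreal (kern \<epsilon> z) * ennreal (2 * norm z ^ 2) \<partial>lborel)"
    using nn_integral_kern_cmult_power[OF e(1), of 2 2] by (simp add: nn_integral_add)
  also have "\<dots> \<le> (\<integral>\<^sup>+z. ennreal (kern \<epsilon> z) * ennreal (2 * barrier b x * norm z ^ 0)
      + ennreal (kern \<epsilon> z) * ennreal (12 * b * (norm x)\<^sup>2 * norm z ^ 2)
      + ennreal (kern \<epsilon> z) * ennreal (2 * b * norm z ^ 4) \<partial>lborel)"
  proof (rule nn_integral_mono)
    fix z :: "real^3"
    have "ennreal (barrier b (x + z)) + ennreal (barrier b (x - z)) + ennreal (2 * norm z ^ 2)
      = ennreal (barrier b (x + z) + barrier b (x - z) + 2 * (norm z)\<^sup>2)"
      using bn by (simp flip: ennreal_plus)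
    also have "\<dots> \<le> ennreal (2 * barrier b x + 12 * b * (norm x)\<^sup>2 * (norm z)\<^sup>2 + 2 * b * (norm z) ^ 4)"
      by (intro ennreal_leI barrier_symmetric_difference b0)
    also have "\<dots> = ennreal (2 * barrier b x * norm z ^ 0) + ennreal (12 * b * (norm x)\<^sup>2 * norm z ^ 2) + ennreal (2 * b * norm z ^ 4)"
      using bn b0 by (simp flip: ennreal_plus)
    finally show "ennreal (kern \<epsilon> z) * ennreal (barrier b (x + z)) + ennreal (kern \<epsilon> z) * ennreal (barrier b (x - z))
          + ennreal (kern \<epsilon> z) * ennreal (2 * norm z ^ 2)
      \<le> ennreal (kern \<epsilon> z) * ennreal (2 * barrier b x * norm z ^ 0)
      + ennreal (kern \<epsilon> z) * ennreal (12 * b * (norm x)\<^sup>2 * norm z ^ 2)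
      + ennreal (kern \<epsilon> z) * ennreal (2 * b * norm z ^ 4)"
      unfolding distrib_left[symmetric] by (rule mult_left_mono) simp
  qed
  also have "\<dots> = ennreal (2 * barrier b x * (fact 0 * \<epsilon> ^ 0)) + ennreal (12 * b * (norm x)\<^sup>2 * (fact 2 * \<epsilon> ^ 2))
      + ennreal (2 * b * (fact 4 * \<epsilon> ^ 4))"
  proof -
    have 0: "0 \<le> 2 * barrier b x" "0 \<le> 12 * b * (norm x)\<^sup>2" "0 \<le> 2 * b" using bn b0 by auto
    show ?thesis
      unfolding nn_integral_kern_cmult_power[OF e(1) 0(1), symmetric] nn_integral_kern_cmult_power[OF e(1) 0(2), symmetric]
        nn_integral_kern_cmult_power[OF e(1) 0(3), symmetric]
      by (subst nn_integral_add, measurable, subst nn_integral_add, measurable)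
  qed
  also have "\<dots> = ennreal (2 * barrier b x + 24 * b * (norm x)\<^sup>2 * \<epsilon>\<^sup>2 + 48 * b * \<epsilon> ^ 4)"
    using bn b0 by (simp add: fact_numeral flip: ennreal_plus)
  also have "\<dots> \<le> ennreal (2 * barrier b x + 2 * \<epsilon>\<^sup>2)"
  proof (rule ennreal_leI)
    have "(norm x)\<^sup>2 \<le> R\<^sup>2" using R by (intro power_mono) auto
    moreover have "\<epsilon>\<^sup>2 \<le> 1" using e by (simp add: power_le_one)
    ultimately have "b * (12 * (norm x)\<^sup>2 + 24 * \<epsilon>\<^sup>2) \<le> b * (12 * R\<^sup>2 + 24)"
      using b0 by (intro mult_left_mono) auto
    also have "\<dots> = 1"
    proof -
      have "0 < 12 * R\<^sup>2 + 24" by (simp add: add_nonneg_pos)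
      then show ?thesis unfolding b by simp
    qed
    finally have "b * (12 * (norm x)\<^sup>2 + 24 * \<epsilon>\<^sup>2) * (2 * \<epsilon>\<^sup>2) \<le> 1 * (2 * \<epsilon>\<^sup>2)"
      by (intro mult_right_mono) auto
    moreover have ex: "b * (12 * p + 24 * q) * (2 * q) = 24 * b * p * q + 48 * b * (q * q)" for p q :: real
      by (simp add: distrib_left distrib_right mult_ac)
    moreover have e4: "\<epsilon> ^ 4 = \<epsilon>\<^sup>2 * \<epsilon>\<^sup>2" by (simp flip: power_add)
    ultimately show "2 * barrier b x + 24 * b * (norm x)\<^sup>2 * \<epsilon>\<^sup>2 + 48 * b * \<epsilon> ^ 4 \<le> 2 * barrier b x + 2 * \<epsilon>\<^sup>2"
      unfolding e4 using ex[of "(norm x)\<^sup>2" "\<epsilon>\<^sup>2"] by linarith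
  qed
  finally have le: "?I + ?I + ennreal (4 * \<epsilon>\<^sup>2) \<le> ennreal (2 * barrier b x + 2 * \<epsilon>\<^sup>2)"
    by (simp add: IJ fact_numeral)
  have "?I \<noteq> \<top>" using le by (auto simp: top_unique)
  then obtain r where r: "?I = ennreal r" "0 \<le> r" by (cases ?I) auto
  then have "ennreal (r + r + 4 * \<epsilon>\<^sup>2) \<le> ennreal (2 * barrier b x + 2 * \<epsilon>\<^sup>2)"
    using le by (simp flip: ennreal_plus)
  then have "r + r + 4 * \<epsilon>\<^sup>2 \<le> 2 * barrier b x + 2 * \<epsilon>\<^sup>2"
    using bn by (subst (asm) ennreal_le_iff) auto
  then have "r \<le> barrier b x - \<epsilon>\<^sup>2" by simp
  then have "?I \<le> ennreal (barrier b x - \<epsilon>\<^sup>2)" unfolding r(1) by (rule ennreal_leI)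
  then show ?thesis by (subst nn_integral_kern_translate) auto
qed

section \<open>Bounds for subsolutions\<close>

text \<open>Convexity of the square with weights \<theta> and 1 - \<theta>. This weighting turns the
  factor \<theta>^2 of Schur's test into \<theta> < 1, so that the first term can be
  absorbed.\<close>

lemma ennreal_square_sum_le:
  fixes p q :: ennreal
  assumes \<theta>: "0 < \<theta>" "\<theta> < 1"
  shows "(p + q)\<^sup>2 \<le> ennreal (1 / \<theta>) * p\<^sup>2 + ennreal (1 / (1 - \<theta>)) * q\<^sup>2"
proof (cases "p = \<top> \<or> q = \<top>")
  case True
  then show ?thesis using \<theta> by (auto simp: power2_eq_square ennreal_mult_top ennreal_top_mult)
next
  case False
  then obtain a b where ab: "p = ennreal a" "q = ennreal b" "0 \<le> a" "0 \<le> b"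
    by (cases p; cases q) auto
  have "0 \<le> ((1 - \<theta>) * a - \<theta> * b)\<^sup>2 / (\<theta> * (1 - \<theta>))" using \<theta> by simp
  also have "\<dots> = (1 / \<theta>) * a\<^sup>2 + (1 / (1 - \<theta>)) * b\<^sup>2 - (a + b)\<^sup>2"
    using \<theta> by (simp add: field_simps power2_eq_square)
  finally have "(a + b)\<^sup>2 \<le> (1 / \<theta>) * a\<^sup>2 + (1 / (1 - \<theta>)) * b\<^sup>2" by simp
  moreover have "ennreal (1 / \<theta>) * p\<^sup>2 + ennreal (1 / (1 - \<theta>)) * q\<^sup>2
      = ennreal ((1 / \<theta>) * a\<^sup>2 + (1 / (1 - \<theta>)) * b\<^sup>2)"
    using \<theta> ab by (simp add: ennreal_power flip: ennreal_mult ennreal_plus)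
  moreover have "(p + q)\<^sup>2 = ennreal ((a + b)\<^sup>2)"
    using ab by (simp add: ennreal_power flip: ennreal_plus)
  ultimately show ?thesis by (simp add: ennreal_leI)
qed

lemma ennreal_power2_le_imp_le:
  fixes t :: ennreal
  assumes "t\<^sup>2 \<le> ennreal (c\<^sup>2)" "0 \<le> c"
  shows "t \<le> ennreal c"
proof (cases t)
  case (real r)
  then have "r\<^sup>2 \<le> c\<^sup>2" using assms by (simp add: ennreal_power ennreal_le_iff)
  then have "r \<le> c" using assms(2) by (rule power2_le_imp_le)
  then show ?thesis using real by (simp add: ennreal_leI)
next
  case top
  then show ?thesis using assms(1) by (simp add: power2_eq_square top_unique)
qed

text \<open>The supersolution serves as the Schur weight, and symmetry of k lets the same weight
  work in both variables. With ?X the integral of W^2 and ?Y that of f^2 this leads to ?X <=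
  \<theta> ?X + ?Y/(1 - \<theta>), where finiteness of ?X permits absorption.\<close>

lemma schur_bound:
  fixes k :: "real^3 \<Rightarrow> real" and \<Phi> :: "real^3 \<Rightarrow> real" and W f :: "real^3 \<Rightarrow> ennreal"
  assumes [measurable]: "k \<in> borel_measurable borel" "\<Phi> \<in> borel_measurable borel"
      "W \<in> borel_measurable borel" "f \<in> borel_measurable borel" "\<Omega> \<in> sets borel"
    and k: "\<And>z. 0 \<le> k z" "\<And>z. k (- z) = k z" and \<Phi>: "\<And>x. 0 < \<Phi> x" and \<theta>: "0 < \<theta>" "\<theta> < 1"
    and super: "\<And>x. x \<in> \<Omega> \<Longrightarrow> (\<integral>\<^sup>+y. ennreal (k (x - y)) * ennreal (\<Phi> y) \<partial>lborel) \<le> ennreal (\<theta> * \<Phi> x)"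
    and W0: "\<And>x. x \<notin> \<Omega> \<Longrightarrow> W x = 0" and W2: "(\<integral>\<^sup>+x. (W x)\<^sup>2 \<partial>lborel) < \<top>"
    and sub: "AE x in lborel. x \<in> \<Omega> \<longrightarrow> W x \<le> (\<integral>\<^sup>+y. ennreal (k (x - y)) * W y \<partial>lborel) + f x"
  shows "ennreal ((1 - \<theta>)\<^sup>2) * (\<integral>\<^sup>+x. (W x)\<^sup>2 \<partial>lborel) \<le> (\<integral>\<^sup>+x. (f x)\<^sup>2 \<partial>lborel)"
proof -
  let ?K = "\<lambda>x. \<integral>\<^sup>+y. ennreal (k (x - y)) * W y \<partial>lborel"
  let ?V = "\<lambda>x. \<integral>\<^sup>+y. ennreal (k (x - y) / \<Phi> y) * (W y)\<^sup>2 \<partial>lborel"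
  have CS: "(?K x)\<^sup>2 \<le> ennreal (\<theta> * \<Phi> x) * ?V x" if x: "x \<in> \<Omega>" for x
  proof -
    \<comment> \<open>Cauchy-Schwarz for the splitting of k into sqrt(k \<Phi>) and sqrt(k/\<Phi>);
      the square of the first factor is what the supersolution property bounds.\<close>
    have "?K x = (\<integral>\<^sup>+y. ennreal (sqrt (k (x - y) * \<Phi> y)) * (ennreal (sqrt (k (x - y) / \<Phi> y)) * W y) \<partial>lborel)"
    proof (intro nn_integral_cong)
      fix y
      have "sqrt (k (x - y) * \<Phi> y) * sqrt (k (x - y) / \<Phi> y) = sqrt (k (x - y) * k (x - y))"
        using \<Phi>[of y] by (simp flip: real_sqrt_mult)
      also have "\<dots> = k (x - y)" using k(1)[of "x - y"] by simp
      finally show "ennreal (k (x - y)) * W y = ennreal (sqrt (k (x - y) * \<Phi> y)) * (ennreal (sqrt (k (x - y) / \<Phi> y)) * W y)"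
        using k(1)[of "x - y"] \<Phi>[of y] by (simp add: less_imp_le flip: mult.assoc ennreal_mult)
    qed
    also have "\<dots>\<^sup>2 \<le> (\<integral>\<^sup>+y. (ennreal (sqrt (k (x - y) * \<Phi> y)))\<^sup>2 \<partial>lborel)
        * (\<integral>\<^sup>+y. (ennreal (sqrt (k (x - y) / \<Phi> y)) * W y)\<^sup>2 \<partial>lborel)"
      by (rule Cauchy_Schwarz_nn_integral) measurable
    also have "(\<integral>\<^sup>+y. (ennreal (sqrt (k (x - y) * \<Phi> y)))\<^sup>2 \<partial>lborel)
        = (\<integral>\<^sup>+y. ennreal (k (x - y)) * ennreal (\<Phi> y) \<partial>lborel)"
      using k(1) \<Phi> by (intro nn_integral_cong) (simp add: less_imp_le ennreal_power flip: ennreal_mult)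
    also have "(\<integral>\<^sup>+y. (ennreal (sqrt (k (x - y) / \<Phi> y)) * W y)\<^sup>2 \<partial>lborel) = ?V x"
      using k(1) \<Phi> by (intro nn_integral_cong) (simp add: less_imp_le power_mult_distrib ennreal_power)
    also have "(\<integral>\<^sup>+y. ennreal (k (x - y)) * ennreal (\<Phi> y) \<partial>lborel) * ?V x \<le> ennreal (\<theta> * \<Phi> x) * ?V x"
      by (intro mult_right_mono super x) simp
    finally show ?thesis .
  qed
  have KK: "(\<integral>\<^sup>+x. (?K x)\<^sup>2 * indicator \<Omega> x \<partial>lborel) \<le> ennreal (\<theta>\<^sup>2) * (\<integral>\<^sup>+x. (W x)\<^sup>2 \<partial>lborel)"
  proof -
    have "(\<integral>\<^sup>+x. (?K x)\<^sup>2 * indicator \<Omega> x \<partial>lborel)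
        \<le> (\<integral>\<^sup>+x. \<integral>\<^sup>+y. (ennreal (\<theta> * \<Phi> x) * indicator \<Omega> x) * (ennreal (k (x - y) / \<Phi> y) * (W y)\<^sup>2) \<partial>lborel \<partial>lborel)"
    proof (rule nn_integral_mono)
      fix x
      have "(\<integral>\<^sup>+y. (ennreal (\<theta> * \<Phi> x) * indicator \<Omega> x) * (ennreal (k (x - y) / \<Phi> y) * (W y)\<^sup>2) \<partial>lborel)
          = (ennreal (\<theta> * \<Phi> x) * indicator \<Omega> x) * ?V x"
        by (rule nn_integral_cmult) measurable
      then show "(?K x)\<^sup>2 * indicator \<Omega> x
        \<le> (\<integral>\<^sup>+y. (ennreal (\<theta> * \<Phi> x) * indicator \<Omega> x) * (ennreal (k (x - y) / \<Phi> y) * (W y)\<^sup>2) \<partial>lborel)"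
        using CS[of x] by (simp add: indicator_def)
    qed
    also have "\<dots> = (\<integral>\<^sup>+y. \<integral>\<^sup>+x. (ennreal (\<theta> * \<Phi> x) * indicator \<Omega> x) * (ennreal (k (x - y) / \<Phi> y) * (W y)\<^sup>2) \<partial>lborel \<partial>lborel)"
      by (rule lborel_pair.Fubini') measurable
    also have "\<dots> \<le> (\<integral>\<^sup>+y. ennreal (\<theta>\<^sup>2) * (W y)\<^sup>2 \<partial>lborel)"
    proof (rule nn_integral_mono)
      fix y
      show "(\<integral>\<^sup>+x. (ennreal (\<theta> * \<Phi> x) * indicator \<Omega> x) * (ennreal (k (x - y) / \<Phi> y) * (W y)\<^sup>2) \<partial>lborel)
          \<le> ennreal (\<theta>\<^sup>2) * (W y)\<^sup>2"
      \<comment> \<open>The supersolution property is assumed only in \<Omega>; elsewhere W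
        vanishes.\<close>
      proof (cases "y \<in> \<Omega>")
        case True
        have "(\<integral>\<^sup>+x. (ennreal (\<theta> * \<Phi> x) * indicator \<Omega> x) * (ennreal (k (x - y) / \<Phi> y) * (W y)\<^sup>2) \<partial>lborel)
          \<le> (\<integral>\<^sup>+x. (ennreal (\<theta> / \<Phi> y) * (W y)\<^sup>2) * (ennreal (k (y - x)) * ennreal (\<Phi> x)) \<partial>lborel)"
        proof (rule nn_integral_mono)
          fix x
          have "k (x - y) = k (y - x)" using k(2)[of "y - x"] by simp
          then have "ennreal (\<theta> * \<Phi> x) * ennreal (k (x - y) / \<Phi> y) = ennreal (\<theta> / \<Phi> y) * (ennreal (k (y - x)) * ennreal (\<Phi> x))"
            using \<theta> k(1)[of "y - x"] \<Phi>[of x] \<Phi>[of y] by (simp add: less_imp_le mult_ac flip: ennreal_mult)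
          then have "ennreal (\<theta> * \<Phi> x) * (ennreal (k (x - y) / \<Phi> y) * (W y)\<^sup>2)
              = (ennreal (\<theta> / \<Phi> y) * (W y)\<^sup>2) * (ennreal (k (y - x)) * ennreal (\<Phi> x))"
            by (metis mult.assoc mult.commute)
          then show "(ennreal (\<theta> * \<Phi> x) * indicator \<Omega> x) * (ennreal (k (x - y) / \<Phi> y) * (W y)\<^sup>2)
             \<le> (ennreal (\<theta> / \<Phi> y) * (W y)\<^sup>2) * (ennreal (k (y - x)) * ennreal (\<Phi> x))"
            by (simp add: indicator_def)
        qed
        also have "\<dots> = (ennreal (\<theta> / \<Phi> y) * (W y)\<^sup>2) * (\<integral>\<^sup>+x. ennreal (k (y - x)) * ennreal (\<Phi> x) \<partial>lborel)"
          by (rule nn_integral_cmult) measurable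
        also have "\<dots> \<le> (ennreal (\<theta> / \<Phi> y) * (W y)\<^sup>2) * ennreal (\<theta> * \<Phi> y)"
          by (intro mult_left_mono super True) simp
        also have "\<dots> = (ennreal (\<theta> / \<Phi> y) * ennreal (\<theta> * \<Phi> y)) * (W y)\<^sup>2" by (simp only: mult_ac)
        also have "ennreal (\<theta> / \<Phi> y) * ennreal (\<theta> * \<Phi> y) = ennreal (\<theta>\<^sup>2)"
          using \<theta> \<Phi>[of y] by (simp add: less_imp_le power2_eq_square flip: ennreal_mult)
        finally show ?thesis .
      qed (simp add: W0)
    qed
    also have "\<dots> = ennreal (\<theta>\<^sup>2) * (\<integral>\<^sup>+x. (W x)\<^sup>2 \<partial>lborel)" by (rule nn_integral_cmult) measurable
    finally show ?thesis .
  qed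
  let ?X = "\<integral>\<^sup>+x. (W x)\<^sup>2 \<partial>lborel" and ?Y = "\<integral>\<^sup>+x. (f x)\<^sup>2 \<partial>lborel"
  have "?X \<le> (\<integral>\<^sup>+x. ennreal (1 / \<theta>) * ((?K x)\<^sup>2 * indicator \<Omega> x) + ennreal (1 / (1 - \<theta>)) * (f x)\<^sup>2 \<partial>lborel)"
  proof (rule nn_integral_mono_AE, rule AE_mp[OF sub], intro AE_I2 impI)
    fix x assume s: "x \<in> \<Omega> \<longrightarrow> W x \<le> ?K x + f x"
    show "(W x)\<^sup>2 \<le> ennreal (1 / \<theta>) * ((?K x)\<^sup>2 * indicator \<Omega> x) + ennreal (1 / (1 - \<theta>)) * (f x)\<^sup>2"
    proof (cases "x \<in> \<Omega>")
      case True
      then have "(W x)\<^sup>2 \<le> (?K x + f x)\<^sup>2" using s by (intro power_mono) auto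
      also have "\<dots> \<le> ennreal (1 / \<theta>) * (?K x)\<^sup>2 + ennreal (1 / (1 - \<theta>)) * (f x)\<^sup>2"
        by (rule ennreal_square_sum_le[OF \<theta>])
      finally show ?thesis using True by simp
    qed (simp add: W0)
  qed
  also have "\<dots> = ennreal (1 / \<theta>) * (\<integral>\<^sup>+x. (?K x)\<^sup>2 * indicator \<Omega> x \<partial>lborel) + ennreal (1 / (1 - \<theta>)) * ?Y"
    by (subst nn_integral_add, measurable, subst (1 2) nn_integral_cmult) auto
  also have "\<dots> \<le> ennreal (1 / \<theta>) * (ennreal (\<theta>\<^sup>2) * ?X) + ennreal (1 / (1 - \<theta>)) * ?Y"
    by (intro add_right_mono mult_left_mono KK) simp
  finally have le: "?X \<le> ennreal (1 / \<theta>) * (ennreal (\<theta>\<^sup>2) * ?X) + ennreal (1 / (1 - \<theta>)) * ?Y" .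
  show ?thesis
  proof (cases "?Y = \<top>")
    case False
    then obtain Y where Y: "?Y = ennreal Y" "0 \<le> Y" by (cases ?Y) auto
    obtain X where X: "?X = ennreal X" "0 \<le> X" using W2 by (cases ?X) auto
    have "ennreal X \<le> ennreal (\<theta> * X + Y / (1 - \<theta>))"
      using le \<theta> X(2) Y(2) unfolding X(1) Y(1)
      by (simp add: power2_eq_square flip: ennreal_mult ennreal_plus mult.assoc)
    then have "X \<le> \<theta> * X + Y / (1 - \<theta>)" using \<theta> X(2) Y(2) by (subst (asm) ennreal_le_iff) auto
    then have "X * (1 - \<theta>) \<le> Y / (1 - \<theta>)" by (simp add: algebra_simps)
    then have "(1 - \<theta>)\<^sup>2 * X \<le> Y" using \<theta> by (simp add: field_simps power2_eq_square)
    then show ?thesis unfolding X(1) Y(1) using X(2) by (simp add: ennreal_leI flip: ennreal_mult)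
  qed simp
qed

text \<open>Subtraction in \<open>ennreal\<close> is truncated, so ?Z is the positive part of W - 2
  B. Mass 1/2 sends the constant 2 B to B, hence ?Z is at most its own convolution with k, and its
  finite integral is at most half of itself.\<close>

lemma truncation_bound:
  fixes k :: "real^3 \<Rightarrow> ennreal" and W :: "real^3 \<Rightarrow> ennreal"
  assumes [measurable]: "k \<in> borel_measurable borel" "W \<in> borel_measurable borel" "\<Omega> \<in> sets borel"
    and k2: "\<And>x. (\<integral>\<^sup>+y. k (x - y) \<partial>lborel) \<le> ennreal (1 / 2)" "\<And>y. (\<integral>\<^sup>+x. k (x - y) \<partial>lborel) \<le> ennreal (1 / 2)"
    and B: "0 \<le> B" and W0: "\<And>x. x \<notin> \<Omega> \<Longrightarrow> W x = 0" and W1: "(\<integral>\<^sup>+x. W x \<partial>lborel) < \<top>"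
    and sub: "AE x in lborel. x \<in> \<Omega> \<longrightarrow> W x \<le> (\<integral>\<^sup>+y. k (x - y) * W y \<partial>lborel) + ennreal B"
  shows "AE x in lborel. W x \<le> ennreal (2 * B)"
proof -
  let ?Z = "\<lambda>x. W x - ennreal (2 * B)"
  have "(\<integral>\<^sup>+x. ?Z x \<partial>lborel) \<le> (\<integral>\<^sup>+x. \<integral>\<^sup>+y. k (x - y) * ?Z y \<partial>lborel \<partial>lborel)"
  proof (rule nn_integral_mono_AE, rule AE_mp[OF sub], intro AE_I2 impI)
    fix x assume s: "x \<in> \<Omega> \<longrightarrow> W x \<le> (\<integral>\<^sup>+y. k (x - y) * W y \<partial>lborel) + ennreal B"
    show "?Z x \<le> (\<integral>\<^sup>+y. k (x - y) * ?Z y \<partial>lborel)"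
    proof (cases "x \<in> \<Omega>")
      case True
      have "(\<integral>\<^sup>+y. k (x - y) * W y \<partial>lborel) \<le> (\<integral>\<^sup>+y. k (x - y) * ?Z y + k (x - y) * ennreal (2 * B) \<partial>lborel)"
      proof (rule nn_integral_mono)
        fix y
        have "W y \<le> ?Z y + ennreal (2 * B)"
          by (cases "W y \<le> ennreal (2 * B)") (auto intro: add_increasing simp: not_le less_imp_le diff_add_cancel_ennreal)
        then have "k (x - y) * W y \<le> k (x - y) * (?Z y + ennreal (2 * B))" by (intro mult_left_mono) auto
        then show "k (x - y) * W y \<le> k (x - y) * ?Z y + k (x - y) * ennreal (2 * B)" by (simp only: distrib_left)
      qed
      also have "\<dots> = (\<integral>\<^sup>+y. k (x - y) * ?Z y \<partial>lborel) + (\<integral>\<^sup>+y. k (x - y) * ennreal (2 * B) \<partial>lborel)"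
        by (rule nn_integral_add) measurable
      also have "(\<integral>\<^sup>+y. k (x - y) * ennreal (2 * B) \<partial>lborel) = (\<integral>\<^sup>+y. k (x - y) \<partial>lborel) * ennreal (2 * B)"
        by (rule nn_integral_multc) measurable
      also have "(\<integral>\<^sup>+y. k (x - y) * ?Z y \<partial>lborel) + (\<integral>\<^sup>+y. k (x - y) \<partial>lborel) * ennreal (2 * B)
          \<le> (\<integral>\<^sup>+y. k (x - y) * ?Z y \<partial>lborel) + ennreal (1 / 2) * ennreal (2 * B)"
        by (intro add_left_mono mult_right_mono k2) simp
      also have "ennreal (1 / 2) * ennreal (2 * B) = ennreal B"
        using B by (subst ennreal_mult[symmetric]) auto
      finally have "W x \<le> ((\<integral>\<^sup>+y. k (x - y) * ?Z y \<partial>lborel) + ennreal B) + ennreal B"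
        using s True by (meson add_right_mono order_trans)
      also have "\<dots> = (\<integral>\<^sup>+y. k (x - y) * ?Z y \<partial>lborel) + ennreal (2 * B)"
        using B by (simp add: add.assoc flip: ennreal_plus)
      finally have "?Z x \<le> ((\<integral>\<^sup>+y. k (x - y) * ?Z y \<partial>lborel) + ennreal (2 * B)) - ennreal (2 * B)"
        by (rule ennreal_minus_mono) simp
      then show ?thesis by simp
    qed (simp add: W0)
  qed
  also have "\<dots> = (\<integral>\<^sup>+y. \<integral>\<^sup>+x. k (x - y) * ?Z y \<partial>lborel \<partial>lborel)"
    by (rule lborel_pair.Fubini') measurable
  also have "\<dots> \<le> (\<integral>\<^sup>+y. ennreal (1 / 2) * ?Z y \<partial>lborel)"
  proof (rule nn_integral_mono)
    fix y
    have "(\<integral>\<^sup>+x. k (x - y) * ?Z y \<partial>lborel) = (\<integral>\<^sup>+x. k (x - y) \<partial>lborel) * ?Z y"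
      by (rule nn_integral_multc) measurable
    also have "\<dots> \<le> ennreal (1 / 2) * ?Z y" by (intro mult_right_mono k2) simp
    finally show "(\<integral>\<^sup>+x. k (x - y) * ?Z y \<partial>lborel) \<le> ennreal (1 / 2) * ?Z y" .
  qed
  also have "\<dots> = ennreal (1 / 2) * (\<integral>\<^sup>+y. ?Z y \<partial>lborel)" by (rule nn_integral_cmult) measurable
  finally have le: "(\<integral>\<^sup>+x. ?Z x \<partial>lborel) \<le> ennreal (1 / 2) * (\<integral>\<^sup>+y. ?Z y \<partial>lborel)" .
  have "(\<integral>\<^sup>+x. ?Z x \<partial>lborel) \<le> (\<integral>\<^sup>+x. W x \<partial>lborel)" by (intro nn_integral_mono) (rule diff_le_self_ennreal)
  then have "(\<integral>\<^sup>+x. ?Z x \<partial>lborel) < \<top>" using W1 by (rule le_less_trans)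
  then obtain z where z: "(\<integral>\<^sup>+x. ?Z x \<partial>lborel) = ennreal z" "0 \<le> z" by (cases "\<integral>\<^sup>+x. ?Z x \<partial>lborel") auto
  have "ennreal (1 / 2) * ennreal z = ennreal (1 / 2 * z)" using z(2) by (intro ennreal_mult[symmetric]) auto
  with le have "ennreal z \<le> ennreal (1 / 2 * z)" unfolding z(1) by (simp only:)
  then have "z \<le> 1 / 2 * z" using z(2) by (subst (asm) ennreal_le_iff) auto
  then have "(\<integral>\<^sup>+x. ?Z x \<partial>lborel) = 0" using z by simp
  then have "AE x in lborel. ?Z x = 0" by (subst (asm) nn_integral_0_iff_AE) auto
  then show ?thesis by (rule AE_mp) (intro AE_I2 impI, simp add: ennreal_minus_eq_0)
qed

lemma nn_integral_lborel_translate: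
  fixes H :: "real^3 \<Rightarrow> ennreal"
  assumes [measurable]: "H \<in> borel_measurable borel"
  shows "(\<integral>\<^sup>+x. H (x - y) \<partial>lborel) = (\<integral>\<^sup>+z. H z \<partial>lborel)"
    and "(\<integral>\<^sup>+x. H (y - x) \<partial>lborel) = (\<integral>\<^sup>+z. H z \<partial>lborel)"
proof -
  have 1: "(lborel :: (real^3) measure) = distr lborel borel ((+) (- y))" by (rule lborel_distr_plus[symmetric])
  have "(\<integral>\<^sup>+z. H z \<partial>lborel) = (\<integral>\<^sup>+z. H z \<partial>distr lborel borel ((+) (- y)))"
    using 1 by (rule arg_cong)
  also have "\<dots> = (\<integral>\<^sup>+x. H (- y + x) \<partial>lborel)" by (rule nn_integral_distr) measurable
  finally show "(\<integral>\<^sup>+x. H (x - y) \<partial>lborel) = (\<integral>\<^sup>+z. H z \<partial>lborel)" by simp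
  have 2: "(lborel :: (real^3) measure) = distr lborel borel (\<lambda>x. y - x)"
    using lborel_affine[of "-1" y] by (simp add: density_1)
  have "(\<integral>\<^sup>+z. H z \<partial>lborel) = (\<integral>\<^sup>+z. H z \<partial>distr lborel borel (\<lambda>x. y - x))"
    using 2 by (rule arg_cong)
  also have "\<dots> = (\<integral>\<^sup>+x. H (y - x) \<partial>lborel)" by (rule nn_integral_distr) measurable
  finally show "(\<integral>\<^sup>+x. H (y - x) \<partial>lborel) = (\<integral>\<^sup>+z. H z \<partial>lborel)" by simp
qed

text \<open>The kernel is split at radius $\epsilon/2$: the singular part has mass at most $1/2$ and is
  absorbed by truncation, the rest maps $L^2$ to $L^\infty$.\<close>

lemma kern_subsolution_bound:
  fixes W f :: "real^3 \<Rightarrow> ennreal"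
  assumes e: "0 < \<epsilon>" "\<epsilon> \<le> 1" and R: "\<And>x. x \<in> \<Omega> \<Longrightarrow> norm x \<le> R"
    and meas [measurable]: "W \<in> borel_measurable borel" "f \<in> borel_measurable borel" "\<Omega> \<in> sets borel"
    and A: "A = 1 + (12 * R\<^sup>2 + 24) / 4 + R ^ 4"
    and W0: "\<And>x. x \<notin> \<Omega> \<Longrightarrow> W x = 0" and W2: "(\<integral>\<^sup>+x. (W x)\<^sup>2 \<partial>lborel) < \<top>"
    and sub: "AE x in lborel. x \<in> \<Omega> \<longrightarrow> W x \<le> (\<integral>\<^sup>+y. ennreal (kern \<epsilon> (x - y)) * W y \<partial>lborel) + f x"
    and f: "AE x in lborel. f x \<le> ennreal m" "0 \<le> m" and q: "(\<integral>\<^sup>+x. (f x)\<^sup>2 \<partial>lborel) \<le> ennreal (q\<^sup>2)" "0 \<le> q"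
  shows "AE x in lborel. W x \<le> ennreal (2 * (2 * A * \<epsilon> powr (-7/2) * q + m))"
proof -
  define b where "b = 1 / (12 * R\<^sup>2 + 24)"
  have d0: "0 < 12 * R\<^sup>2 + 24" by (simp add: add_nonneg_pos)
  then have b: "0 < b" "b \<le> 1" "1 / (4 * b) = (12 * R\<^sup>2 + 24) / 4" by (auto simp: b_def)
  have A1: "1 \<le> A" unfolding A using d0 by (simp add: add_nonneg_nonneg)
  \<comment> \<open>1/(4 b) is the second summand of A, and b <= 1 bounds the quartic term by R^4,
    so A is an upper bound for the barrier on \<Omega>.\<close>
  have barA: "barrier b x \<le> A" if "x \<in> \<Omega>" for x
  proof -
    have "((norm x)\<^sup>2)\<^sup>2 \<le> R ^ 4" using R[OF that] by (simp add: power_mono flip: power_mult)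
    then have "b * ((norm x)\<^sup>2)\<^sup>2 \<le> 1 * R ^ 4" using b by (intro mult_mono) auto
    then show ?thesis unfolding barrier_eq[OF b(1)] b(3) A using zero_le_power2[of "norm x"] by linarith
  qed
  \<comment> \<open>The additive gain \<epsilon>^2 becomes a relative one through barrier <= A. The
    factor 2 keeps \<theta> positive given A >= 1 and \<epsilon> <= 1.\<close>
  define \<theta> where "\<theta> = 1 - \<epsilon>\<^sup>2 / (2 * A)"
  have e2: "0 < \<epsilon>\<^sup>2" "\<epsilon>\<^sup>2 \<le> 1" using e by (auto simp: power_le_one)
  have "0 < \<epsilon>\<^sup>2 / (2 * A)" "\<epsilon>\<^sup>2 / (2 * A) < 1" using e2 A1 by (auto simp: divide_less_eq)
  then have \<theta>: "0 < \<theta>" "\<theta> < 1" by (auto simp: \<theta>_def)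
  have super: "(\<integral>\<^sup>+y. ennreal (kern \<epsilon> (x - y)) * ennreal (barrier b y) \<partial>lborel) \<le> ennreal (\<theta> * barrier b x)" if x: "x \<in> \<Omega>" for x
  proof -
    have "\<epsilon>\<^sup>2 * barrier b x \<le> \<epsilon>\<^sup>2 * A" using barA[OF x] e2 by (intro mult_left_mono) auto
    then have "\<epsilon>\<^sup>2 / (2 * A) * barrier b x \<le> \<epsilon>\<^sup>2" using A1 e2 by (simp add: field_simps add_increasing2)
    then have "barrier b x - \<epsilon>\<^sup>2 \<le> \<theta> * barrier b x" by (simp add: \<theta>_def left_diff_distrib)
    then show ?thesis using kern_barrier[OF e R[OF x] b_def] by (meson ennreal_leI order_trans)
  qed
  have L2: "ennreal ((1 - \<theta>)\<^sup>2) * (\<integral>\<^sup>+x. (W x)\<^sup>2 \<partial>lborel) \<le> (\<integral>\<^sup>+x. (f x)\<^sup>2 \<partial>lborel)"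
    using barrier_ge_1[OF b(1)]
    by (intro schur_bound[OF _ _ meas _ _ _ \<theta> super W0 W2 sub]) (auto simp: kern_nonneg[OF e(1)] kern_minus intro: less_le_trans[OF zero_less_one])
  obtain X where X: "(\<integral>\<^sup>+x. (W x)\<^sup>2 \<partial>lborel) = ennreal X" "0 \<le> X"
    using W2 by (cases "\<integral>\<^sup>+x. (W x)\<^sup>2 \<partial>lborel") auto
  have "ennreal ((1 - \<theta>)\<^sup>2 * X) \<le> ennreal (q\<^sup>2)"
    using order_trans[OF L2 q(1)] X by (simp add: ennreal_mult)
  then have "(1 - \<theta>)\<^sup>2 * X \<le> q\<^sup>2" by (simp add: ennreal_le_iff)
  then have "(\<epsilon>\<^sup>2 / (2 * A))\<^sup>2 * X \<le> q\<^sup>2" by (simp add: \<theta>_def)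
  then have "\<epsilon> ^ 4 * X \<le> 4 * A\<^sup>2 * q\<^sup>2" using A1 by (simp add: power_divide power_mult_distrib field_simps flip: power_mult)
  then have Xle: "X \<le> 4 * A\<^sup>2 * q\<^sup>2 / \<epsilon> ^ 4" using e by (simp add: field_simps)

  define k1 where "k1 z = ennreal (kern \<epsilon> z) * indicator {..\<epsilon> / 2} (norm z)" for z
  define k2 where "k2 z = ennreal (kern \<epsilon> z) * indicator {\<epsilon> / 2<..} (norm z)" for z
  have [measurable]: "k1 \<in> borel_measurable borel" "k2 \<in> borel_measurable borel"
    unfolding k1_def[abs_def] k2_def[abs_def] by measurable
  have k12: "ennreal (kern \<epsilon> z) = k1 z + k2 z" for z by (simp add: k1_def k2_def indicator_def)
  \<comment> \<open>The supremum 1/(pi \<epsilon>^3) of the outer part times the total mass 1 of the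
    kernel.\<close>
  have k2_sq: "(\<integral>\<^sup>+y. (k2 (x - y))\<^sup>2 \<partial>lborel) \<le> ennreal (1 / (pi * \<epsilon> ^ 3))" for x
  proof -
    have "(\<integral>\<^sup>+y. (k2 (x - y))\<^sup>2 \<partial>lborel) = (\<integral>\<^sup>+z. (k2 z)\<^sup>2 \<partial>lborel)"
      by (rule nn_integral_lborel_translate) measurable
    also have "\<dots> \<le> (\<integral>\<^sup>+z. ennreal (1 / (pi * \<epsilon> ^ 3)) * ennreal (kern \<epsilon> z * norm z ^ 0) \<partial>lborel)"
    proof (rule nn_integral_mono)
      fix z :: "real^3"
      show "(k2 z)\<^sup>2 \<le> ennreal (1 / (pi * \<epsilon> ^ 3)) * ennreal (kern \<epsilon> z * norm z ^ 0)"
      proof (cases "\<epsilon> / 2 < norm z")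
        case True
        have "ennreal (kern \<epsilon> z) * ennreal (kern \<epsilon> z) \<le> ennreal (1 / (pi * \<epsilon> ^ 3)) * ennreal (kern \<epsilon> z)"
          using True e by (intro mult_right_mono ennreal_leI kern_le_outside) auto
        then show ?thesis using True by (simp add: k2_def power2_eq_square)
      qed (simp add: k2_def)
    qed
    also have "\<dots> = ennreal (1 / (pi * \<epsilon> ^ 3)) * ennreal (fact 0 * \<epsilon> ^ 0)"
      by (subst nn_integral_cmult) (simp_all only: nn_integral_kern_power[OF e(1)], measurable)
    finally show ?thesis by simp
  qed
  have K2: "(\<integral>\<^sup>+y. k2 (x - y) * W y \<partial>lborel) \<le> ennreal (2 * A * \<epsilon> powr (-7/2) * q)" for x
  proof -
    have "(\<integral>\<^sup>+y. k2 (x - y) * W y \<partial>lborel)\<^sup>2 \<le> (\<integral>\<^sup>+y. (k2 (x - y))\<^sup>2 \<partial>lborel) * (\<integral>\<^sup>+y. (W y)\<^sup>2 \<partial>lborel)"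
      by (rule Cauchy_Schwarz_nn_integral) measurable
    also have "\<dots> \<le> ennreal (1 / (pi * \<epsilon> ^ 3)) * ennreal X"
      unfolding X(1) by (intro mult_right_mono k2_sq) simp
    also have "\<dots> = ennreal (1 / (pi * \<epsilon> ^ 3) * X)" using e X by (simp flip: ennreal_mult)
    also have "\<dots> \<le> ennreal ((2 * A * \<epsilon> powr (-7/2) * q)\<^sup>2)"
    proof (rule ennreal_leI)
      \<comment> \<open>\<epsilon>^(-3) from the outer kernel and \<epsilon>^(-4) from the L^2 bound
        combine to \<epsilon>^(-7), the square of the required power.\<close>
      have "1 / (pi * \<epsilon> ^ 3) * X \<le> 1 / (pi * \<epsilon> ^ 3) * (4 * A\<^sup>2 * q\<^sup>2 / \<epsilon> ^ 4)"
        using Xle e by (intro mult_left_mono) auto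
      also have "\<dots> = (4 / pi) * (A\<^sup>2 * q\<^sup>2 / \<epsilon> ^ 7)"
      proof -
        have e7: "\<epsilon> ^ 7 = \<epsilon> ^ 3 * \<epsilon> ^ 4" by (simp flip: power_add)
        show ?thesis unfolding e7 by (simp add: mult_ac)
      qed
      finally have "1 / (pi * \<epsilon> ^ 3) * X \<le> (4 / pi) * (A\<^sup>2 * q\<^sup>2 / \<epsilon> ^ 7)" .
      also have "\<dots> \<le> 4 * (A\<^sup>2 * q\<^sup>2 / \<epsilon> ^ 7)"
        using pi_ge_two e by (intro mult_right_mono) (auto simp: divide_le_eq)
      also have "\<dots> = (2 * A * \<epsilon> powr (-7/2) * q)\<^sup>2"
      proof -
        have "(\<epsilon> powr (-7/2))\<^sup>2 = 1 / \<epsilon> ^ 7"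
        proof -
          have "(\<epsilon> powr (-7/2))\<^sup>2 = \<epsilon> powr (- 7)" by (simp add: power2_eq_square flip: powr_add)
          also have "\<dots> = 1 / \<epsilon> powr 7" by (rule powr_minus_divide)
          also have "\<epsilon> powr 7 = \<epsilon> ^ 7" using e by (rule_tac powr_numeral) simp
          finally show ?thesis .
        qed
        then show ?thesis by (simp add: power_mult_distrib)
      qed
      finally show "1 / (pi * \<epsilon> ^ 3) * X \<le> (2 * A * \<epsilon> powr (-7/2) * q)\<^sup>2" .
    qed
    finally show ?thesis
      by (rule ennreal_power2_le_imp_le) (use A1 q(2) in simp)
  qed
  define B where "B = 2 * A * \<epsilon> powr (-7/2) * q + m"
  have B0: "0 \<le> B" using A1 q(2) f(2) by (simp add: B_def)
  have k1_mass: "(\<integral>\<^sup>+z. k1 z \<partial>lborel) \<le> ennreal (1 / 2)"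
    unfolding k1_def by (rule nn_integral_kern_small_ball[OF e(1)])
  have "AE x in lborel. W x \<le> ennreal (2 * B)"
  proof (rule truncation_bound[of k1 W \<Omega> B])
    show "(\<integral>\<^sup>+y. k1 (x - y) \<partial>lborel) \<le> ennreal (1 / 2)" for x
      using k1_mass by (subst nn_integral_lborel_translate) auto
    show "(\<integral>\<^sup>+x. k1 (x - y) \<partial>lborel) \<le> ennreal (1 / 2)" for y
      using k1_mass by (subst nn_integral_lborel_translate) auto
    show "(\<integral>\<^sup>+x. W x \<partial>lborel) < \<top>"
    proof -
      \<comment> \<open>On a set of finite measure L^2 implies L^1, here through t <= 1 +
        t^2.\<close>
      have "\<Omega> \<subseteq> cball 0 R" using R by auto
      then have fin: "emeasure lborel \<Omega> < \<top>"
        using emeasure_bounded_finite[of \<Omega>] bounded_subset[OF bounded_cball] by auto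
      have "(\<integral>\<^sup>+x. W x \<partial>lborel) \<le> (\<integral>\<^sup>+x. indicator \<Omega> x + (W x)\<^sup>2 \<partial>lborel)"
      proof (rule nn_integral_mono)
        fix x
        have "t \<le> 1 + t\<^sup>2" for t :: ennreal
        proof (cases "t \<le> 1")
          case True then show ?thesis by (simp add: add_increasing2)
        next
          case False
          then have "1 * t \<le> t * t" by (intro mult_right_mono) auto
          then show ?thesis by (simp add: power2_eq_square add_increasing)
        qed
        then show "W x \<le> indicator \<Omega> x + (W x)\<^sup>2" by (cases "x \<in> \<Omega>") (auto simp: W0)
      qed
      also have "\<dots> = emeasure lborel \<Omega> + (\<integral>\<^sup>+x. (W x)\<^sup>2 \<partial>lborel)"
        by (subst nn_integral_add) auto
      also have "\<dots> < \<top>" using fin W2 by simp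
      finally show ?thesis .
    qed
    show "AE x in lborel. x \<in> \<Omega> \<longrightarrow> W x \<le> (\<integral>\<^sup>+y. k1 (x - y) * W y \<partial>lborel) + ennreal B"
    proof (rule AE_mp[OF sub], rule AE_mp[OF f(1)], intro AE_I2 impI)
      fix x assume fx: "f x \<le> ennreal m" and x: "x \<in> \<Omega>"
        and s: "x \<in> \<Omega> \<longrightarrow> W x \<le> (\<integral>\<^sup>+y. ennreal (kern \<epsilon> (x - y)) * W y \<partial>lborel) + f x"
      have "(\<integral>\<^sup>+y. ennreal (kern \<epsilon> (x - y)) * W y \<partial>lborel)
          = (\<integral>\<^sup>+y. k1 (x - y) * W y \<partial>lborel) + (\<integral>\<^sup>+y. k2 (x - y) * W y \<partial>lborel)"
        unfolding k12 distrib_right by (rule nn_integral_add) measurable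
      then have "W x \<le> (\<integral>\<^sup>+y. k1 (x - y) * W y \<partial>lborel) + (\<integral>\<^sup>+y. k2 (x - y) * W y \<partial>lborel) + f x"
        using s x by simp
      also have "\<dots> \<le> (\<integral>\<^sup>+y. k1 (x - y) * W y \<partial>lborel) + ennreal (2 * A * \<epsilon> powr (-7/2) * q) + ennreal m"
        by (intro add_mono K2 fx order_refl)
      also have "\<dots> = (\<integral>\<^sup>+y. k1 (x - y) * W y \<partial>lborel) + ennreal B"
        unfolding B_def using A1 q(2) f(2) by (subst ennreal_plus) (auto simp: add.assoc)
      finally show "W x \<le> (\<integral>\<^sup>+y. k1 (x - y) * W y \<partial>lborel) + ennreal B" .
    qed
  qed (use W0 B0 in auto)
  then show ?thesis unfolding B_def .
qed

section \<open>Averages over phase space\<close>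

text \<open>The essential supremum of an absolute value can be negative only on a null measure
  space, where it is -\<infinity> and \<open>real_of_ereal\<close> turns it into 0.\<close>

lemma memLinf_AE:
  assumes "memLinf M f"
  shows "AE z in M. \<bar>f z\<bar> \<le> real_of_ereal (Linf M f)" and "0 \<le> real_of_ereal (Linf M f)"
proof -
  have f [measurable]: "f \<in> borel_measurable M" and fin: "Linf M f < \<infinity>"
    using assms by (auto simp: memLinf_def)
  have AE: "AE z in M. ereal \<bar>f z\<bar> \<le> Linf M f"
    unfolding Linf_def by (rule esssup_AE)
  have "(AE z in M. \<bar>f z\<bar> \<le> real_of_ereal (Linf M f)) \<and> 0 \<le> real_of_ereal (Linf M f)"
  proof (cases "Linf M f")
    case (real r)
    have r: "AE z in M. \<bar>f z\<bar> \<le> r" using AE by (simp add: real)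
    have "0 \<le> r"
    proof (rule ccontr)
      assume "\<not> 0 \<le> r"
      with r have "AE z in M. ereal \<bar>f z\<bar> \<le> - \<infinity>" by (auto elim!: eventually_mono)
      then have "Linf M f \<le> - \<infinity>" unfolding Linf_def by (intro esssup_I) measurable
      then show False by (simp add: real)
    qed
    then show ?thesis using r by (simp add: real)
  next
    case MInf
    then have "AE z in M. False" using AE by simp
    then show ?thesis by (auto simp: MInf elim!: eventually_mono)
  qed (use fin in simp)
  then show "AE z in M. \<bar>f z\<bar> \<le> real_of_ereal (Linf M f)" "0 \<le> real_of_ereal (Linf M f)" by auto
qed

lemma nn_integral_square_le:
  fixes p :: "'a \<Rightarrow> ennreal"
  assumes [measurable]: "p \<in> borel_measurable M" and M: "emeasure M (space M) \<le> c"
  shows "(\<integral>\<^sup>+x. p x \<partial>M)\<^sup>2 \<le> c * (\<integral>\<^sup>+x. (p x)\<^sup>2 \<partial>M)"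
proof -
  have "(\<integral>\<^sup>+x. 1 * p x \<partial>M)\<^sup>2 \<le> (\<integral>\<^sup>+x. 1\<^sup>2 \<partial>M) * (\<integral>\<^sup>+x. (p x)\<^sup>2 \<partial>M)"
    by (rule Cauchy_Schwarz_nn_integral) measurable
  also have "\<dots> \<le> c * (\<integral>\<^sup>+x. (p x)\<^sup>2 \<partial>M)" using M by (intro mult_right_mono) auto
  finally show ?thesis by simp
qed

text \<open>Fubini: for every s the translate of N is null, so for almost every starting point the
  line meets N in a null set of times.\<close>

lemma AE_line_null:
  fixes N :: "(real^3) set"
  assumes N: "N \<in> null_sets lborel"
  shows "AE x in lborel. (\<integral>\<^sup>+s. indicator N (x - s *\<^sub>R w) \<partial>lborel) = 0"
proof -
  have [measurable]: "N \<in> sets borel" using N by auto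
  have "(\<integral>\<^sup>+x. (\<integral>\<^sup>+s. indicator N (x - s *\<^sub>R w) \<partial>lborel) \<partial>lborel)
      = (\<integral>\<^sup>+s. (\<integral>\<^sup>+x. indicator N (x - s *\<^sub>R w) \<partial>lborel) \<partial>lborel)"
    by (rule lborel_pair.Fubini') measurable
  also have "\<dots> = (\<integral>\<^sup>+s. (\<integral>\<^sup>+x. indicator N x \<partial>lborel) \<partial>(lborel :: real measure))"
    by (intro nn_integral_cong nn_integral_lborel_translate) measurable
  also have "\<dots> = 0" using N by (simp add: null_setsD1)
  finally show ?thesis by (subst (asm) nn_integral_0_iff_AE) auto
qed

lemma AE_exp_law_line_le:
  fixes \<psi> :: "real^3 \<Rightarrow> ennreal"
  assumes e: "0 < \<epsilon>" and [measurable]: "\<psi> \<in> borel_measurable borel" and le: "AE x in lborel. \<psi> x \<le> c"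
  shows "AE x in lborel. (\<integral>\<^sup>+s. \<psi> (x - s *\<^sub>R w) \<partial>exp_law \<epsilon>) \<le> c"
proof -
  interpret E: prob_space "exp_law \<epsilon>" by (rule prob_space_exp_law[OF e])
  let ?N = "{x. \<not> \<psi> x \<le> c}"
  have N: "?N \<in> null_sets lborel"
  proof -
    have "{x \<in> space lborel. \<not> \<psi> x \<le> c} \<in> sets lborel" by measurable
    from AE_iff_null[OF this] show ?thesis using le by simp
  qed
  then have [measurable]: "?N \<in> sets borel" by auto
  show ?thesis
  proof (rule AE_mp[OF AE_line_null[OF N, of w]], intro AE_I2 impI)
    fix x assume z: "(\<integral>\<^sup>+s. indicator ?N (x - s *\<^sub>R w) \<partial>lborel) = 0"
    have "AE s in lborel. indicator ?N (x - s *\<^sub>R w) = (0 :: ennreal)"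
      using z by (subst (asm) nn_integral_0_iff_AE) auto
    then have "AE s in exp_law \<epsilon>. \<psi> (x - s *\<^sub>R w) \<le> c"
      unfolding exp_law_def by (subst AE_density) (auto simp: indicator_def elim!: eventually_mono split: if_splits)
    then have "(\<integral>\<^sup>+s. \<psi> (x - s *\<^sub>R w) \<partial>exp_law \<epsilon>) \<le> (\<integral>\<^sup>+s. c \<partial>exp_law \<epsilon>)" by (rule nn_integral_mono_AE)
    then show "(\<integral>\<^sup>+s. \<psi> (x - s *\<^sub>R w) \<partial>exp_law \<epsilon>) \<le> c" using E.emeasure_space_1 by simp
  qed
qed

lemma AE_lebesgue_on_of_lborel:
  assumes "\<Omega> \<in> sets borel" "AE x in lborel. x \<in> \<Omega> \<longrightarrow> P x"
  shows "AE x in lebesgue_on \<Omega>. P x"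
  using assms by (subst AE_restrict_space_iff) (auto intro: AE_completion)

lemma AE_lborel_of_lebesgue_on:
  assumes "\<Omega> \<in> sets borel" "AE x in lebesgue_on \<Omega>. P x"
  shows "AE x in lborel. x \<in> \<Omega> \<longrightarrow> P x"
  using assms by (subst (asm) AE_restrict_space_iff) (auto simp: AE_completion_iff)

lemma nn_integral_lebesgue_on_eq_lborel:
  fixes h :: "'a::euclidean_space \<Rightarrow> ennreal"
  assumes \<Omega>: "\<Omega> \<in> sets borel" and h: "h \<in> borel_measurable borel" "\<And>x. x \<notin> \<Omega> \<Longrightarrow> h x = 0"
  shows "(\<integral>\<^sup>+x. h x \<partial>lborel) = (\<integral>\<^sup>+x. h x \<partial>lebesgue_on \<Omega>)"
proof -
  have "(\<integral>\<^sup>+x. h x \<partial>lebesgue_on \<Omega>) = (\<integral>\<^sup>+x. h x * indicator \<Omega> x \<partial>lebesgue)"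
    using \<Omega> by (intro nn_integral_restrict_space) auto
  also have "\<dots> = (\<integral>\<^sup>+x. h x \<partial>lebesgue)"
    using h(2) by (intro nn_integral_cong) (auto simp: indicator_def)
  also have "\<dots> = (\<integral>\<^sup>+x. h x \<partial>lborel)" by (rule nn_integral_completion)
  finally show ?thesis by simp
qed

lemma phase_measurable:
  assumes "f \<in> borel \<Otimes>\<^sub>M sphere_measure \<rightarrow>\<^sub>M N"
  shows "f \<in> phase_measure \<Omega> \<rightarrow>\<^sub>M N"
proof -
  have "(\<lambda>z. (fst z, snd z)) \<in> phase_measure \<Omega> \<rightarrow>\<^sub>M borel \<Otimes>\<^sub>M sphere_measure"
    by (intro measurable_Pair phase_measure_fst_measurable) (simp add: phase_measure_def)
  from measurable_compose[OF this assms] show ?thesis by simp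
qed

text \<open>Line estimates hold for fixed w and almost every x, whereas the product rule takes the
  variables in the opposite order. Exchanging them is what calls for a measurable P.\<close>

lemma AE_phase_measureI:
  assumes \<Omega>: "open \<Omega>" "bounded \<Omega>" and P: "Measurable.pred (borel \<Otimes>\<^sub>M sphere_measure) P"
    and AE: "AE w in sphere_measure. AE x in lborel. P (x, w)"
  shows "AE z in phase_measure \<Omega>. P z"
proof -
  interpret W: finite_measure sphere_measure by (rule finite_measure_sphere_measure)
  interpret L: finite_measure "lebesgue_on \<Omega>" by (rule finite_measure_lebesgue_on_bounded[OF \<Omega>])
  interpret LW: pair_sigma_finite "lebesgue_on \<Omega>" sphere_measure ..
  have Pm: "{z \<in> space (lebesgue_on \<Omega> \<Otimes>\<^sub>M sphere_measure). P z} \<in> sets (lebesgue_on \<Omega> \<Otimes>\<^sub>M sphere_measure)"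
    using phase_measurable[OF P, of \<Omega>] unfolding phase_measure_def by (simp add: pred_def)
  have "AE w in sphere_measure. AE x in lebesgue_on \<Omega>. P (x, w)"
    using AE by (rule eventually_mono) (use \<Omega> in \<open>auto intro!: AE_lebesgue_on_of_lborel\<close>)
  then have "AE x in lebesgue_on \<Omega>. AE w in sphere_measure. P (x, w)"
    using LW.AE_commute[of "\<lambda>x w. P (x, w)"] Pm by simp
  then show ?thesis unfolding phase_measure_def using Pm by (intro LW.AE_pair_measure) auto
qed

section \<open>Averages along lines and over directions\<close>

lemma line_measurable:
  assumes h: "h \<in> borel_measurable (borel \<Otimes>\<^sub>M sphere_measure)"
  shows "(\<lambda>p. h (fst (fst p) - snd p *\<^sub>R snd (fst p), snd (fst p)))
    \<in> borel_measurable ((borel \<Otimes>\<^sub>M sphere_measure) \<Otimes>\<^sub>M borel)"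
proof -
  have [measurable]: "snd \<in> borel \<Otimes>\<^sub>M sphere_measure \<rightarrow>\<^sub>M borel"
    by (rule measurable_compose[OF measurable_snd measurable_sphere_measureI]) simp
  have "(\<lambda>p. (fst (fst p) - snd p *\<^sub>R snd (fst p), snd (fst p)))
      \<in> (borel \<Otimes>\<^sub>M sphere_measure) \<Otimes>\<^sub>M borel \<rightarrow>\<^sub>M borel \<Otimes>\<^sub>M sphere_measure"
  proof (rule measurable_Pair)
    show "(\<lambda>p. snd (fst p)) \<in> (borel \<Otimes>\<^sub>M sphere_measure) \<Otimes>\<^sub>M borel \<rightarrow>\<^sub>M sphere_measure"
      by (rule measurable_compose[OF measurable_fst measurable_snd])
  qed measurable
  from measurable_compose[OF this h] show ?thesis .
qed

text \<open>Flights are not stopped at the boundary. In the estimate of solutions h vanishes outside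
  \<Omega>, and what remains are plain translations, under which Lebesgue measure is
  invariant.\<close>

definition line_avg :: "real \<Rightarrow> ((real^3) \<times> (real^3) \<Rightarrow> ennreal) \<Rightarrow> (real^3) \<times> (real^3) \<Rightarrow> ennreal" where
  "line_avg \<epsilon> h z = (\<integral>\<^sup>+s. h (fst z - s *\<^sub>R snd z, snd z) \<partial>exp_law \<epsilon>)"

lemma line_avg_measurable:
  assumes e: "0 < \<epsilon>" and h: "h \<in> borel_measurable (borel \<Otimes>\<^sub>M sphere_measure)"
  shows "line_avg \<epsilon> h \<in> borel_measurable (borel \<Otimes>\<^sub>M sphere_measure)"
proof -
  interpret E: prob_space "exp_law \<epsilon>" by (rule prob_space_exp_law[OF e])
  have "(\<lambda>p. h (fst (fst p) - snd p *\<^sub>R snd (fst p), snd (fst p)))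
    \<in> borel_measurable ((borel \<Otimes>\<^sub>M sphere_measure) \<Otimes>\<^sub>M exp_law \<epsilon>)"
    using line_measurable[OF h] by (simp cong: measurable_cong_sets sets_pair_measure_cong)
  then show ?thesis unfolding line_avg_def[abs_def]
    by (intro E.borel_measurable_nn_integral) (simp add: split_beta')
qed

lemma line_measurable_fixed:
  assumes h: "h \<in> borel_measurable (borel \<Otimes>\<^sub>M sphere_measure)" and w: "w \<in> sphere 0 1"
  shows "(\<lambda>s. h (x - s *\<^sub>R w, w)) \<in> borel_measurable borel"
proof -
  have "(\<lambda>s. (x - s *\<^sub>R w, w)) \<in> borel \<rightarrow>\<^sub>M borel \<Otimes>\<^sub>M sphere_measure"
    using w by (intro measurable_Pair) (auto simp: space_sphere_measure)
  from measurable_compose[OF this h] show ?thesis .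
qed

lemma slice_measurable:
  assumes h: "h \<in> borel_measurable (borel \<Otimes>\<^sub>M sphere_measure)" and w: "w \<in> sphere 0 1"
  shows "(\<lambda>x. h (x, w)) \<in> borel_measurable borel"
proof -
  have "(\<lambda>x. (x, w)) \<in> borel \<rightarrow>\<^sub>M borel \<Otimes>\<^sub>M sphere_measure"
    using w by (intro measurable_Pair) (auto simp: space_sphere_measure)
  from measurable_compose[OF this h] show ?thesis .
qed

text \<open>Jensen's inequality for the probability measure \<open>exp_law\<close>.\<close>

lemma line_avg_square_le:
  assumes e: "0 < \<epsilon>" and h: "h \<in> borel_measurable (borel \<Otimes>\<^sub>M sphere_measure)" and w: "w \<in> sphere 0 1"
  shows "(line_avg \<epsilon> h (x, w))\<^sup>2 \<le> line_avg \<epsilon> (\<lambda>z. (h z)\<^sup>2) (x, w)"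
proof -
  interpret E: prob_space "exp_law \<epsilon>" by (rule prob_space_exp_law[OF e])
  have "(\<lambda>s. h (x - s *\<^sub>R w, w)) \<in> borel_measurable (exp_law \<epsilon>)"
    using line_measurable_fixed[OF h w] by simp
  from nn_integral_square_le[OF this, of 1] show ?thesis
    using E.emeasure_space_1 by (simp add: line_avg_def)
qed

lemma nn_integral_line_avg:
  assumes e: "0 < \<epsilon>" and h: "h \<in> borel_measurable (borel \<Otimes>\<^sub>M sphere_measure)" and w: "w \<in> sphere 0 1"
  shows "(\<integral>\<^sup>+x. line_avg \<epsilon> h (x, w) \<partial>lborel) = (\<integral>\<^sup>+x. h (x, w) \<partial>lborel)"
proof -
  interpret E: prob_space "exp_law \<epsilon>" by (rule prob_space_exp_law[OF e])
  interpret LE: pair_sigma_finite "lborel :: (real^3) measure" "exp_law \<epsilon>" ..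
  have [measurable]: "(\<lambda>x. h (x, w)) \<in> borel_measurable borel" by (rule slice_measurable[OF h w])
  have "(\<integral>\<^sup>+x. line_avg \<epsilon> h (x, w) \<partial>lborel) = (\<integral>\<^sup>+x. (\<integral>\<^sup>+s. (\<lambda>x. h (x, w)) (x - s *\<^sub>R w) \<partial>exp_law \<epsilon>) \<partial>lborel)"
    by (simp add: line_avg_def)
  also have "\<dots> = (\<integral>\<^sup>+s. (\<integral>\<^sup>+x. (\<lambda>x. h (x, w)) (x - s *\<^sub>R w) \<partial>lborel) \<partial>exp_law \<epsilon>)"
    by (rule LE.Fubini'[symmetric]) measurable
  also have "\<dots> = (\<integral>\<^sup>+s. (\<integral>\<^sup>+x. h (x, w) \<partial>lborel) \<partial>exp_law \<epsilon>)"
    by (intro nn_integral_cong nn_integral_lborel_translate) measurable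
  also have "\<dots> = (\<integral>\<^sup>+x. h (x, w) \<partial>lborel)" using E.emeasure_space_1 by simp
  finally show ?thesis .
qed

text \<open>Normalised by 4 pi, as \<open>avg\<close> is. The total mass of
  \<open>sphere_measure\<close> enters through its upper bound 4 pi, so a constant is averaged to at
  most itself.\<close>

definition sphere_avg :: "(real^3 \<Rightarrow> ennreal) \<Rightarrow> ennreal" where
  "sphere_avg p = ennreal (1 / (4 * pi)) * (\<integral>\<^sup>+w. p w \<partial>sphere_measure)"

lemma four_pi_cancel: "ennreal (1 / (4 * pi)) * ennreal (4 * pi) = 1"
  by (subst ennreal_mult[symmetric]) auto

lemma sphere_avg_const_le: "sphere_avg (\<lambda>_. c) \<le> c"
proof -
  have "sphere_avg (\<lambda>_. c) \<le> ennreal (1 / (4 * pi)) * (c * ennreal (4 * pi))"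
    unfolding sphere_avg_def nn_integral_const by (intro mult_left_mono emeasure_sphere_measure_le) auto
  also have "\<dots> = c * (ennreal (1 / (4 * pi)) * ennreal (4 * pi))" by (simp only: mult_ac)
  finally show ?thesis by (simp add: four_pi_cancel)
qed

lemma sphere_avg_mono_AE: "AE w in sphere_measure. p w \<le> q w \<Longrightarrow> sphere_avg p \<le> sphere_avg q"
  unfolding sphere_avg_def by (intro mult_left_mono nn_integral_mono_AE) auto

lemma sphere_avg_square_le:
  assumes p: "p \<in> borel_measurable sphere_measure"
  shows "(sphere_avg p)\<^sup>2 \<le> (\<integral>\<^sup>+w. (p w)\<^sup>2 \<partial>sphere_measure)"
proof -
  let ?c = "ennreal (1 / (4 * pi))"
  have "(sphere_avg p)\<^sup>2 = ?c\<^sup>2 * (\<integral>\<^sup>+w. p w \<partial>sphere_measure)\<^sup>2"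
    by (simp add: sphere_avg_def power_mult_distrib)
  also have "\<dots> \<le> ?c\<^sup>2 * (ennreal (4 * pi) * (\<integral>\<^sup>+w. (p w)\<^sup>2 \<partial>sphere_measure))"
    by (intro mult_left_mono nn_integral_square_le[OF p emeasure_sphere_measure_le]) simp
  also have "\<dots> = ?c * (?c * ennreal (4 * pi)) * (\<integral>\<^sup>+w. (p w)\<^sup>2 \<partial>sphere_measure)"
    by (simp only: power2_eq_square mult_ac)
  also have "\<dots> = ?c * (\<integral>\<^sup>+w. (p w)\<^sup>2 \<partial>sphere_measure)" by (simp add: four_pi_cancel)
  also have "\<dots> \<le> 1 * (\<integral>\<^sup>+w. (p w)\<^sup>2 \<partial>sphere_measure)"
  proof (intro mult_right_mono)
    have "1 / (4 * pi) \<le> 1" using pi_ge_two by (simp add: divide_le_eq)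
    then show "?c \<le> 1" using ennreal_leI by fastforce
  qed simp
  finally show ?thesis by simp
qed

text \<open>Where u x is not integrable, the Bochner integral is 0 by convention and the bound is
  trivial.\<close>

lemma avg_le_sphere_avg: "ennreal \<bar>avg u x\<bar> \<le> sphere_avg (\<lambda>w. ennreal \<bar>u x w\<bar>)"
proof -
  have "ennreal \<bar>\<integral>w. u x w \<partial>sphere_measure\<bar> \<le> (\<integral>\<^sup>+w. ennreal \<bar>u x w\<bar> \<partial>sphere_measure)"
  proof (cases "integrable sphere_measure (u x)")
    case True
    then show ?thesis using integral_norm_bound_ennreal[OF True] by simp
  qed (simp add: not_integrable_integral_eq)
  then have "ennreal (1 / (4 * pi)) * ennreal \<bar>\<integral>w. u x w \<partial>sphere_measure\<bar> \<le> sphere_avg (\<lambda>w. ennreal \<bar>u x w\<bar>)"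
    unfolding sphere_avg_def by (rule mult_left_mono) simp
  moreover have "ennreal \<bar>avg u x\<bar> = ennreal (1 / (4 * pi)) * ennreal \<bar>\<integral>w. u x w \<partial>sphere_measure\<bar>"
    by (subst ennreal_mult[symmetric]) (auto simp: avg_def abs_mult)
  ultimately show ?thesis by simp
qed

lemma sphere_line_avg_measurable:
  assumes e: "0 < \<epsilon>" and h: "h \<in> borel_measurable (borel \<Otimes>\<^sub>M sphere_measure)"
  shows "(\<lambda>x. sphere_avg (\<lambda>w. line_avg \<epsilon> h (x, w))) \<in> borel_measurable borel"
proof -
  interpret W: finite_measure sphere_measure by (rule finite_measure_sphere_measure)
  have "(\<lambda>x. \<integral>\<^sup>+w. line_avg \<epsilon> h (x, w) \<partial>sphere_measure) \<in> borel_measurable borel"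
    using line_avg_measurable[OF e h] by (intro W.borel_measurable_nn_integral) simp
  then show ?thesis unfolding sphere_avg_def by measurable
qed

lemma Pair_sphere_measurable:
  "h \<in> borel_measurable (borel \<Otimes>\<^sub>M sphere_measure) \<Longrightarrow> (\<lambda>w. h (x, w)) \<in> borel_measurable sphere_measure"
  by (rule measurable_compose[OF measurable_Pair1']) auto

text \<open>Jensen over directions and over path lengths, then Fubini: for each direction,
  translations along it preserve the L^2 norm.\<close>

lemma sphere_line_avg_L2:
  assumes e: "0 < \<epsilon>" and h: "h \<in> borel_measurable (borel \<Otimes>\<^sub>M sphere_measure)"
  shows "(\<integral>\<^sup>+x. (sphere_avg (\<lambda>w. line_avg \<epsilon> h (x, w)))\<^sup>2 \<partial>lborel)
    \<le> (\<integral>\<^sup>+x. \<integral>\<^sup>+w. (h (x, w))\<^sup>2 \<partial>sphere_measure \<partial>lborel)"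
proof -
  interpret W: finite_measure sphere_measure by (rule finite_measure_sphere_measure)
  interpret LW: pair_sigma_finite "lborel :: (real^3) measure" sphere_measure ..
  have h2: "(\<lambda>z. (h z)\<^sup>2) \<in> borel_measurable (borel \<Otimes>\<^sub>M sphere_measure)" using h by measurable
  have lb: "borel_measurable ((lborel :: (real^3) measure) \<Otimes>\<^sub>M sphere_measure) = borel_measurable (borel \<Otimes>\<^sub>M sphere_measure)"
    by (rule measurable_cong_sets) (auto intro: sets_pair_measure_cong)
  have "(\<integral>\<^sup>+x. (sphere_avg (\<lambda>w. line_avg \<epsilon> h (x, w)))\<^sup>2 \<partial>lborel)
      \<le> (\<integral>\<^sup>+x. \<integral>\<^sup>+w. line_avg \<epsilon> (\<lambda>z. (h z)\<^sup>2) (x, w) \<partial>sphere_measure \<partial>lborel)"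
  proof (rule nn_integral_mono)
    fix x
    have "(sphere_avg (\<lambda>w. line_avg \<epsilon> h (x, w)))\<^sup>2 \<le> (\<integral>\<^sup>+w. (line_avg \<epsilon> h (x, w))\<^sup>2 \<partial>sphere_measure)"
      by (intro sphere_avg_square_le Pair_sphere_measurable line_avg_measurable e h)
    also have "\<dots> \<le> (\<integral>\<^sup>+w. line_avg \<epsilon> (\<lambda>z. (h z)\<^sup>2) (x, w) \<partial>sphere_measure)"
      by (intro nn_integral_mono line_avg_square_le e h) (simp add: space_sphere_measure)
    finally show "(sphere_avg (\<lambda>w. line_avg \<epsilon> h (x, w)))\<^sup>2 \<le> (\<integral>\<^sup>+w. line_avg \<epsilon> (\<lambda>z. (h z)\<^sup>2) (x, w) \<partial>sphere_measure)" .
  qed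
  also have "\<dots> = (\<integral>\<^sup>+w. \<integral>\<^sup>+x. line_avg \<epsilon> (\<lambda>z. (h z)\<^sup>2) (x, w) \<partial>lborel \<partial>sphere_measure)"
    by (rule LW.Fubini'[symmetric]) (simp add: lb split_beta' line_avg_measurable[OF e h2])
  also have "\<dots> = (\<integral>\<^sup>+w. \<integral>\<^sup>+x. (h (x, w))\<^sup>2 \<partial>lborel \<partial>sphere_measure)"
    by (intro nn_integral_cong nn_integral_line_avg e h2) (simp add: space_sphere_measure)
  also have "\<dots> = (\<integral>\<^sup>+x. \<integral>\<^sup>+w. (h (x, w))\<^sup>2 \<partial>sphere_measure \<partial>lborel)"
    by (rule LW.Fubini') (simp add: lb split_beta' h2)
  finally show ?thesis .
qed

section \<open>The uniform bound\<close>

text \<open>In the interior the solution exceeds the boundary bound $G$ only through scattering: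
  a particle carries the value $G$ until it either exits or scatters, so only the excess
  $W = (|\bar u| - G)^+$ and the source enter the line average.\<close>

lemma solution_line_bound:
  fixes \<Omega> :: "(real^3) set"
  assumes \<Omega>: "open \<Omega>" "convex \<Omega>" "bounded \<Omega>" and e: "0 < \<epsilon>" and G: "0 \<le> G"
    and sol: "AE z in phase_measure \<Omega>.
        (let x = fst z; w = snd z; \<tau> = back_exit \<Omega> x w;
             F = (\<lambda>s. exp (- s / \<epsilon>) * (avg u (x - s *\<^sub>R w) + S (x - s *\<^sub>R w) w))
         in F integrable_on {0..\<tau>} \<and>
            u x w = exp (- \<tau> / \<epsilon>) * g (x - \<tau> *\<^sub>R w) w + (1 / \<epsilon>) * integral {0..\<tau>} F)"
    and g: "AE z in phase_measure \<Omega>. \<bar>g (fst z - back_exit \<Omega> (fst z) (snd z) *\<^sub>R snd z) (snd z)\<bar> \<le> G"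
    and N: "N \<in> null_sets lborel"
    and h: "h \<in> borel_measurable (borel \<Otimes>\<^sub>M sphere_measure)" "\<And>z. 0 \<le> h z"
    and bd: "\<And>x w. x \<in> \<Omega> - N \<Longrightarrow> w \<in> sphere 0 1 \<Longrightarrow> \<bar>avg u x + S x w\<bar> \<le> G + h (x, w)"
  shows "AE z in phase_measure \<Omega>. ennreal \<bar>u (fst z) (snd z)\<bar> \<le> ennreal G + line_avg \<epsilon> (\<lambda>z. ennreal (h z)) z"
proof -
  have Nb [measurable]: "N \<in> sets borel" using N by auto
  \<comment> \<open>Almost every characteristic meets N only in a null set of times, so the
    pointwise bound on the integrand may be used along it.\<close>
  have "AE z in phase_measure \<Omega>. (\<integral>\<^sup>+s. indicator N (fst z - s *\<^sub>R snd z) \<partial>lborel) = (0 :: ennreal)"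
  proof (rule AE_phase_measureI[OF \<Omega>(1,3)])
    have "(\<lambda>p. indicator N (fst (fst p) - snd p *\<^sub>R snd (fst p)) :: ennreal)
        \<in> borel_measurable ((borel \<Otimes>\<^sub>M sphere_measure) \<Otimes>\<^sub>M lborel)"
    proof -
      have "(\<lambda>z. indicator N (fst z) :: ennreal) \<in> borel_measurable (borel \<Otimes>\<^sub>M sphere_measure)" by measurable
      from line_measurable[OF this] show ?thesis by (simp cong: measurable_cong_sets sets_pair_measure_cong)
    qed
    then have "(\<lambda>z. (\<integral>\<^sup>+s. indicator N (fst z - s *\<^sub>R snd z) \<partial>lborel) :: ennreal) \<in> borel_measurable (borel \<Otimes>\<^sub>M sphere_measure)"
      by (intro lborel.borel_measurable_nn_integral) (simp add: split_beta')
    then show "Measurable.pred (borel \<Otimes>\<^sub>M sphere_measure) (\<lambda>z. (\<integral>\<^sup>+s. indicator N (fst z - s *\<^sub>R snd z) \<partial>lborel) = (0 :: ennreal))"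
      by measurable
    show "AE w in sphere_measure. AE x in lborel. (\<integral>\<^sup>+s. indicator N (fst (x, w) - s *\<^sub>R snd (x, w)) \<partial>lborel) = (0 :: ennreal)"
      using AE_line_null[OF N] by simp
  qed
  then show ?thesis using sol g AE_space
  proof eventually_elim
    case (elim z)
    obtain x w where z: "z = (x, w)" by (cases z)
    have x: "x \<in> \<Omega>" and w: "norm w = 1" using elim(4) by (auto simp: z space_phase_measure)
    let ?\<tau> = "back_exit \<Omega> x w"
    let ?F = "\<lambda>s. exp (- s / \<epsilon>) * (avg u (x - s *\<^sub>R w) + S (x - s *\<^sub>R w) w)"
    have F: "?F integrable_on {0..?\<tau>}"
      and u: "u x w = exp (- ?\<tau> / \<epsilon>) * g (x - ?\<tau> *\<^sub>R w) w + (1 / \<epsilon>) * integral {0..?\<tau>} ?F"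
      using elim(2) by (auto simp: z Let_def)
    \<comment> \<open>The exit time is added because the point reached then lies outside \<Omega>,
      where nothing is assumed about the integrand.\<close>
    define N' where "N' = (\<lambda>s. x - s *\<^sub>R w) -` N \<union> {?\<tau>}"
    have neg: "negligible N'"
    proof -
      have b: "(\<lambda>s. x - s *\<^sub>R w) -` N \<in> sets borel"
        using measurable_sets[of "\<lambda>s. x - s *\<^sub>R w" borel borel N] by simp
      have "emeasure lborel ((\<lambda>s. x - s *\<^sub>R w) -` N) = (\<integral>\<^sup>+s. indicator ((\<lambda>s. x - s *\<^sub>R w) -` N) s \<partial>lborel)"
        using b by simp
      also have "\<dots> = (\<integral>\<^sup>+s. indicator N (x - s *\<^sub>R w) \<partial>lborel)" by (intro nn_integral_cong) (simp add: indicator_def)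
      also have "\<dots> = 0" using elim(1) by (simp add: z)
      finally have "(\<lambda>s. x - s *\<^sub>R w) -` N \<in> null_sets lborel" using b by auto
      then have "negligible ((\<lambda>s. x - s *\<^sub>R w) -` N)"
        unfolding negligible_iff_null_sets by (rule null_sets_completionI)
      then show ?thesis unfolding N'_def by simp
    qed
    have \<tau>: "0 < ?\<tau>" by (rule back_exit_pos[OF \<Omega> x w])
    have "ennreal \<bar>exp (- ?\<tau> / \<epsilon>) * g (x - ?\<tau> *\<^sub>R w) w + (1 / \<epsilon>) * integral {0..?\<tau>} ?F\<bar>
      \<le> ennreal G + (\<integral>\<^sup>+s. ennreal (h (x - s *\<^sub>R w, w)) \<partial>exp_law \<epsilon>)"
    proof (rule exp_line_estimate[OF e less_imp_le[OF \<tau>] G _ _ _ F neg])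
      show "\<bar>g (x - ?\<tau> *\<^sub>R w) w\<bar> \<le> G" using elim(3) by (simp add: z)
      show "(\<lambda>s. h (x - s *\<^sub>R w, w)) \<in> borel_measurable borel"
        using w by (intro line_measurable_fixed h(1)) simp
      show "0 \<le> h (x - s *\<^sub>R w, w)" for s by (rule h(2))
      fix s assume s: "s \<in> {0..?\<tau>} - N'"
      then have "x - s *\<^sub>R w \<in> \<Omega> - N"
        using less_back_exit_iff[OF \<Omega> x w, of s] by (auto simp: N'_def)
      then have "\<bar>avg u (x - s *\<^sub>R w) + S (x - s *\<^sub>R w) w\<bar> \<le> G + h (x - s *\<^sub>R w, w)" using w by (intro bd) auto
      then show "\<bar>?F s\<bar> \<le> exp (- s / \<epsilon>) * (G + h (x - s *\<^sub>R w, w))" by (simp add: abs_mult)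
    qed
    then show ?case unfolding z u[symmetric] by (simp add: line_avg_def)
  qed
qed

text \<open>The average inherits measurability only for the completed measure, whereas kernel
  integrals and line averages are formed with Borel functions.\<close>

lemma avg_borel_representative:
  assumes \<Omega>: "\<Omega> \<in> sets borel" and u: "(\<lambda>(x, w). u x w) \<in> borel_measurable (phase_measure \<Omega>)"
  obtains V where "V \<in> borel_measurable borel" "AE x in lborel. x \<in> \<Omega> \<longrightarrow> V x = avg u x"
proof -
  interpret W: finite_measure sphere_measure by (rule finite_measure_sphere_measure)
  have "(\<lambda>x. \<integral>w. u x w \<partial>sphere_measure) \<in> borel_measurable (lebesgue_on \<Omega>)"
    using u unfolding phase_measure_def by (intro W.borel_measurable_lebesgue_integral)
  then have "avg u \<in> borel_measurable (lebesgue_on \<Omega>)" unfolding avg_def[abs_def] by measurable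
  then have "(\<lambda>x. indicator \<Omega> x *\<^sub>R avg u x) \<in> borel_measurable lebesgue"
    using \<Omega> by (subst (asm) borel_measurable_restrict_space_iff) auto
  then obtain V where "V \<in> borel_measurable lborel" "AE x in lborel. indicator \<Omega> x *\<^sub>R avg u x = V x"
    using completion_ex_borel_measurable_real by blast
  then show ?thesis by (intro that[of V]) (auto elim!: eventually_mono)
qed

text \<open>The line estimate is used twice. Averaged over directions it makes the excess of the
  average a subsolution for \<open>kern\<close>; once that excess is bounded, the estimate itself
  bounds u, since almost-everywhere bounds survive averaging along lines. The three summands come
  from the boundary data, the excess and the source.\<close>

lemma sup_bound_of_solution:
  fixes \<Omega> :: "(real^3) set"
  assumes \<Omega>: "open \<Omega>" "convex \<Omega>" "bounded \<Omega>" "\<Omega> \<noteq> {}" "C3_boundary \<Omega>"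
    and R: "\<And>x. x \<in> \<Omega> \<Longrightarrow> norm x \<le> R" and A: "A = 1 + (12 * R\<^sup>2 + 24) / 4 + R ^ 4"
    and e: "0 < \<epsilon>" "\<epsilon> \<le> 1"
    and S2: "memL2 (phase_measure \<Omega>) (\<lambda>(x, w). S x w)"
    and m: "AE z in phase_measure \<Omega>. \<bar>S (fst z) (snd z)\<bar> \<le> m" "0 \<le> m"
    and G: "AE z in Gamma_minus_measure \<Omega>. \<bar>g (fst z) (snd z)\<bar> \<le> G" "0 \<le> G"
    and sol: "is_solution \<Omega> \<epsilon> S g u"
  defines "q \<equiv> L2norm (phase_measure \<Omega>) (\<lambda>(x, w). S x w)"
  shows "AE z in phase_measure \<Omega>. \<bar>u (fst z) (snd z)\<bar> \<le> G + (2 * (2 * A * \<epsilon> powr (-7/2) * q + m) + m)"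
proof -
  let ?P = "phase_measure \<Omega>"
  interpret W: finite_measure sphere_measure by (rule finite_measure_sphere_measure)
  interpret L: finite_measure "lebesgue_on \<Omega>" by (rule finite_measure_lebesgue_on_bounded[OF \<Omega>(1,3)])
  interpret LW: pair_sigma_finite "lebesgue_on \<Omega>" sphere_measure ..
  interpret BW: pair_sigma_finite "lborel :: (real^3) measure" sphere_measure ..
  have \<Omega>b [measurable]: "\<Omega> \<in> sets borel" using \<Omega>(1) by simp
  have u2: "memL2 ?P (\<lambda>(x, w). u x w)"
    and mild: "AE z in ?P.
        (let x = fst z; w = snd z; \<tau> = back_exit \<Omega> x w;
             F = (\<lambda>s. exp (- s / \<epsilon>) * (avg u (x - s *\<^sub>R w) + S (x - s *\<^sub>R w) w))
         in F integrable_on {0..\<tau>} \<and>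
            u x w = exp (- \<tau> / \<epsilon>) * g (x - \<tau> *\<^sub>R w) w + (1 / \<epsilon>) * integral {0..\<tau>} F)"
    using sol by (auto simp: is_solution_def)
  have um: "(\<lambda>(x, w). u x w) \<in> borel_measurable ?P" and Sm: "(\<lambda>(x, w). S x w) \<in> borel_measurable ?P"
    using u2 S2 by (auto simp: memL2_def)
  obtain V where V [measurable]: "V \<in> borel_measurable borel" and Vu: "AE x in lborel. x \<in> \<Omega> \<longrightarrow> V x = avg u x"
    by (rule avg_borel_representative[OF \<Omega>b um]) (rule that)
  obtain N1 where N1: "N1 \<in> null_sets lborel"
      and S'm: "(\<lambda>z. if fst z \<in> \<Omega> - N1 then (case z of (x, w) \<Rightarrow> S x w) else 0) \<in> borel_measurable (borel \<Otimes>\<^sub>M sphere_measure)"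
    using pair_lebesgue_on_fun_mod_null[OF \<Omega>b Sm[unfolded phase_measure_def]] by blast
  obtain N2 where N2: "N2 \<in> null_sets lborel" "{x \<in> space lborel. \<not> (x \<in> \<Omega> \<longrightarrow> V x = avg u x)} \<subseteq> N2"
  proof -
    obtain N2 where "{x \<in> space lborel. \<not> (x \<in> \<Omega> \<longrightarrow> V x = avg u x)} \<subseteq> N2"
        "emeasure lborel N2 = 0" "N2 \<in> sets lborel"
      using Vu by (rule AE_E)
    then show ?thesis by (intro that[of N2] null_setsI)
  qed
  define N where "N = N1 \<union> N2"
  have N: "N \<in> null_sets lborel" unfolding N_def using N1 N2(1) by (rule null_sets.Un)
  have VN: "V x = avg u x" if "x \<in> \<Omega> - N" for x using N2(2) that by (auto simp: N_def)
  \<comment> \<open>Extension by zero lets the kernel integral run over all of R^3.\<close>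
  define Wr where "Wr x = (if x \<in> \<Omega> then max 0 (\<bar>V x\<bar> - G) else 0)" for x
  define Sr where "Sr z = \<bar>if fst z \<in> \<Omega> - N1 then (case z of (x, w) \<Rightarrow> S x w) else 0\<bar>" for z
  have Wm [measurable]: "Wr \<in> borel_measurable borel" unfolding Wr_def[abs_def] by measurable
  have Srm [measurable]: "Sr \<in> borel_measurable (borel \<Otimes>\<^sub>M sphere_measure)"
    unfolding Sr_def[abs_def] using S'm by measurable
  have Wr0: "0 \<le> Wr x" "x \<notin> \<Omega> \<Longrightarrow> Wr x = 0" for x by (auto simp: Wr_def)
  have Sr0: "0 \<le> Sr z" for z by (simp add: Sr_def)
  define f where "f x = sphere_avg (\<lambda>w. line_avg \<epsilon> (\<lambda>z. ennreal (Sr z)) (x, w))" for x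
  have Sre: "(\<lambda>z. ennreal (Sr z)) \<in> borel_measurable (borel \<Otimes>\<^sub>M sphere_measure)" by measurable
  have Wre: "(\<lambda>z. ennreal (Wr (fst z))) \<in> borel_measurable (borel \<Otimes>\<^sub>M sphere_measure)" by measurable
  have fm [measurable]: "f \<in> borel_measurable borel"
    unfolding f_def[abs_def] by (rule sphere_line_avg_measurable[OF e(1) Sre])

  have trace: "AE z in ?P. \<bar>g (fst z - back_exit \<Omega> (fst z) (snd z) *\<^sub>R snd z) (snd z)\<bar> \<le> G"
    using AE_boundary_trace[OF \<Omega> G(1)] by simp
  have line0: "AE z in ?P. ennreal \<bar>u (fst z) (snd z)\<bar> \<le> ennreal G + line_avg \<epsilon> (\<lambda>z. ennreal (Wr (fst z) + Sr z)) z"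
  proof (rule solution_line_bound[OF \<Omega>(1-3) e(1) G(2) mild trace N])
    show "(\<lambda>z. Wr (fst z) + Sr z) \<in> borel_measurable (borel \<Otimes>\<^sub>M sphere_measure)" by measurable
    show "0 \<le> Wr (fst z) + Sr z" for z using Wr0(1) Sr0 by (rule add_nonneg_nonneg)
    fix x w :: "real^3" assume x: "x \<in> \<Omega> - N"
    have "\<bar>avg u x\<bar> \<le> G + Wr x" using x VN[OF x] by (auto simp: Wr_def)
    moreover have "\<bar>S x w\<bar> = Sr (x, w)" using x by (simp add: Sr_def N_def)
    ultimately show "\<bar>avg u x + S x w\<bar> \<le> G + (Wr (fst (x, w)) + Sr (x, w))"
      using abs_triangle_ineq[of "avg u x" "S x w"] by simp
  qed
  have split: "line_avg \<epsilon> (\<lambda>z. ennreal (Wr (fst z) + Sr z)) (x, w)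
      = line_avg \<epsilon> (\<lambda>z. ennreal (Wr (fst z))) (x, w) + line_avg \<epsilon> (\<lambda>z. ennreal (Sr z)) (x, w)"
    if w: "w \<in> sphere 0 1" for x w
  proof -
    have 1: "(\<lambda>s. ennreal (Wr (x - s *\<^sub>R w))) \<in> borel_measurable (exp_law \<epsilon>)" by measurable
    have 2: "(\<lambda>s. ennreal (Sr (x - s *\<^sub>R w, w))) \<in> borel_measurable (exp_law \<epsilon>)"
      using line_measurable_fixed[OF Sre w] by simp
    show ?thesis unfolding line_avg_def fst_conv snd_conv
      using Wr0(1) Sr0 nn_integral_add[OF 1 2] by simp
  qed
  have line: "AE z in ?P. ennreal \<bar>u (fst z) (snd z)\<bar>
      \<le> ennreal G + (line_avg \<epsilon> (\<lambda>z. ennreal (Wr (fst z))) z + line_avg \<epsilon> (\<lambda>z. ennreal (Sr z)) z)"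
    using line0 AE_space
  proof eventually_elim
    case (elim z)
    obtain x w where z: "z = (x, w)" by (cases z)
    then have "w \<in> sphere 0 1" using elim(2) by (simp add: space_phase_measure)
    from split[OF this] elim(1) show ?case unfolding z by simp
  qed

  have sub: "AE x in lborel. x \<in> \<Omega> \<longrightarrow> ennreal (Wr x) \<le> (\<integral>\<^sup>+y. ennreal (kern \<epsilon> (x - y)) * ennreal (Wr y) \<partial>lborel) + f x"
  proof -
    have "AE x in lebesgue_on \<Omega>. AE w in sphere_measure. ennreal \<bar>u x w\<bar>
      \<le> ennreal G + (line_avg \<epsilon> (\<lambda>z. ennreal (Wr (fst z))) (x, w) + line_avg \<epsilon> (\<lambda>z. ennreal (Sr z)) (x, w))"
      using LW.AE_pair[OF line[unfolded phase_measure_def]] by simp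
    then have "AE x in lborel. x \<in> \<Omega> \<longrightarrow> (AE w in sphere_measure. ennreal \<bar>u x w\<bar>
      \<le> ennreal G + (line_avg \<epsilon> (\<lambda>z. ennreal (Wr (fst z))) (x, w) + line_avg \<epsilon> (\<lambda>z. ennreal (Sr z)) (x, w)))"
      by (rule AE_lborel_of_lebesgue_on[OF \<Omega>b])
    then show ?thesis using Vu
    proof eventually_elim
      case (elim x)
      show ?case
      proof
        assume x: "x \<in> \<Omega>"
        let ?a = "\<lambda>w. line_avg \<epsilon> (\<lambda>z. ennreal (Wr (fst z))) (x, w)" and ?b = "\<lambda>w. line_avg \<epsilon> (\<lambda>z. ennreal (Sr z)) (x, w)"
        have am: "?a \<in> borel_measurable sphere_measure" "?b \<in> borel_measurable sphere_measure"
          by (intro Pair_sphere_measurable line_avg_measurable e(1) Wre Sre)+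
        have "ennreal \<bar>V x\<bar> \<le> sphere_avg (\<lambda>w. ennreal \<bar>u x w\<bar>)"
          using elim(2) x avg_le_sphere_avg[of u x] by simp
        also have "\<dots> \<le> sphere_avg (\<lambda>w. ennreal G + (?a w + ?b w))"
          using elim(1) x by (intro sphere_avg_mono_AE) simp
        also have "\<dots> = sphere_avg (\<lambda>w. ennreal G) + (sphere_avg ?a + f x)"
          unfolding sphere_avg_def f_def using am by (simp add: nn_integral_add distrib_left)
        also have "\<dots> \<le> ennreal G + ((\<integral>\<^sup>+y. ennreal (kern \<epsilon> (x - y)) * ennreal (Wr y) \<partial>lborel) + f x)"
        proof (intro add_mono sphere_avg_const_le order_refl)
          have "sphere_avg ?a \<le> ennreal (1 / (4 * pi)) * (ennreal (4 * pi) * (\<integral>\<^sup>+y. ennreal (kern \<epsilon> (x - y)) * ennreal (Wr y) \<partial>lborel))"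
            unfolding sphere_avg_def line_avg_def fst_conv snd_conv
            by (intro mult_left_mono sphere_exp_law_le_kern e(1)) auto
          then show "sphere_avg ?a \<le> (\<integral>\<^sup>+y. ennreal (kern \<epsilon> (x - y)) * ennreal (Wr y) \<partial>lborel)"
            by (simp only: mult.assoc[symmetric] four_pi_cancel mult_1)
        qed
        finally have Vle: "ennreal \<bar>V x\<bar> \<le> ennreal G + ((\<integral>\<^sup>+y. ennreal (kern \<epsilon> (x - y)) * ennreal (Wr y) \<partial>lborel) + f x)" .
        show "ennreal (Wr x) \<le> (\<integral>\<^sup>+y. ennreal (kern \<epsilon> (x - y)) * ennreal (Wr y) \<partial>lborel) + f x"
        proof (cases "\<bar>V x\<bar> \<le> G")
          case True
          then show ?thesis by (simp add: Wr_def)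
        next
          case False
          \<comment> \<open>Where the excess is positive it splits off additively, and the finite G
            can then be cancelled in \<open>ennreal\<close>.\<close>
          then have "ennreal \<bar>V x\<bar> = ennreal G + ennreal (Wr x)"
            using x G(2) by (simp add: Wr_def flip: ennreal_plus)
          then have "ennreal G + ennreal (Wr x) \<le> ennreal G + ((\<integral>\<^sup>+y. ennreal (kern \<epsilon> (x - y)) * ennreal (Wr y) \<partial>lborel) + f x)"
            using Vle by simp
          then show ?thesis by (subst (asm) ennreal_add_left_cancel_le) auto
        qed
      qed
    qed
  qed

  have S_slice: "AE w in sphere_measure. AE x in lborel. Sr (x, w) \<le> m"
  proof -
    have Sm': "(\<lambda>z. S (fst z) (snd z)) \<in> borel_measurable (lebesgue_on \<Omega> \<Otimes>\<^sub>M sphere_measure)"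
      using Sm by (simp add: phase_measure_def split_beta')
    have pr: "{z \<in> space (lebesgue_on \<Omega> \<Otimes>\<^sub>M sphere_measure). \<bar>S (fst z) (snd z)\<bar> \<le> m} \<in> sets (lebesgue_on \<Omega> \<Otimes>\<^sub>M sphere_measure)"
      using Sm' by measurable
    have "AE x in lebesgue_on \<Omega>. AE w in sphere_measure. \<bar>S x w\<bar> \<le> m"
      using LW.AE_pair[OF m(1)[unfolded phase_measure_def]] by simp
    then have "AE w in sphere_measure. AE x in lebesgue_on \<Omega>. \<bar>S x w\<bar> \<le> m"
      using LW.AE_commute[of "\<lambda>x w. \<bar>S x w\<bar> \<le> m", OF pr] by simp
    then show ?thesis
    proof (rule eventually_mono)
      fix w assume "AE x in lebesgue_on \<Omega>. \<bar>S x w\<bar> \<le> m"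
      then have "AE x in lborel. x \<in> \<Omega> \<longrightarrow> \<bar>S x w\<bar> \<le> m" by (rule AE_lborel_of_lebesgue_on[OF \<Omega>b])
      then show "AE x in lborel. Sr (x, w) \<le> m" by (rule eventually_mono) (use m(2) in \<open>auto simp: Sr_def\<close>)
    qed
  qed
  have SL: "AE w in sphere_measure. AE x in lborel. line_avg \<epsilon> (\<lambda>z. ennreal (Sr z)) (x, w) \<le> ennreal m"
    using S_slice AE_space
  proof eventually_elim
    case (elim w)
    then have w: "w \<in> sphere 0 1" by (simp add: space_sphere_measure)
    have "AE x in lborel. ennreal (Sr (x, w)) \<le> ennreal m" using elim(1) by (rule eventually_mono) (rule ennreal_leI)
    from AE_exp_law_line_le[OF e(1) slice_measurable[OF Sre w] this, of w]
    show ?case by (simp add: line_avg_def)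
  qed
  have SL_pred: "Measurable.pred (borel \<Otimes>\<^sub>M sphere_measure) (\<lambda>z. line_avg \<epsilon> (\<lambda>z. ennreal (Sr z)) z \<le> ennreal m)"
    using line_avg_measurable[OF e(1) Sre] by measurable
  have f_le: "AE x in lborel. f x \<le> ennreal m"
  proof -
    have "{z \<in> space (lborel \<Otimes>\<^sub>M sphere_measure). line_avg \<epsilon> (\<lambda>z. ennreal (Sr z)) (fst z, snd z) \<le> ennreal m}
        \<in> sets (lborel \<Otimes>\<^sub>M sphere_measure)"
      using SL_pred by (simp add: pred_def space_pair_measure cong: sets_pair_measure_cong)
    then have "AE x in lborel. AE w in sphere_measure. line_avg \<epsilon> (\<lambda>z. ennreal (Sr z)) (x, w) \<le> ennreal m"
      using BW.AE_commute[of "\<lambda>x w. line_avg \<epsilon> (\<lambda>z. ennreal (Sr z)) (x, w) \<le> ennreal m"] SL by simp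
    then show ?thesis
    proof (rule eventually_mono)
      fix x assume "AE w in sphere_measure. line_avg \<epsilon> (\<lambda>z. ennreal (Sr z)) (x, w) \<le> ennreal m"
      then have "f x \<le> sphere_avg (\<lambda>_. ennreal m)" unfolding f_def by (rule sphere_avg_mono_AE)
      then show "f x \<le> ennreal m" using sphere_avg_const_le order_trans by blast
    qed
  qed

  have f_L2: "(\<integral>\<^sup>+x. (f x)\<^sup>2 \<partial>lborel) \<le> ennreal (q\<^sup>2)"
  proof -
    have "(\<integral>\<^sup>+x. (f x)\<^sup>2 \<partial>lborel) \<le> (\<integral>\<^sup>+x. \<integral>\<^sup>+w. (ennreal (Sr (x, w)))\<^sup>2 \<partial>sphere_measure \<partial>lborel)"
      unfolding f_def by (rule sphere_line_avg_L2[OF e(1) Sre])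
    also have "\<dots> = (\<integral>\<^sup>+x. \<integral>\<^sup>+w. (ennreal (Sr (x, w)))\<^sup>2 \<partial>sphere_measure \<partial>lebesgue_on \<Omega>)"
    proof (rule nn_integral_lebesgue_on_eq_lborel[OF \<Omega>b])
      show "(\<lambda>x. \<integral>\<^sup>+w. (ennreal (Sr (x, w)))\<^sup>2 \<partial>sphere_measure) \<in> borel_measurable borel"
        by (intro W.borel_measurable_nn_integral) (simp add: split_beta')
      show "(\<integral>\<^sup>+w. (ennreal (Sr (x, w)))\<^sup>2 \<partial>sphere_measure) = 0" if "x \<notin> \<Omega>" for x
        using that by (simp add: Sr_def)
    qed
    also have "\<dots> \<le> (\<integral>\<^sup>+x. \<integral>\<^sup>+w. ennreal ((S x w)\<^sup>2) \<partial>sphere_measure \<partial>lebesgue_on \<Omega>)"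
      by (intro nn_integral_mono) (auto simp: Sr_def ennreal_power)
    also have "\<dots> = L2sq ?P (\<lambda>(x, w). S x w)"
    proof -
      have "(\<lambda>z. ennreal ((case z of (x, w) \<Rightarrow> S x w)\<^sup>2)) \<in> borel_measurable (lebesgue_on \<Omega> \<Otimes>\<^sub>M sphere_measure)"
        using Sm unfolding phase_measure_def by measurable
      from W.nn_integral_fst[OF this] show ?thesis by (simp add: L2sq_def phase_measure_def)
    qed
    also have "\<dots> = ennreal (q\<^sup>2)"
      using S2 by (simp add: q_def L2norm_def memL2_def)
    finally show ?thesis .
  qed

  \<comment> \<open>Square integrability of u is part of the notion of solution; it supplies the
    finiteness on which the absorption in Schur's test rests.\<close>
  have W_L2: "(\<integral>\<^sup>+x. (ennreal (Wr x))\<^sup>2 \<partial>lborel) < \<top>"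
  proof -
    have "(\<integral>\<^sup>+x. (ennreal (Wr x))\<^sup>2 \<partial>lborel) = (\<integral>\<^sup>+x. (ennreal (Wr x))\<^sup>2 \<partial>lebesgue_on \<Omega>)"
      by (rule nn_integral_lebesgue_on_eq_lborel[OF \<Omega>b]) (auto simp: Wr_def)
    also have "\<dots> \<le> (\<integral>\<^sup>+x. \<integral>\<^sup>+w. ennreal ((u x w)\<^sup>2) \<partial>sphere_measure \<partial>lebesgue_on \<Omega>)"
    proof (rule nn_integral_mono_AE)
      have "AE x in lebesgue_on \<Omega>. V x = avg u x" by (rule AE_lebesgue_on_of_lborel[OF \<Omega>b Vu])
      then show "AE x in lebesgue_on \<Omega>. (ennreal (Wr x))\<^sup>2 \<le> (\<integral>\<^sup>+w. ennreal ((u x w)\<^sup>2) \<partial>sphere_measure)"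
        using AE_space
      proof eventually_elim
        case (elim x)
        then have x: "x \<in> space (lebesgue_on \<Omega>)" by simp
        have "(\<lambda>w. u x w) \<in> borel_measurable sphere_measure"
          using measurable_compose[OF measurable_Pair1'[OF x] um[unfolded phase_measure_def]] by simp
        then have pm: "(\<lambda>w. ennreal \<bar>u x w\<bar>) \<in> borel_measurable sphere_measure" by measurable
        have "Wr x \<le> \<bar>avg u x\<bar>" using elim(1) G(2) by (auto simp: Wr_def)
        then have "ennreal (Wr x) \<le> sphere_avg (\<lambda>w. ennreal \<bar>u x w\<bar>)"
          using avg_le_sphere_avg[of u x] ennreal_leI order_trans by blast
        then have "(ennreal (Wr x))\<^sup>2 \<le> (sphere_avg (\<lambda>w. ennreal \<bar>u x w\<bar>))\<^sup>2" by (intro power_mono) auto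
        also have "\<dots> \<le> (\<integral>\<^sup>+w. (ennreal \<bar>u x w\<bar>)\<^sup>2 \<partial>sphere_measure)" by (rule sphere_avg_square_le[OF pm])
        finally show ?case by (simp add: ennreal_power)
      qed
    qed
    also have "\<dots> = L2sq ?P (\<lambda>(x, w). u x w)"
    proof -
      have "(\<lambda>z. ennreal ((case z of (x, w) \<Rightarrow> u x w)\<^sup>2)) \<in> borel_measurable (lebesgue_on \<Omega> \<Otimes>\<^sub>M sphere_measure)"
        using um unfolding phase_measure_def by measurable
      from W.nn_integral_fst[OF this] show ?thesis by (simp add: L2sq_def phase_measure_def)
    qed
    also have "\<dots> < \<top>" using u2 by (simp add: memL2_def)
    finally show ?thesis .
  qed

  let ?B = "2 * (2 * A * \<epsilon> powr (-7/2) * q + m)"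
  have q0: "0 \<le> q" by (simp add: q_def L2norm_def)
  have W_le: "AE x in lborel. ennreal (Wr x) \<le> ennreal ?B"
  proof (rule kern_subsolution_bound[OF e R _ fm \<Omega>b A _ W_L2 sub f_le m(2) f_L2 q0])
    show "ennreal (Wr x) = 0" if "x \<notin> \<Omega>" for x using that by (simp add: Wr0)
  qed measurable
  have WL: "AE z in ?P. line_avg \<epsilon> (\<lambda>z. ennreal (Wr (fst z))) z \<le> ennreal ?B"
  proof (rule AE_phase_measureI[OF \<Omega>(1,3)])
    show "Measurable.pred (borel \<Otimes>\<^sub>M sphere_measure) (\<lambda>z. line_avg \<epsilon> (\<lambda>z. ennreal (Wr (fst z))) z \<le> ennreal ?B)"
      using line_avg_measurable[OF e(1) Wre] by measurable
    have "AE x in lborel. line_avg \<epsilon> (\<lambda>z. ennreal (Wr (fst z))) (x, w) \<le> ennreal ?B" for w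
      using AE_exp_law_line_le[OF e(1) _ W_le, of w] by (simp add: line_avg_def)
    then show "AE w in sphere_measure. AE x in lborel. line_avg \<epsilon> (\<lambda>z. ennreal (Wr (fst z))) (x, w) \<le> ennreal ?B"
      by simp
  qed
  have SLP: "AE z in ?P. line_avg \<epsilon> (\<lambda>z. ennreal (Sr z)) z \<le> ennreal m"
    by (rule AE_phase_measureI[OF \<Omega>(1,3) SL_pred SL])
  have A0: "0 \<le> A" unfolding A by (intro add_nonneg_nonneg) auto
  show ?thesis using line WL SLP
  proof eventually_elim
    case (elim z)
    have "ennreal \<bar>u (fst z) (snd z)\<bar> \<le> ennreal G + (ennreal ?B + ennreal m)"
      using elim(1) by (rule order_trans) (intro add_left_mono add_mono elim(2,3))
    also have "\<dots> = ennreal (G + (?B + m))"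
      using G(2) m(2) q0 A0 by (simp flip: ennreal_plus)
    finally show ?case using G(2) m(2) q0 A0 by (subst (asm) ennreal_le_iff) auto
  qed
qed

theorem theorem2p3:
  fixes \<Omega> :: "(real^3) set"
  assumes "open \<Omega>" and "convex \<Omega>" and "bounded \<Omega>" and "\<Omega> \<noteq> {}"
    and "C3_boundary \<Omega>"
  shows "\<exists>C > 0. \<exists>\<epsilon>0 > 0. \<forall>\<epsilon> S g u. 0 < \<epsilon> \<and> \<epsilon> < \<epsilon>0 \<longrightarrow>
           memL2 (phase_measure \<Omega>) (\<lambda>(x, w). S x w) \<longrightarrow>
           memLinf (phase_measure \<Omega>) (\<lambda>(x, w). S x w) \<longrightarrow>
           memL2 (Gamma_minus_weighted \<Omega>) (\<lambda>(x, w). g x w) \<longrightarrow>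
           memLinf (Gamma_minus_measure \<Omega>) (\<lambda>(x, w). g x w) \<longrightarrow>
           is_solution \<Omega> \<epsilon> S g u \<longrightarrow>
           Linf (phase_measure \<Omega>) (\<lambda>(x, w). u x w) \<le>
             ereal (C * (\<epsilon> powr (-7/2) * L2norm (phase_measure \<Omega>) (\<lambda>(x, w). S x w)
                       + real_of_ereal (Linf (phase_measure \<Omega>) (\<lambda>(x, w). S x w))
                       + \<epsilon> powr (-2) * L2norm (Gamma_minus_weighted \<Omega>) (\<lambda>(x, w). g x w)
                       + real_of_ereal (Linf (Gamma_minus_measure \<Omega>) (\<lambda>(x, w). g x w))))"
proof -
  obtain R where R: "\<And>x. x \<in> \<Omega> \<Longrightarrow> norm x \<le> R" using \<open>bounded \<Omega>\<close> unfolding bounded_iff by blast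
  define A where "A = 1 + (12 * R\<^sup>2 + 24) / 4 + R ^ 4"
  have A0: "0 \<le> A" unfolding A_def by (intro add_nonneg_nonneg) auto
  show ?thesis
  \<comment> \<open>The threshold 1 for \<epsilon> is the range of the barrier estimate. The
    preceding bound has coefficients 4 A and 3 on the two norms of S and 1 on the supremum of g,
    each at most 4 A + 3.\<close>
  proof (rule exI[of _ "4 * A + 3"], intro conjI exI[of _ "1 :: real"] allI impI)
    show "0 < 4 * A + 3" using A0 by simp
    show "0 < (1 :: real)" by simp
    fix \<epsilon> :: real and S g u :: "real^3 \<Rightarrow> real^3 \<Rightarrow> real"
    assume e: "0 < \<epsilon> \<and> \<epsilon> < 1"
      and S2: "memL2 (phase_measure \<Omega>) (\<lambda>(x, w). S x w)"
      and Si: "memLinf (phase_measure \<Omega>) (\<lambda>(x, w). S x w)"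
      and gi: "memLinf (Gamma_minus_measure \<Omega>) (\<lambda>(x, w). g x w)"
      and sol: "is_solution \<Omega> \<epsilon> S g u"
    define q m G p where "q = L2norm (phase_measure \<Omega>) (\<lambda>(x, w). S x w)"
      and "m = real_of_ereal (Linf (phase_measure \<Omega>) (\<lambda>(x, w). S x w))"
      and "G = real_of_ereal (Linf (Gamma_minus_measure \<Omega>) (\<lambda>(x, w). g x w))"
      and "p = L2norm (Gamma_minus_weighted \<Omega>) (\<lambda>(x, w). g x w)"
    have m: "AE z in phase_measure \<Omega>. \<bar>S (fst z) (snd z)\<bar> \<le> m" "0 \<le> m"
      using memLinf_AE[OF Si] by (simp_all add: m_def split_beta')
    have G: "AE z in Gamma_minus_measure \<Omega>. \<bar>g (fst z) (snd z)\<bar> \<le> G" "0 \<le> G"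
      using memLinf_AE[OF gi] by (simp_all add: G_def split_beta')
    have qp: "0 \<le> \<epsilon> powr (-7/2) * q" "0 \<le> \<epsilon> powr (-2) * p" by (simp_all add: q_def p_def L2norm_def)
    have AE: "AE z in phase_measure \<Omega>. \<bar>u (fst z) (snd z)\<bar> \<le> G + (2 * (2 * A * \<epsilon> powr (-7/2) * q + m) + m)"
      using e sup_bound_of_solution[OF assms R A_def _ _ S2 m G sol] by (simp add: q_def)
    have le: "G + (2 * (2 * A * \<epsilon> powr (-7/2) * q + m) + m)
      \<le> (4 * A + 3) * (\<epsilon> powr (-7/2) * q + m + \<epsilon> powr (-2) * p + G)"
    proof -
      have "G + (2 * (2 * A * a + m) + m) \<le> (4 * A + 3) * (a + m + b + G)" if "0 \<le> a" "0 \<le> b" for a b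
      proof -
        have "0 \<le> 4 * A * (m + b + G) + 3 * a + 3 * b + 2 * G" using A0 m(2) G(2) that by simp
        then show ?thesis by (simp add: algebra_simps)
      qed
      from this[OF qp] show ?thesis by (simp add: mult.assoc)
    qed
    have "Linf (phase_measure \<Omega>) (\<lambda>(x, w). u x w)
      \<le> ereal ((4 * A + 3) * (\<epsilon> powr (-7/2) * q + m + \<epsilon> powr (-2) * p + G))"
      unfolding Linf_def
    proof (rule esssup_I)
      have "(\<lambda>(x, w). u x w) \<in> borel_measurable (phase_measure \<Omega>)"
        using sol by (simp add: is_solution_def memL2_def)
      then show "(\<lambda>z. ereal \<bar>case z of (x, w) \<Rightarrow> u x w\<bar>) \<in> borel_measurable (phase_measure \<Omega>)" by measurable
      show "AE z in phase_measure \<Omega>. ereal \<bar>case z of (x, w) \<Rightarrow> u x w\<bar>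
          \<le> ereal ((4 * A + 3) * (\<epsilon> powr (-7/2) * q + m + \<epsilon> powr (-2) * p + G))"
        using AE by (rule eventually_mono) (use le in \<open>auto simp: split_beta'\<close>)
    qed
    then show "Linf (phase_measure \<Omega>) (\<lambda>(x, w). u x w) \<le>
             ereal ((4 * A + 3) * (\<epsilon> powr (-7/2) * L2norm (phase_measure \<Omega>) (\<lambda>(x, w). S x w)
                       + real_of_ereal (Linf (phase_measure \<Omega>) (\<lambda>(x, w). S x w))
                       + \<epsilon> powr (-2) * L2norm (Gamma_minus_weighted \<Omega>) (\<lambda>(x, w). g x w)
                       + real_of_ereal (Linf (Gamma_minus_measure \<Omega>) (\<lambda>(x, w). g x w))))"
      by (simp only: q_def m_def G_def p_def)
  qed
qed

end
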